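(* Let $T>0$ and consider a solution $u=(\rho,v)$ of the original system $$\partial_t\rho+\partial_x m=0,\qquad \partial_t v+\partial_x h=-\gamma|v|v,\qquad 0<x<\ell,\ 0<t<T,$$ and a solution $\hat u=(\hat\rho,\hat v)$ of the observer system $$\partial_t\hat\rho+\partial_x\hat m=\mathcal L_\rho,\qquad \partial_t\hat v+\partial_x\hat h=-\gamma|\hat v|\hat v+\mathcal L_v,\qquad 0<x<\ell,\ 0<t<T,$$ with observer terms for velocity, density or mass flow measurements, with initial data $u_0$ and $\hat u_0$, respectively, and satisfying the boundary conditions $$m(t,0)=\hat m(t,0)=m_b(t),\qquad h(t,\ell)=\hat h(t,\ell)=h_b(t),\qquad 0\le t\le T.$$ Assume the following. (A1) $(\rho,v)\in\big(C^0([0,T];W^{1,\infty}(0,\ell))\cap W^{1,\infty}(0,T;L^\infty(0,\ell))\big)^2$ satisfies the original system pointwise almost everywhere, and there are $\underline\rho,\bar\rho,\tilde v>0$ with $0<\underline\rho\le\rho(t,x)\le\bar\rho$ and $-\tilde v\le v(t,x)\le\tilde v$ for all $0\le x\le\ell$, $0\le t\le T$. (A2) $\rho P''(\rho)\ge4|\tilde v|^2$ for all $\underline\rho\le\rho\le\bar\rho$. (A3) $(\hat\rho,\hat v)\in\big(C^0([0,T];W^{1,\infty}(0,\ell))\cap W^{1,\infty}(0,T;L^\infty(0,\ell))\big)^2$ satisfies $0<\underline\rho\le\hat\rho(t,x)\le\bar\rho$ and $-\tilde v\le\hat v(t,x)\le\tilde v$ for all $0\le x\le\ell$, $0\le t\le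 T$. (A4) The bounds $$\|\partial_t\rho\|_{L^\infty(0,T;L^\infty(0,\ell))}+\|\partial_tv\|_{L^\infty(0,T;L^\infty(0,\ell))}\le C_t,\qquad \|v\|_{L^\infty(0,T;L^\infty(0,\ell))},\ \|\hat v\|_{L^\infty(0,T;L^\infty(0,\ell))}\le\bar v$$ hold with $C_t,\bar v>0$ sufficiently small. Then there exist constants $C_1,C_2>0$ such that $$\|u(t,\cdot)-\hat u(t,\cdot)\|_{L^2(0,\ell)}\le C_1\|u_0-\hat u_0\|_{L^2(0,\ell)}\,e^{-C_2t}\qquad\text{for all }0\le t\le T.$$
   Context: $p:(0,\infty)\to\mathbb R$ is smooth and strictly monotone with $p'>0$; the pressure potential $P$ is smooth and strictly convex with $p'(\rho)=\rho P''(\rho)$; $\gamma\ge0$ is the friction coefficient and $\ell>0$ the pipe length. Notation: $m=\rho v$, $h=\frac12v^2+P'(\rho)$, $\hat m=\hat\rho\hat v$, $\hat h=\frac12\hat v^2+P'(\hat\rho)$. Observer terms (with nudging parameter $\mu>0$): for velocity measurements $\mathcal L_\rho=0$, $\mathcal L_v=\mu(v-\hat v)$; for density measurements $\mathcal L_\rho=\mu\frac{c}{\sqrt{p'(\hat\rho)}}\hat\rho\,(\tilde P(\rho)-\tilde P(\hat\rho))$, $\mathcal L_v=0$, where $c=\sqrt{p'(\rho_{\mathrm{ref}})}$ for a reference density $\rho_{\mathrm{ref}}>0$ and $\tilde P(\rho)=\int_{\rho_{\mathrm{ref}}}^\rho\frac{\sqrt{p'(s)}}{cs}\,ds$; for mass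 flow measurements $\mathcal L_\rho=0$, $\mathcal L_v=\mu(m-\hat m)$. *)

theory Defs
  imports "HOL-Analysis.Analysis" "HOL-Probability.Essential_Supremum"
begin

text \<open>
  Space-time functions are curried, time first: \<open>u t x\<close>. An element of a Sobolev space over
  a bounded interval is represented by its continuous representative on the closed interval, so
  that pointwise bounds, boundary values and initial values make sense. Elements of
  $L^\infty$ are represented by Borel functions.
\<close>

section \<open>Constitutive functions\<close>

definition smooth_pos :: "(real \<Rightarrow> real) \<Rightarrow> bool" where
  "smooth_pos f \<longleftrightarrow> (\<forall>n. \<forall>r>0. (deriv ^^ n) f differentiable (at r))"

definition strictly_convex_on :: "real set \<Rightarrow> (real \<Rightarrow> real) \<Rightarrow> bool" where
  "strictly_convex_on S f \<longleftrightarrow> convex S \<and>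
     (\<forall>x\<in>S. \<forall>y\<in>S. \<forall>s. x \<noteq> y \<and> 0 < s \<and> s < 1 \<longrightarrow>
        f ((1 - s) * x + s * y) < (1 - s) * f x + s * f y)"

definition mass_flow :: "real \<Rightarrow> real \<Rightarrow> real" where
  "mass_flow r w = r * w"

definition enthalpy :: "(real \<Rightarrow> real) \<Rightarrow> real \<Rightarrow> real \<Rightarrow> real" where
  "enthalpy P r w = w\<^sup>2 / 2 + deriv P r"


section \<open>Function spaces\<close>

subsection \<open>Functions of one variable\<close>

definition Linf_norm :: "real set \<Rightarrow> (real \<Rightarrow> real) \<Rightarrow> ereal" where
  "Linf_norm S f = esssup (restrict_space lborel S) (\<lambda>x. ereal \<bar>f x\<bar>)"

definition in_Linf :: "real set \<Rightarrow> (real \<Rightarrow> real) \<Rightarrow> bool" where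
  "in_Linf S f \<longleftrightarrow> f \<in> borel_measurable (restrict_space lborel S) \<and> Linf_norm S f < \<infinity>"

text \<open>Test functions are $\varphi \in C^1_c(a,b)$, given together with their derivative.\<close>

definition test_fun :: "real \<Rightarrow> real \<Rightarrow> (real \<Rightarrow> real) \<Rightarrow> (real \<Rightarrow> real) \<Rightarrow> bool" where
  "test_fun a b \<phi> \<phi>' \<longleftrightarrow>
     (\<forall>x. (\<phi> has_real_derivative \<phi>' x) (at x)) \<and> continuous_on UNIV \<phi>' \<and>
     (\<exists>K. compact K \<and> K \<subseteq> {a<..<b} \<and> (\<forall>x. x \<notin> K \<longrightarrow> \<phi> x = 0))"

definition has_weak_deriv :: "real \<Rightarrow> real \<Rightarrow> (real \<Rightarrow> real) \<Rightarrow> (real \<Rightarrow> real) \<Rightarrow> bool" where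
  "has_weak_deriv a b f g \<longleftrightarrow> (\<forall>\<phi> \<phi>'. test_fun a b \<phi> \<phi>' \<longrightarrow>
     (LINT x:{a<..<b}|lborel. \<phi>' x * f x) = - (LINT x:{a<..<b}|lborel. \<phi> x * g x))"

definition weak_deriv :: "real \<Rightarrow> real \<Rightarrow> (real \<Rightarrow> real) \<Rightarrow> real \<Rightarrow> real" where
  "weak_deriv a b f = (SOME g. in_Linf {a<..<b} g \<and> has_weak_deriv a b f g)"

definition in_W1inf :: "real \<Rightarrow> real \<Rightarrow> (real \<Rightarrow> real) \<Rightarrow> bool" where
  "in_W1inf a b f \<longleftrightarrow> continuous_on {a..b} f \<and> in_Linf {a<..<b} f \<and>
     (\<exists>g. in_Linf {a<..<b} g \<and> has_weak_deriv a b f g)"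

definition W1inf_norm :: "real \<Rightarrow> real \<Rightarrow> (real \<Rightarrow> real) \<Rightarrow> ereal" where
  "W1inf_norm a b f = Linf_norm {a<..<b} f + Linf_norm {a<..<b} (weak_deriv a b f)"

text \<open>The norm of $L^2(0,\ell)$ for functions with values in the Euclidean plane.\<close>

definition L2_norm :: "real \<Rightarrow> (real \<Rightarrow> real \<times> real) \<Rightarrow> real" where
  "L2_norm l f = sqrt (LINT x:{0<..<l}|lborel. (norm (f x))\<^sup>2)"


subsection \<open>Functions of time with values in a function space\<close>

definition C0_W1inf :: "real \<Rightarrow> real \<Rightarrow> (real \<Rightarrow> real \<Rightarrow> real) \<Rightarrow> bool" where
  "C0_W1inf T l u \<longleftrightarrow>
     (\<forall>t\<in>{0..T}. in_W1inf 0 l (u t)) \<and>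
     (\<forall>t\<in>{0..T}. ((\<lambda>s. W1inf_norm 0 l (\<lambda>x. u s x - u t x)) \<longlongrightarrow> 0) (at t within {0..T}))"

definition Linf_Linf_norm :: "real \<Rightarrow> real \<Rightarrow> (real \<Rightarrow> real \<Rightarrow> real) \<Rightarrow> ereal" where
  "Linf_Linf_norm T l u =
     esssup (restrict_space lborel {0<..<T}) (\<lambda>t. Linf_norm {0<..<l} (u t))"

text \<open>
  The Bochner space $L^\infty(0,T;L^\infty(0,\ell))$. The second conjunct is strong measurability
  of \<open>t \<mapsto> u t\<close> as a function into $L^\infty(0,\ell)$; the first one fixes a jointly measurable
  representative, which always exists for a strongly measurable function.
\<close>

definition in_Linf_Linf :: "real \<Rightarrow> real \<Rightarrow> (real \<Rightarrow> real \<Rightarrow> real) \<Rightarrow> bool" where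
  "in_Linf_Linf T l u \<longleftrightarrow>
     (\<lambda>(t, x). u t x) \<in> borel_measurable (restrict_space lborel ({0<..<T} \<times> {0<..<l})) \<and>
     (\<exists>s :: nat \<Rightarrow> real \<Rightarrow> real \<Rightarrow> real.
        (\<forall>n. simple_function (restrict_space lborel {0<..<T}) (s n)) \<and>
        (\<forall>n. \<forall>t\<in>{0<..<T}. in_Linf {0<..<l} (s n t)) \<and>
        (AE t in restrict_space lborel {0<..<T}.
           (\<lambda>n. Linf_norm {0<..<l} (\<lambda>x. s n t x - u t x)) \<longlonglongrightarrow> 0)) \<and>
     Linf_Linf_norm T l u < \<infinity>"

text \<open>
  The identity $\int_0^T \varphi'(t) u(t)\,dt = -\int_0^T \varphi(t) g(t)\,dt$ between elements of
  $L^\infty(0,\ell)$, that is, up to a null set of points \<open>x\<close>, which may depend on \<open>\<phi>\<close>.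
\<close>

definition has_weak_time_deriv ::
    "real \<Rightarrow> real \<Rightarrow> (real \<Rightarrow> real \<Rightarrow> real) \<Rightarrow> (real \<Rightarrow> real \<Rightarrow> real) \<Rightarrow> bool" where
  "has_weak_time_deriv T l u g \<longleftrightarrow> (\<forall>\<phi> \<phi>'. test_fun 0 T \<phi> \<phi>' \<longrightarrow>
     (AE x in restrict_space lborel {0<..<l}.
        (LINT t:{0<..<T}|lborel. \<phi>' t * u t x) = - (LINT t:{0<..<T}|lborel. \<phi> t * g t x)))"

definition weak_time_deriv ::
    "real \<Rightarrow> real \<Rightarrow> (real \<Rightarrow> real \<Rightarrow> real) \<Rightarrow> real \<Rightarrow> real \<Rightarrow> real" where
  "weak_time_deriv T l u = (SOME g. in_Linf_Linf T l g \<and> has_weak_time_deriv T l u g)"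

definition W1inf_Linf :: "real \<Rightarrow> real \<Rightarrow> (real \<Rightarrow> real \<Rightarrow> real) \<Rightarrow> bool" where
  "W1inf_Linf T l u \<longleftrightarrow> in_Linf_Linf T l u \<and>
     (\<exists>g. in_Linf_Linf T l g \<and> has_weak_time_deriv T l u g)"

definition regular :: "real \<Rightarrow> real \<Rightarrow> (real \<Rightarrow> real \<Rightarrow> real) \<Rightarrow> bool" where
  "regular T l u \<longleftrightarrow> C0_W1inf T l u \<and> W1inf_Linf T l u"


section \<open>The original system and the observer system\<close>

text \<open>
  $\partial_t\rho + \partial_x m = f$ and $\partial_t v + \partial_x h = -\gamma|v|v + g$, pointwise
  for almost every $(t,x)$. Functions in the class \<open>regular\<close> are Lipschitz continuous, so the
  classical partial derivatives used here exist and equal the weak ones almost everywhere.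
\<close>

definition solves_system ::
    "(real \<Rightarrow> real) \<Rightarrow> real \<Rightarrow> real \<Rightarrow> real \<Rightarrow> (real \<Rightarrow> real \<Rightarrow> real) \<Rightarrow> (real \<Rightarrow> real \<Rightarrow> real) \<Rightarrow>
     (real \<Rightarrow> real \<Rightarrow> real) \<Rightarrow> (real \<Rightarrow> real \<Rightarrow> real) \<Rightarrow> bool" where
  "solves_system P \<gamma> l T f g \<rho> v \<longleftrightarrow>
     (AE (t, x) in lborel. t \<in> {0<..<T} \<and> x \<in> {0<..<l} \<longrightarrow>
       (\<exists>\<rho>\<^sub>t m\<^sub>x v\<^sub>t h\<^sub>x.
          ((\<lambda>s. \<rho> s x) has_real_derivative \<rho>\<^sub>t) (at t) \<and>
          ((\<lambda>y. mass_flow (\<rho> t y) (v t y)) has_real_derivative m\<^sub>x) (at x) \<and>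
          ((\<lambda>s. v s x) has_real_derivative v\<^sub>t) (at t) \<and>
          ((\<lambda>y. enthalpy P (\<rho> t y) (v t y)) has_real_derivative h\<^sub>x) (at x) \<and>
          \<rho>\<^sub>t + m\<^sub>x = f t x \<and>
          v\<^sub>t + h\<^sub>x = - \<gamma> * \<bar>v t x\<bar> * v t x + g t x))"

datatype measurement = Velocity | Density | Mass_Flow

text \<open>The integral is oriented, so it is negative for \<open>r < r\<^sub>r\<^sub>e\<^sub>f\<close>.\<close>

definition P_tilde :: "(real \<Rightarrow> real) \<Rightarrow> real \<Rightarrow> real \<Rightarrow> real" where
  "P_tilde p r\<^sub>r\<^sub>e\<^sub>f r =
     (LBINT s=ereal r\<^sub>r\<^sub>e\<^sub>f..ereal r. sqrt (deriv p s) / (sqrt (deriv p r\<^sub>r\<^sub>e\<^sub>f) * s))"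

fun obs_term_\<rho> :: "measurement \<Rightarrow> (real \<Rightarrow> real) \<Rightarrow> real \<Rightarrow> real \<Rightarrow> real \<Rightarrow> real \<Rightarrow> real" where
  "obs_term_\<rho> Density p r\<^sub>r\<^sub>e\<^sub>f \<mu> r r' =
     \<mu> * (sqrt (deriv p r\<^sub>r\<^sub>e\<^sub>f) / sqrt (deriv p r')) * r' * (P_tilde p r\<^sub>r\<^sub>e\<^sub>f r - P_tilde p r\<^sub>r\<^sub>e\<^sub>f r')"
| "obs_term_\<rho> _ p r\<^sub>r\<^sub>e\<^sub>f \<mu> r r' = 0"

fun obs_term_v :: "measurement \<Rightarrow> real \<Rightarrow> real \<Rightarrow> real \<Rightarrow> real \<Rightarrow> real \<Rightarrow> real" where
  "obs_term_v Velocity \<mu> r w r' w' = \<mu> * (w - w')"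
| "obs_term_v Mass_Flow \<mu> r w r' w' = \<mu> * (mass_flow r w - mass_flow r' w')"
| "obs_term_v Density \<mu> r w r' w' = 0"

definition solves_original ::
    "(real \<Rightarrow> real) \<Rightarrow> real \<Rightarrow> real \<Rightarrow> real \<Rightarrow>
     (real \<Rightarrow> real \<Rightarrow> real) \<Rightarrow> (real \<Rightarrow> real \<Rightarrow> real) \<Rightarrow> bool" where
  "solves_original P \<gamma> l T \<rho> v \<longleftrightarrow> solves_system P \<gamma> l T (\<lambda>t x. 0) (\<lambda>t x. 0) \<rho> v"

text \<open>\<open>(\<rho>, v)\<close> is the observed solution and \<open>(\<rho>', v')\<close> the state of the observer.\<close>

definition solves_observer ::
    "measurement \<Rightarrow> (real \<Rightarrow> real) \<Rightarrow> (real \<Rightarrow> real) \<Rightarrow> real \<Rightarrow> real \<Rightarrow> real \<Rightarrow> real \<Rightarrow> real \<Rightarrow>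
     (real \<Rightarrow> real \<Rightarrow> real) \<Rightarrow> (real \<Rightarrow> real \<Rightarrow> real) \<Rightarrow>
     (real \<Rightarrow> real \<Rightarrow> real) \<Rightarrow> (real \<Rightarrow> real \<Rightarrow> real) \<Rightarrow> bool" where
  "solves_observer meas p P r\<^sub>r\<^sub>e\<^sub>f \<mu> \<gamma> l T \<rho> v \<rho>' v' \<longleftrightarrow>
     solves_system P \<gamma> l T
       (\<lambda>t x. obs_term_\<rho> meas p r\<^sub>r\<^sub>e\<^sub>f \<mu> (\<rho> t x) (\<rho>' t x))
       (\<lambda>t x. obs_term_v meas \<mu> (\<rho> t x) (v t x) (\<rho>' t x) (v' t x)) \<rho>' v'"

end

(*
  The distance of the observer (rho', v') from the solution (rho, v) is measured by the relative
  energy. Writing R, V, M, H for the errors in density, velocity, mass flow and enthalpy, its time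
  derivative is -(H M)_x plus the observer and friction terms plus a remainder that is quadratic in
  (R, V) with a factor rho_t or v_t; in particular no derivative of the observer state remains. The
  flux H M vanishes at both ends, and the observer term damps one of R and V. Damping of the other
  one comes from adding e times the integral of V Phi, where Phi(x) is the integral of R over
  (0, x): its derivative contains H R - V M, and the sign of e decides which of the two is damped
  (e < 0 for velocity and mass flow, e > 0 for density measurements). The boundary terms vanish
  again since H(l) = 0 and Phi(0) = 0. All other terms are small with C_t and the velocity bound,
  so that the functional satisfies a differential inequality; it is Lipschitz in time and thus the
  inequality, which holds for almost every time, can be integrated.
*)
theory Submission
  imports Defs
begin

section \<open>Lipschitz functions and integrals\<close>

text \<open>The relative energy is the Bregman distance of the energy density \<rho> v^2/2 +
  P(\<rho>), whose partial derivatives are enthalpy and mass flow. Hence its time derivative is H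
  R_t + M V_t up to second order terms, and inserting R_t = -M_x + ..., V_t = -H_x + ... makes the
  principal part an exact x-derivative. The obstacle is regularity: derivatives exist only almost
  everywhere, and the assumptions speak of weak derivatives and essential suprema. Everything is
  therefore reduced to Lipschitz functions: bounded weak derivatives give Lipschitz bounds with the
  same constant, and Lipschitz functions obey the fundamental theorem. The order of the choices
  matters: e depends only on the damping, the length and the bounds of the state, so it is fixed
  first; the single small number d, which bounds C_t and the velocities, comes afterwards, and terms
  with a factor d are absorbed by damping already gained. \<Phi> is nonlocal, but Cauchy-Schwarz
  bounds its square by l times the integral of R^2, which keeps the estimates pointwise up to one
  number N.\<close>

lemma dominated_convergence_negligible:
  fixes f :: "nat \<Rightarrow> 'n::euclidean_space \<Rightarrow> 'm::euclidean_space"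
  assumes N: "negligible N" and f: "\<And>k. f k integrable_on S" and h: "h integrable_on S"
    and le: "\<And>k x. x \<in> S - N \<Longrightarrow> norm (f k x) \<le> h x"
    and conv: "\<And>x. x \<in> S - N \<Longrightarrow> (\<lambda>k. f k x) \<longlonglongrightarrow> g x"
  shows "g integrable_on S" "(\<lambda>k. integral S (f k)) \<longlonglongrightarrow> integral S g"
proof -
  \<comment> \<open>Dominated convergence asks for its hypotheses at every point; the factor
    \<open>c\<close> switches all functions off on \<open>N\<close> without changing an
    integral.\<close>
  define c where "c x = (if x \<in> N then 0 else 1::real)" for x
  have f': "(\<lambda>x. c x *\<^sub>R f k x) integrable_on S" for k
    by (rule integrable_spike[OF f N]) (auto simp: c_def)
  have h': "(\<lambda>x. c x * h x) integrable_on S"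
    by (rule integrable_spike[OF h N]) (auto simp: c_def)
  have le': "norm (c x *\<^sub>R f k x) \<le> c x * h x" if "x \<in> S" for k x
    using le[of x k] that by (auto simp: c_def)
  have conv': "(\<lambda>k. c x *\<^sub>R f k x) \<longlonglongrightarrow> c x *\<^sub>R g x" if "x \<in> S" for x
    using conv[of x] that by (auto simp: c_def)
  note D = dominated_convergence[OF f' h' le' conv', simplified]
  show "g integrable_on S"
    by (rule integrable_spike[OF D(1) N]) (auto simp: c_def)
  have 1: "integral S (\<lambda>x. c x *\<^sub>R f k x) = integral S (f k)" for k
    by (rule integral_spike[OF N]) (auto simp: c_def)
  have 2: "integral S (\<lambda>x. c x *\<^sub>R g x) = integral S g"
    by (rule integral_spike[OF N]) (auto simp: c_def)
  show "(\<lambda>k. integral S (f k)) \<longlonglongrightarrow> integral S g"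
    using D(2) by (simp add: 1 2)
qed

text \<open>The difference quotients are dominated by the constant \<open>K\<close>, so dominated
  convergence applies. It works with sequences, hence the derivative is tested along arbitrary null
  sequences \<open>X\<close>; integrability of \<open>f'\<close> is a by-product of any one of
  them.\<close>

lemma has_real_derivative_integral:
  fixes f :: "real \<Rightarrow> 'n::euclidean_space \<Rightarrow> real"
  assumes d: "0 < d" and int: "\<And>t. \<bar>t - t0\<bar> < d \<Longrightarrow> f t integrable_on S"
    and K: "(\<lambda>x. K) integrable_on S"
    and lip: "\<And>t x. \<bar>t - t0\<bar> < d \<Longrightarrow> x \<in> S \<Longrightarrow> \<bar>f t x - f t0 x\<bar> \<le> K * \<bar>t - t0\<bar>"
    and N: "negligible N"
    and der: "\<And>x. x \<in> S - N \<Longrightarrow> ((\<lambda>t. f t x) has_real_derivative f' x) (at t0)"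
  shows "f' integrable_on S"
    "((\<lambda>t. integral S (f t)) has_real_derivative integral S f') (at t0)"
proof -
  have main: "f' integrable_on S \<and>
      (\<lambda>n. (integral S (f (t0 + X n)) - integral S (f t0)) / X n) \<longlonglongrightarrow> integral S f'"
    if X: "\<And>n. X n \<in> {-d<..<d} - {0}" "X \<longlonglongrightarrow> 0" for X :: "nat \<Rightarrow> real"
  proof -
    have i: "f (t0 + X n) integrable_on S" "f t0 integrable_on S" for n
      using X(1)[of n] d by (auto intro!: int)
    have 1: "(\<lambda>x. (f (t0 + X n) x - f t0 x) / X n) integrable_on S" for n
      using i integrable_diff integrable_on_divide by blast
    have 2: "norm ((f (t0 + X n) x - f t0 x) / X n) \<le> K" if "x \<in> S - N" for n x
      using lip[of "t0 + X n" x] X(1)[of n] that by (auto simp: abs_divide divide_le_eq)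
    have 3: "(\<lambda>n. (f (t0 + X n) x - f t0 x) / X n) \<longlonglongrightarrow> f' x" if "x \<in> S - N" for x
    proof -
      have "((\<lambda>h. (f (t0 + h) x - f t0 x) / h) \<longlongrightarrow> f' x) (at 0)"
        using der[OF that] by (simp add: DERIV_def)
      moreover have "filterlim X (at 0) sequentially"
        using X by (auto simp: filterlim_at intro!: always_eventually)
      ultimately show ?thesis by (rule filterlim_compose)
    qed
    note D = dominated_convergence_negligible[OF N 1 K 2 3]
    have eq: "integral S (\<lambda>x. (f (t0 + X n) x - f t0 x) / X n)
        = (integral S (f (t0 + X n)) - integral S (f t0)) / X n" for n
      using integral_diff[OF i] by simp
    show ?thesis using D unfolding eq by blast
  qed
  \<comment> \<open>A concrete null sequence that supplies the integrability of \<open>f'\<close>;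
    the denominator \<open>2 + real n\<close> keeps even the first term strictly below
    \<open>d\<close>.\<close>
  have X0: "d / (2 + real n) \<in> {-d<..<d} - {0}" for n
  proof -
    have "0 < d / (2 + real n)" "d / (2 + real n) < d"
      using d by (auto simp: divide_simps)
    then show ?thesis by auto
  qed
  have "(\<lambda>n. d / (2 + real n)) \<longlonglongrightarrow> 0"
    by real_asymp
  from main[OF X0 this] show "f' integrable_on S" by simp
  have "((\<lambda>h. (integral S (f (t0 + h)) - integral S (f t0)) / h) \<longlongrightarrow> integral S f')
      (at 0 within {-d<..<d})"
    unfolding tendsto_at_iff_sequentially o_def using main by blast
  then show "((\<lambda>t. integral S (f t)) has_real_derivative integral S f') (at t0)"
    using d by (simp add: DERIV_def at_within_open[of 0 "{-d<..<d}"])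
qed

lemma lipschitz_derivative_bound:
  assumes "(f has_real_derivative D) (at x)" "a < x" "x < b"
    and lip: "\<And>y. a < y \<Longrightarrow> y < b \<Longrightarrow> \<bar>f y - f x\<bar> \<le> K * \<bar>y - x\<bar>"
  shows "\<bar>D\<bar> \<le> K"
proof -
  have "((\<lambda>y. (f y - f x) / (y - x)) \<longlongrightarrow> D) (at x)"
    using assms(1) by (simp add: has_field_derivative_iff)
  then have t: "((\<lambda>y. \<bar>(f y - f x) / (y - x)\<bar>) \<longlongrightarrow> \<bar>D\<bar>) (at x)"
    by (rule tendsto_rabs)
  have "\<forall>\<^sub>F y in at x. y \<in> {a<..<b} - {x}"
    using assms(2,3) eventually_at_in_open[of "{a<..<b}" x] by simp
  then have "\<forall>\<^sub>F y in at x. \<bar>(f y - f x) / (y - x)\<bar> \<le> K"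
    by eventually_elim (use lip in \<open>auto simp: abs_divide divide_le_eq\<close>)
  with t show ?thesis
    by (rule tendsto_upperbound) simp
qed

text \<open>The integral of the translates \<open>g (x + t)\<close> over {a..b} is differentiated at
  t = 0 in two ways: under the integral sign it gives the integral of \<open>f'\<close>, and as a
  difference of values of the antiderivative \<open>I\<close> it gives \<open>g b - g a\<close>.
  Uniqueness of the derivative replaces any appeal to absolute continuity.\<close>

lemma lipschitz_FTC:
  fixes f f' :: "real \<Rightarrow> real"
  assumes ab: "a \<le> b" and lip: "\<And>x y. x \<in> {a..b} \<Longrightarrow> y \<in> {a..b} \<Longrightarrow> \<bar>f x - f y\<bar> \<le> K * \<bar>x - y\<bar>"
    and N: "negligible N"
    and der: "\<And>x. x \<in> {a<..<b} - N \<Longrightarrow> (f has_real_derivative f' x) (at x)"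
  shows "(f' has_integral f b - f a) {a..b}"
proof (cases "a = b")
  case False
  with ab have ab: "a < b" by simp
  \<comment> \<open>Constant continuation beyond the end points, so that all translates are defined
    and share the Lipschitz constant \<open>K\<close>.\<close>
  define g where "g x = f (max a (min b x))" for x
  have K0: "0 \<le> K"
  proof -
    have "0 \<le> K * \<bar>a - b\<bar>"
      using lip[of a b] ab by (simp add: order_trans[OF abs_ge_zero])
    then show ?thesis
      using ab by (simp add: zero_le_mult_iff)
  qed
  have glip: "\<bar>g x - g y\<bar> \<le> K * \<bar>x - y\<bar>" for x y
  proof -
    have "\<bar>g x - g y\<bar> \<le> K * \<bar>max a (min b x) - max a (min b y)\<bar>"
      unfolding g_def using ab by (intro lip) auto
    also have "\<dots> \<le> K * \<bar>x - y\<bar>"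
      using K0 ab by (intro mult_left_mono) (auto simp: max_def min_def)
    finally show ?thesis .
  qed
  have "K-lipschitz_on UNIV g"
    using glip K0 by (auto simp: lipschitz_on_def dist_real_def)
  then have cont: "continuous_on A g" for A
    using lipschitz_on_continuous_on continuous_on_subset by blast
  have gder: "((\<lambda>t. g (x + t)) has_real_derivative f' x) (at 0)"
    if "x \<in> {a..b} - (N \<union> {a, b})" for x
  proof -
    have x: "x \<in> {a<..<b} - N" using that by auto
    have "(g has_real_derivative f' x) (at x)"
      by (rule DERIV_cong_ev[THEN iffD1, OF refl _ refl der[OF x]])
        (use x in \<open>auto simp: g_def max_def min_def
           intro!: eventually_mono[OF eventually_nhds_in_open[of "{a<..<b}" x]]\<close>)
    then show ?thesis
      by (simp add: DERIV_shift[of g _ 0 x, simplified] add.commute)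
  qed
  have i: "(\<lambda>x. g (x + t)) integrable_on {a..b}" for t
    by (intro integrable_continuous_real continuous_on_compose2[OF cont[of UNIV]] continuous_intros) auto
  \<comment> \<open>The continuation has kinks at \<open>a\<close> and \<open>b\<close> in
    general.\<close>
  have N': "negligible (N \<union> {a, b})"
    using N by simp
  have "((\<lambda>t. integral {a..b} (\<lambda>x. g (x + t))) has_real_derivative integral {a..b} f') (at 0)"
    and f'int: "f' integrable_on {a..b}"
  proof -
    have c: "(\<lambda>x. K) integrable_on {a..b}" by (rule integrable_const_ivl)
    have l: "\<bar>g (x + t) - g (x + 0)\<bar> \<le> K * \<bar>t - 0\<bar>" for x t
      using glip[of "x + t" "x + 0"] by simp
    note D = has_real_derivative_integral[where f="\<lambda>t x. g (x + t)" and ?t0.0=0,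
        OF zero_less_one i c l N' gder]
    show "f' integrable_on {a..b}" by (rule D(1))
    show "((\<lambda>t. integral {a..b} (\<lambda>x. g (x + t))) has_real_derivative integral {a..b} f') (at 0)"
      by (rule D(2))
  qed
  \<comment> \<open>Starting at \<open>a - 1\<close> makes \<open>I\<close> differentiable around
    both \<open>a\<close> and \<open>b\<close>.\<close>
  define I where "I y = integral {a-1..y} g" for y
  have I: "(I has_real_derivative g y) (at y)" if "a - 1 < y" "y < b + 1" for y
  proof -
    have "(I has_real_derivative g y) (at y within {a-1..b+1})"
      unfolding I_def using that by (intro integral_has_real_derivative cont) auto
    then show ?thesis
      using that by (simp add: at_within_Icc_at)
  qed
  have eq: "integral {a..b} (\<lambda>x. g (x + t)) = I (b + t) - I (a + t)" if "\<bar>t\<bar> < 1" for t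
  proof -
    have "integral {a..b} (\<lambda>x. g (x + t)) = integral {a+t..b+t} g"
      using integral_shift[of a t b g] cont by (simp add: o_def)
    moreover have "integral {a-1..a+t} g + integral {a+t..b+t} g = integral {a-1..b+t} g"
      using that ab by (intro Henstock_Kurzweil_Integration.integral_combine integrable_continuous_real cont) auto
    ultimately show ?thesis by (simp add: I_def)
  qed
  have "((\<lambda>t. I (b + t) - I (a + t)) has_real_derivative g b - g a) (at 0)"
  proof (rule DERIV_diff)
    show "((\<lambda>t. I (b + t)) has_real_derivative g b) (at 0)"
      using I[of b] ab by (simp add: DERIV_shift[of I _ 0 b, simplified] add.commute)
    show "((\<lambda>t. I (a + t)) has_real_derivative g a) (at 0)"
      using I[of a] ab by (simp add: DERIV_shift[of I _ 0 a, simplified] add.commute)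
  qed
  then have "((\<lambda>t. integral {a..b} (\<lambda>x. g (x + t))) has_real_derivative g b - g a) (at 0)"
    by (rule DERIV_cong_ev[THEN iffD1, OF refl _ refl, rotated])
      (auto simp: eq intro!: eventually_mono[OF eventually_nhds_in_open[of "{-1<..<1::real}" 0]])
  with \<open>((\<lambda>t. integral {a..b} (\<lambda>x. g (x + t))) has_real_derivative integral {a..b} f') (at 0)\<close>
  have "integral {a..b} f' = g b - g a"
    by (rule DERIV_unique)
  then show ?thesis
    using f'int ab by (auto simp: has_integral_iff g_def)
qed auto

text \<open>Gronwall for a Lipschitz function: \<open>f t * exp (c * t)\<close> is again Lipschitz
  and its derivative, which exists off a null set, is nonpositive there, so
  \<open>lipschitz_FTC\<close> keeps it below its initial value.\<close>

lemma lipschitz_exp_decay: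
  fixes f :: "real \<Rightarrow> real"
  assumes lip: "\<And>s t. s \<in> {0..T} \<Longrightarrow> t \<in> {0..T} \<Longrightarrow> \<bar>f s - f t\<bar> \<le> K * \<bar>s - t\<bar>"
    and N: "negligible N"
    and der: "\<And>t. t \<in> {0<..<T} - N \<Longrightarrow> \<exists>D. (f has_real_derivative D) (at t) \<and> D \<le> - c * f t"
    and t: "t \<in> {0..T}"
  shows "f t \<le> f 0 * exp (- c * t)"
proof -
  have fb: "\<exists>B. \<forall>s\<in>{0..t}. \<bar>f s\<bar> \<le> B"
  proof (intro exI ballI)
    fix s assume "s \<in> {0..t}"
    then have s: "s \<in> {0..T}" "\<bar>s\<bar> \<le> t" "0 \<in> {0..T}" using t by auto
    have "\<bar>f s - f 0\<bar> \<le> \<bar>K\<bar> * \<bar>s\<bar>"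
      using lip[OF s(1,3)] mult_right_mono[OF abs_ge_self[of K] abs_ge_zero[of s]] by simp
    also have "\<dots> \<le> \<bar>K\<bar> * t" using s by (intro mult_left_mono) auto
    finally show "\<bar>f s\<bar> \<le> \<bar>f 0\<bar> + \<bar>K\<bar> * t" by linarith
  qed
  then obtain B where B: "\<And>s. s \<in> {0..t} \<Longrightarrow> \<bar>f s\<bar> \<le> B" by blast
  define L where "L = \<bar>c\<bar> * exp (\<bar>c\<bar> * t)"
  have elip: "\<bar>exp (c * r) - exp (c * s)\<bar> \<le> L * \<bar>r - s\<bar>" if "r \<in> {0..t}" "s \<in> {0..t}" for r s
  proof -
    have "norm (exp (c * r) - exp (c * s)) \<le> L * norm (r - s)"
    proof (rule field_differentiable_bound[of "{0..t}" "\<lambda>s. exp (c * s)" "\<lambda>s. c * exp (c * s)"])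
      fix z assume z: "z \<in> {0..t}"
      show "((\<lambda>s. exp (c * s)) has_field_derivative c * exp (c * z)) (at z within {0..t})"
        by (auto intro!: derivative_eq_intros)
      have "c * z \<le> \<bar>c\<bar> * t"
        using z mult_right_mono[OF abs_ge_self[of c], of z] mult_left_mono[of z t "\<bar>c\<bar>"] by auto
      then show "norm (c * exp (c * z)) \<le> L"
        by (simp add: L_def abs_mult mult_left_mono)
    qed (use that in auto)
    then show ?thesis by simp
  qed
  define E where "E = exp (\<bar>c\<bar> * t)"
  have Eb: "\<bar>exp (c * s)\<bar> \<le> E" if "s \<in> {0..t}" for s
    using that mult_right_mono[OF abs_ge_self[of c], of s] mult_left_mono[of s t "\<bar>c\<bar>"]
    by (auto simp: E_def)
  have glip: "\<bar>f r * exp (c * r) - f s * exp (c * s)\<bar> \<le> (\<bar>K\<bar> * E + B * L) * \<bar>r - s\<bar>"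
    if rs: "r \<in> {0..t}" "s \<in> {0..t}" for r s
  proof -
    have "f r * exp (c * r) - f s * exp (c * s)
        = (f r - f s) * exp (c * r) + f s * (exp (c * r) - exp (c * s))"
      by (simp add: algebra_simps)
    also have "\<bar>\<dots>\<bar> \<le> \<bar>f r - f s\<bar> * \<bar>exp (c * r)\<bar> + \<bar>f s\<bar> * \<bar>exp (c * r) - exp (c * s)\<bar>"
      by (rule order_trans[OF abs_triangle_ineq]) (simp add: abs_mult)
    also have "\<dots> \<le> (\<bar>K\<bar> * \<bar>r - s\<bar>) * E + B * (L * \<bar>r - s\<bar>)"
    proof (intro add_mono mult_mono)
      have "\<bar>f r - f s\<bar> \<le> K * \<bar>r - s\<bar>"
        using rs t by (intro lip) auto
      also have "\<dots> \<le> \<bar>K\<bar> * \<bar>r - s\<bar>" by (intro mult_right_mono) auto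
      finally show "\<bar>f r - f s\<bar> \<le> \<bar>K\<bar> * \<bar>r - s\<bar>" .
    qed (use rs B[OF rs(2)] Eb[OF rs(1)] elip[OF rs] abs_ge_zero[of "f s"] abs_ge_zero[of "f r"] in \<open>auto\<close>)
    finally show ?thesis by (simp add: algebra_simps)
  qed
  \<comment> \<open>The value 0 on the exceptional set makes \<open>g'\<close> nonpositive on the
    whole interval, as the comparison of integrals requires.\<close>
  define g' where "g' s = (if s \<in> N \<union> {0, t} then 0 else deriv (\<lambda>s. f s * exp (c * s)) s)" for s
  have N': "negligible (N \<union> {0, t})" using N by simp
  have gd: "((\<lambda>s. f s * exp (c * s)) has_real_derivative g' s) (at s) \<and> g' s \<le> 0"
    if s: "s \<in> {0<..<t} - (N \<union> {0, t})" for s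
  proof -
    obtain D where D: "(f has_real_derivative D) (at s)" "D \<le> - c * f s"
      using der[of s] s t by auto
    have "((\<lambda>s. f s * exp (c * s)) has_real_derivative (D + c * f s) * exp (c * s)) (at s)"
      using D(1) by (auto intro!: derivative_eq_intros simp: algebra_simps)
    moreover from this have "g' s = (D + c * f s) * exp (c * s)"
      using s by (simp add: g'_def DERIV_imp_deriv)
    moreover have "(D + c * f s) * exp (c * s) \<le> 0"
      using D(2) by (intro mult_nonpos_nonneg) auto
    ultimately show ?thesis by simp
  qed
  have "(g' has_integral f t * exp (c * t) - f 0 * exp (c * 0)) {0..t}"
    using t gd by (intro lipschitz_FTC[OF _ glip N']) auto
  moreover have "g' s \<le> 0" if "s \<in> {0..t}" for s
    using gd[of s] that by (cases "s \<in> N \<union> {0, t}") (auto simp: g'_def)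
  ultimately have "f t * exp (c * t) - f 0 * exp (c * 0) \<le> 0"
    by (metis has_integral_le has_integral_0)
  then show ?thesis
    by (simp add: exp_minus field_simps)
qed

section \<open>Weak derivatives of Lipschitz functions\<close>

text \<open>Triangle of height 2 and area 1 over {0..1}. As a combination of positive parts it is
  continuous without case distinctions, and integrating term by term gives
  \<open>smoothstep\<close>, a piecewise quadratic step from 0 to 1 that is just smooth enough for
  \<open>test_fun\<close>.\<close>

definition tent :: "real \<Rightarrow> real" where
  "tent x = 4 * (max 0 x - 2 * max 0 (x - 1/2) + max 0 (x - 1))"

definition smoothstep :: "real \<Rightarrow> real" where
  "smoothstep x = 2 * (max 0 x)\<^sup>2 - 4 * (max 0 (x - 1/2))\<^sup>2 + 2 * (max 0 (x - 1))\<^sup>2"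

lemma has_real_derivative_max_0_square:
  "((\<lambda>x. (max 0 x)\<^sup>2) has_real_derivative 2 * max 0 x) (at (x::real))"
proof -
  consider "x > 0" | "x < 0" | "x = 0" by linarith
  then show ?thesis
  proof cases
    case 1
    have "((\<lambda>x. x\<^sup>2) has_real_derivative 2 * max 0 x) (at x)"
      using 1 by (auto intro!: derivative_eq_intros)
    then show ?thesis
      by (rule DERIV_cong_ev[THEN iffD1, OF refl _ refl, rotated])
        (use 1 in \<open>auto intro!: eventually_mono[OF eventually_nhds_in_open[of "{0<..}" x]]\<close>)
  next
    case 2
    have "((\<lambda>x. 0) has_real_derivative 2 * max 0 x) (at x)"
      using 2 by (auto intro!: derivative_eq_intros)
    then show ?thesis
      by (rule DERIV_cong_ev[THEN iffD1, OF refl _ refl, rotated])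
        (use 2 in \<open>auto intro!: eventually_mono[OF eventually_nhds_in_open[of "{..<0}" x]]\<close>)
  next
    case 3
    have "((\<lambda>y::real. max 0 y) \<longlongrightarrow> max 0 0) (at 0)"
      by (intro tendsto_intros)
    moreover have "(max 0 y)\<^sup>2 / y = max 0 y" if "y \<noteq> 0" for y :: real
      using that by (auto simp: max_def power2_eq_square)
    ultimately have "((\<lambda>y::real. ((max 0 y)\<^sup>2 - (max 0 0)\<^sup>2) / (y - 0)) \<longlongrightarrow> 2 * max 0 0) (at 0)"
      by (auto simp: eventually_at_filter elim!: Lim_transform_eventually)
    then show ?thesis
      unfolding 3 has_field_derivative_iff .
  qed
qed

lemma smoothstep_deriv:
  "((\<lambda>x. smoothstep ((x - s) / h)) has_real_derivative tent ((x - s) / h) / h) (at x)"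
proof -
  have c: "((\<lambda>x. (max 0 ((x - s) / h - c))\<^sup>2) has_real_derivative 2 * max 0 ((x - s) / h - c) * (1 / h)) (at x)" for c
    using DERIV_diff[OF DERIV_cdivide[OF DERIV_diff[OF DERIV_ident DERIV_const]] DERIV_const]
    by (intro DERIV_chain2[OF has_real_derivative_max_0_square]) simp
  show ?thesis
    unfolding smoothstep_def tent_def
    using DERIV_add[OF DERIV_diff[OF DERIV_cmult[OF c[of 0], of 2] DERIV_cmult[OF c[of "1/2"], of 4]]
        DERIV_cmult[OF c[of 1], of 2]]
    by (simp add: algebra_simps add_divide_distrib diff_divide_distrib)
qed

lemma tent_nonneg: "0 \<le> tent x"
  by (auto simp: tent_def max_def)

lemma tent_eq_0: "x \<le> 0 \<or> 1 \<le> x \<Longrightarrow> tent x = 0"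
  by (auto simp: tent_def max_def)

lemma smoothstep_eq_0: "x \<le> 0 \<Longrightarrow> smoothstep x = 0"
  by (auto simp: smoothstep_def max_def)

lemma smoothstep_eq_1: "1 \<le> x \<Longrightarrow> smoothstep x = 1"
  by (auto simp: smoothstep_def max_def power2_eq_square algebra_simps)

lemma smoothstep_mono: "x \<le> y \<Longrightarrow> smoothstep x \<le> smoothstep y"
proof (rule DERIV_nonneg_imp_nondecreasing[of x y smoothstep])
  fix z
  show "\<exists>D. (smoothstep has_real_derivative D) (at z) \<and> 0 \<le> D"
    using smoothstep_deriv[of 0 1 z] tent_nonneg[of z] by auto
qed auto

lemma continuous_on_tent: "continuous_on A (\<lambda>x. tent ((x - s) / h))"
  unfolding tent_def divide_inverse by (intro continuous_intros)

text \<open>A $C^1$ approximation of the indicator function of \<open>{s..t}\<close>; the derivative approximates the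
  difference of the Dirac measures at \<open>s\<close> and \<open>t\<close>.\<close>

definition bump :: "real \<Rightarrow> real \<Rightarrow> real \<Rightarrow> real \<Rightarrow> real" where
  "bump s t h x = smoothstep ((x - s) / h) - smoothstep ((x - (t - h)) / h)"

definition bump' :: "real \<Rightarrow> real \<Rightarrow> real \<Rightarrow> real \<Rightarrow> real" where
  "bump' s t h x = tent ((x - s) / h) / h - tent ((x - (t - h)) / h) / h"

text \<open>The falling ramp starts at \<open>t - h\<close>, which is not before \<open>s\<close>;
  as \<open>smoothstep\<close> is monotone, the difference of the two ramps cannot be negative.
  Overlapping ramps are allowed, they only lower the plateau.\<close>

lemma bump_bounds:
  assumes "0 < h" "h \<le> t - s"
  shows "0 \<le> bump s t h x" "bump s t h x \<le> indicator {s..t} x"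
proof -
  have le: "(x - (t - h)) / h \<le> (x - s) / h"
    using assms by (intro divide_right_mono) auto
  show "0 \<le> bump s t h x"
    using smoothstep_mono[OF le] by (simp add: bump_def)
  have u: "smoothstep y \<le> 1" "0 \<le> smoothstep y" for y
    using smoothstep_mono[of y "max 1 y"] smoothstep_eq_1[of "max 1 y"]
      smoothstep_mono[of "min 0 y" y] smoothstep_eq_0[of "min 0 y"] by auto
  show "bump s t h x \<le> indicator {s..t} x"
  proof (cases "x \<in> {s..t}")
    case True
    then show ?thesis
      using u(1)[of "(x - s) / h"] u(2)[of "(x - (t - h)) / h"] by (simp add: bump_def)
  next
    case False
    then consider "x < s" | "t < x" by fastforce
    then have "bump s t h x = 0"
    proof cases
      case 1
      then have "(x - s) / h \<le> 0" "(x - (t - h)) / h \<le> 0"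
        using assms by (auto simp: divide_le_0_iff)
      then show ?thesis by (simp add: bump_def smoothstep_eq_0)
    next
      case 2
      then have "1 \<le> (x - s) / h" "1 \<le> (x - (t - h)) / h"
        using assms by (auto simp: le_divide_eq)
      then show ?thesis by (simp add: bump_def smoothstep_eq_1)
    qed
    then show ?thesis by simp
  qed
qed

lemma continuous_on_bump': "continuous_on A (bump' s t h)"
  unfolding bump'_def divide_inverse[of _ h]
  by (intro continuous_intros continuous_on_tent[unfolded divide_inverse])

lemma test_fun_bump:
  assumes "a < s" "t < b" "0 < h" "h \<le> t - s"
  shows "test_fun a b (bump s t h) (bump' s t h)"
  unfolding test_fun_def
proof (intro conjI allI exI[of _ "{s..t}"] impI)
  fix x
  show "(bump s t h has_real_derivative bump' s t h x) (at x)"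
    unfolding bump_def[abs_def] bump'_def by (intro DERIV_diff smoothstep_deriv)
  show "bump s t h x = 0" if "x \<notin> {s..t}"
    using bump_bounds[OF assms(3,4), of x] that by auto
qed (use assms continuous_on_bump' in auto)

text \<open>The scaled tent is a probability density living on {s..s+h}, so the integral is an
  average of values that are \<eta>-close to \<open>c\<close>.\<close>

lemma tent_average:
  assumes f: "continuous_on {a..b} f" and s: "a \<le> s" "0 < h" "s + h \<le> b"
    and c: "\<And>x. x \<in> {s..s+h} \<Longrightarrow> \<bar>f x - c\<bar> \<le> \<eta>"
  shows "\<bar>integral {a..b} (\<lambda>x. tent ((x - s) / h) / h * f x) - c\<bar> \<le> \<eta>"
proof -
  let ?k = "\<lambda>x. tent ((x - s) / h) / h"
  have "(?k has_integral smoothstep ((b - s) / h) - smoothstep ((a - s) / h)) {a..b}"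
    using s smoothstep_deriv
    by (intro fundamental_theorem_of_calculus)
      (auto simp: has_real_derivative_iff_has_vector_derivative intro: has_vector_derivative_at_within)
  moreover have "smoothstep ((b - s) / h) = 1" "smoothstep ((a - s) / h) = 0"
    using s by (auto intro!: smoothstep_eq_1 smoothstep_eq_0 simp: le_divide_eq divide_le_0_iff)
  ultimately have k: "(?k has_integral 1) {a..b}" by simp
  have kc: "continuous_on {a..b} ?k"
    unfolding divide_inverse[of _ h] by (intro continuous_intros continuous_on_tent[unfolded divide_inverse])
  have i: "(\<lambda>x. ?k x * f x) integrable_on {a..b}"
    by (intro integrable_continuous_real continuous_intros f kc)
  have 1: "((\<lambda>x. ?k x * f x - ?k x * c) has_integral integral {a..b} (\<lambda>x. ?k x * f x) - 1 * c) {a..b}"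
    by (intro has_integral_diff has_integral_mult_left k integrable_integral i)
  have 2: "((\<lambda>x. ?k x * \<eta>) has_integral 1 * \<eta>) {a..b}"
    by (intro has_integral_mult_left k)
  have 3: "norm (?k x * f x - ?k x * c) \<le> ?k x * \<eta>" if "x \<in> {a..b}" for x
  proof (cases "x \<in> {s..s+h}")
    case True
    have "norm (?k x * f x - ?k x * c) = ?k x * \<bar>f x - c\<bar>"
      using s tent_nonneg[of "(x - s) / h"]
      by (simp only: right_diff_distrib[symmetric] real_norm_def abs_mult) simp
    also have "\<dots> \<le> ?k x * \<eta>"
      using s tent_nonneg c[OF True] by (intro mult_left_mono) auto
    finally show ?thesis .
  next
    case False
    then have "tent ((x - s) / h) = 0"
      using s by (intro tent_eq_0) (auto simp: le_divide_eq divide_le_0_iff)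
    then show ?thesis by simp
  qed
  have "norm (integral {a..b} (\<lambda>x. ?k x * f x - ?k x * c)) \<le> integral {a..b} (\<lambda>x. ?k x * \<eta>)"
    using 1 2 3 by (intro integral_norm_bound_integral) blast+
  then show ?thesis
    unfolding integral_unique[OF 1] integral_unique[OF 2] by simp
qed

lemma LINT_continuous_eq_integral:
  fixes f :: "real \<Rightarrow> real"
  assumes "continuous_on {a..b} f"
  shows "(LINT x:{a<..<b}|lborel. f x) = integral {a..b} f"
proof -
  have "set_integrable lborel {a..b} f"
    using assms borel_integrable_atLeastAtMost' by blast
  then have "set_integrable lborel {a<..<b} f"
    by (rule set_integrable_subset) auto
  then show "(LINT x:{a<..<b}|lborel. f x) = integral {a..b} f"
    by (simp add: set_borel_integral_eq_integral integral_open_interval_real)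
qed

text \<open>The pairing with \<open>bump'\<close> is an average of \<open>f\<close> near
  \<open>s\<close> minus one near \<open>t\<close>, hence tends to \<open>f s - f t\<close> as the
  width shrinks. Only countably many widths are used: for the weak time derivative each test
  function has its own null set, and these have to be united.\<close>

lemma bump_weak_lipschitz:
  assumes f: "continuous_on {a..b} f" and st: "a < s" "s < t" "t < b"
    and le: "\<And>n. \<bar>LINT x:{a<..<b}|lborel. bump' s t ((t - s) / (2 + real n)) x * f x\<bar> \<le> B"
  shows "\<bar>f s - f t\<bar> \<le> B"
proof (rule field_le_epsilon)
  fix e :: real assume "0 < e"
  define \<eta> where "\<eta> = e / 2"
  have \<eta>: "0 < \<eta>" using \<open>0 < e\<close> by (simp add: \<eta>_def)
  have "isCont f s" "isCont f t"
    using f st continuous_on_interior[of "{a..b}" f] by auto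
  then have "\<exists>d>0. \<forall>x. \<bar>x - s\<bar> < d \<longrightarrow> \<bar>f x - f s\<bar> < \<eta>" "\<exists>d>0. \<forall>x. \<bar>x - t\<bar> < d \<longrightarrow> \<bar>f x - f t\<bar> < \<eta>"
    using \<eta> by (auto simp: continuous_at_eps_delta dist_real_def)
  then obtain d1 d2 where d: "0 < d1" "0 < d2"
    and d1: "\<And>x. \<bar>x - s\<bar> < d1 \<Longrightarrow> \<bar>f x - f s\<bar> < \<eta>"
    and d2: "\<And>x. \<bar>x - t\<bar> < d2 \<Longrightarrow> \<bar>f x - f t\<bar> < \<eta>" by blast
  have "(\<lambda>n. (t - s) / (2 + real n)) \<longlonglongrightarrow> 0" by real_asymp
  then have "\<forall>\<^sub>F n in sequentially. (t - s) / (2 + real n) < min d1 d2"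
    using d by (intro order_tendstoD) auto
  then obtain n where n: "(t - s) / (2 + real n) < min d1 d2"
    by (auto simp: eventually_sequentially)
  define h where "h = (t - s) / (2 + real n)"
  have h: "0 < h" "h < d1" "h < d2" "h \<le> t - s"
    using n st by (auto simp: h_def divide_simps mult_le_cancel_left1)
  let ?I = "\<lambda>s. integral {a..b} (\<lambda>x. tent ((x - s) / h) / h * f x)"
  have cont: "continuous_on {a..b} (\<lambda>x. tent ((x - s) / h) / h * f x)" for s
    unfolding divide_inverse[of _ h] by (intro continuous_intros continuous_on_tent[unfolded divide_inverse] f)
  have 1: "\<bar>?I s - f s\<bar> \<le> \<eta>"
    using h st by (intro tent_average[OF f] less_imp_le[OF d1]) auto
  have 2: "\<bar>?I (t - h) - f t\<bar> \<le> \<eta>"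
    using h st by (intro tent_average[OF f] less_imp_le[OF d2]) auto
  have "(LINT x:{a<..<b}|lborel. bump' s t h x * f x) = integral {a..b} (\<lambda>x. bump' s t h x * f x)"
    by (intro LINT_continuous_eq_integral continuous_intros continuous_on_bump' f)
  also have "\<dots> = ?I s - ?I (t - h)"
    unfolding bump'_def left_diff_distrib
    by (intro integral_diff integrable_continuous_real cont)
  finally have "\<bar>?I s - ?I (t - h)\<bar> \<le> B"
    using le[of n] by (simp add: h_def)
  moreover have "e = 2 * \<eta>" by (simp add: \<eta>_def)
  ultimately show "\<bar>f s - f t\<bar> \<le> B + e"
    using 1 2 by linarith
qed

text \<open>The product is dominated by \<open>C\<close> on {s..t}. Should it fail to be integrable,
  its integral is 0 by convention and the bound still holds.\<close>

lemma abs_LINT_bump_le: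
  assumes C: "0 \<le> C" and g: "AE x in lborel. x \<in> {a<..<b} \<longrightarrow> \<bar>g x\<bar> \<le> C" and h: "0 < h" "h \<le> t - s"
  shows "\<bar>LINT x:{a<..<b}|lborel. bump s t h x * g x\<bar> \<le> C * (t - s)"
proof -
  have "\<bar>LINT x:{a<..<b}|lborel. bump s t h x * g x\<bar>
      \<le> (\<integral>x. \<bar>indicator {a<..<b} x * (bump s t h x * g x)\<bar> \<partial>lborel)"
    unfolding set_lebesgue_integral_def using integral_abs_bound by simp
  also have "\<dots> \<le> (\<integral>x. C * indicator {s..t} x \<partial>lborel)"
  proof (rule integral_mono_AE')
    show "AE x in lborel. \<bar>indicator {a<..<b} x * (bump s t h x * g x)\<bar> \<le> C * indicator {s..t} x"
      using g
    proof eventually_elim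
      case (elim x)
      show ?case
      proof (cases "x \<in> {a<..<b}")
        case True
        have "\<bar>bump s t h x * g x\<bar> = bump s t h x * \<bar>g x\<bar>"
          using bump_bounds[OF h] by (simp add: abs_mult)
        also have "\<dots> \<le> indicator {s..t} x * C"
          using bump_bounds[OF h] elim True by (intro mult_mono) auto
        finally show ?thesis using True by (simp add: mult.commute)
      qed (use C in auto)
    qed
  next
    show "AE x in lborel. 0 \<le> C * indicat_real {s..t} x"
      using C by (intro AE_I2) simp
    show "integrable lborel (\<lambda>x. C * indicat_real {s..t} x)"
      by (intro integrable_mult_right integrable_real_indicator) (auto simp: emeasure_lborel_Icc_eq)
  qed
  also have "\<dots> = C * (t - s)" using h by simp
  finally show ?thesis .
qed

text \<open>The set where \<open>f\<close> exceeds \<open>c\<close> is open and null, hence empty;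
  the end points follow by continuity. This turns essential bounds of continuous representatives
  into bounds everywhere.\<close>

lemma AE_imp_le_continuous:
  fixes f :: "real \<Rightarrow> real"
  assumes "a < b" "continuous_on {a..b} f" "AE x in lborel. x \<in> {a<..<b} \<longrightarrow> f x \<le> c" "x \<in> {a..b}"
  shows "f x \<le> c"
proof -
  let ?U = "{x \<in> {a<..<b}. f x \<in> {c<..}}"
  have "continuous_on {a<..<b} f"
    using assms(2) by (rule continuous_on_subset) auto
  then have op: "open ?U"
    by (intro continuous_open_preimage[unfolded vimage_def Int_def, simplified]) auto
  have "AE x in lborel. x \<notin> ?U"
    using assms(3) by eventually_elim auto
  then have "?U \<in> null_sets lborel"
    using op by (subst AE_iff_null_sets) auto
  then have "negligible ?U"
    by (simp add: negligible_iff_null_sets null_sets_completionI)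
  with op have "?U = {}"
    using open_not_negligible by blast
  then have "\<forall>x\<in>{a<..<b}. f x \<le> c" by force
  then show ?thesis
    using assms continuous_le_on_closure[of "{a<..<b}" f x c] by simp
qed

text \<open>Testing with bumps that approximate the indicator of {s..t} bounds
  \<open>f s - f t\<close> by the essential bound of \<open>g\<close> times the length. The open
  interval comes first because test functions vanish near the boundary; continuity adds the end
  points.\<close>

lemma has_weak_deriv_imp_lipschitz_on:
  assumes ab: "a < b" and f: "continuous_on {a..b} f" and g: "has_weak_deriv a b f g"
    and C: "0 \<le> C" "AE x in lborel. x \<in> {a<..<b} \<longrightarrow> \<bar>g x\<bar> \<le> C"
  shows "C-lipschitz_on {a..b} f"
proof -
  have *: "\<bar>f s - f t\<bar> \<le> C * (t - s)" if st: "a < s" "s < t" "t < b" for s t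
  proof (rule bump_weak_lipschitz[OF f st])
    fix n
    define h where "h = (t - s) / (2 + real n)"
    have h: "0 < h" "h \<le> t - s"
      using st by (auto simp: h_def divide_simps mult_le_cancel_left1)
    have "(LINT x:{a<..<b}|lborel. bump' s t h x * f x) = - (LINT x:{a<..<b}|lborel. bump s t h x * g x)"
      using g test_fun_bump[OF st(1,3) h] unfolding has_weak_deriv_def by blast
    then show "\<bar>LINT x:{a<..<b}|lborel. bump' s t ((t - s) / (2 + real n)) x * f x\<bar> \<le> C * (t - s)"
      using abs_LINT_bump_le[OF C h] by (simp add: h_def)
  qed
  have "C-lipschitz_on {a<..<b} f"
  proof (rule lipschitz_onI[OF _ C(1)])
    fix s t assume "s \<in> {a<..<b}" "t \<in> {a<..<b}"
    then show "dist (f s) (f t) \<le> C * dist s t"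
      using *[of s t] *[of t s] by (cases s t rule: linorder_cases) (auto simp: dist_real_def)
  qed
  then show ?thesis
    using lipschitz_on_closure[of C "{a<..<b}" f] ab f by simp
qed

section \<open>The regularity class\<close>

lemma AE_restrict_lborel_iff:
  "(AE x in restrict_space lborel {a<..<b}. Q x) \<longleftrightarrow> (AE x in lborel. x \<in> {a<..<b::real} \<longrightarrow> Q x)"
  by (rule AE_restrict_space_iff) auto

lemma Linf_norm_leD:
  assumes "Linf_norm {a<..<b} f \<le> ereal c"
  shows "AE x in lborel. x \<in> {a<..<b} \<longrightarrow> \<bar>f x\<bar> \<le> c"
proof -
  have "AE x in restrict_space lborel {a<..<b}. ereal \<bar>f x\<bar> \<le> Linf_norm {a<..<b} f"
    unfolding Linf_norm_def by (rule esssup_AE)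
  then have "AE x in restrict_space lborel {a<..<b}. \<bar>f x\<bar> \<le> c"
    by eventually_elim (use assms order_trans in fastforce)
  then show ?thesis
    by (simp add: AE_restrict_lborel_iff)
qed

text \<open>Two conventions are at stake: a non-measurable function has \<open>esssup\<close> equal
  to the top element, and over a null set the value would be -\<infinity>, which
  \<open>a < b\<close> excludes.\<close>

lemma esssup_nonneg:
  fixes f :: "real \<Rightarrow> ereal"
  assumes "a < b" "\<And>x. 0 \<le> f x"
  shows "0 \<le> esssup (restrict_space lborel {a<..<b}) f"
proof (cases "f \<in> borel_measurable (restrict_space lborel {a<..<b})")
  case True
  have "emeasure (restrict_space lborel {a<..<b}) (space (restrict_space lborel {a<..<b})) \<noteq> 0"
    using assms by (simp add: emeasure_restrict_space space_restrict_space)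
  then have "0 = esssup (restrict_space lborel {a<..<b}) (\<lambda>x. 0::ereal)"
    by (rule esssup_const[symmetric])
  also have "\<dots> \<le> esssup (restrict_space lborel {a<..<b}) f"
    using assms by (intro esssup_mono) auto
  finally show ?thesis .
qed (simp add: esssup_non_measurable)

lemma Linf_norm_nonneg: "a < b \<Longrightarrow> 0 \<le> Linf_norm {a<..<b} f"
  unfolding Linf_norm_def by (rule esssup_nonneg) auto

lemma Linf_Linf_norm_nonneg: "0 < T \<Longrightarrow> 0 < l \<Longrightarrow> 0 \<le> Linf_Linf_norm T l u"
  unfolding Linf_Linf_norm_def by (rule esssup_nonneg) (auto intro: Linf_norm_nonneg)

lemma Linf_norm_bound:
  assumes "a < b" "Linf_norm {a<..<b} f < \<infinity>"
  obtains C where "0 \<le> C" "AE x in lborel. x \<in> {a<..<b} \<longrightarrow> \<bar>f x\<bar> \<le> C"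
proof -
  obtain C where C: "Linf_norm {a<..<b} f = ereal C"
    using assms Linf_norm_nonneg[of a b f] by (cases "Linf_norm {a<..<b} f") auto
  show ?thesis
    using that[of C] Linf_norm_leD[of a b f C] C Linf_norm_nonneg[OF assms(1), of f] by simp
qed

lemma Linf_Linf_norm_leD:
  assumes "Linf_Linf_norm T l u \<le> ereal c"
  shows "AE t in lborel. t \<in> {0<..<T} \<longrightarrow> (AE x in lborel. x \<in> {0<..<l} \<longrightarrow> \<bar>u t x\<bar> \<le> c)"
proof -
  have "AE t in restrict_space lborel {0<..<T}. Linf_norm {0<..<l} (u t) \<le> Linf_Linf_norm T l u"
    unfolding Linf_Linf_norm_def by (rule esssup_AE)
  then have "AE t in lborel. t \<in> {0<..<T} \<longrightarrow> Linf_norm {0<..<l} (u t) \<le> Linf_Linf_norm T l u"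
    by (simp add: AE_restrict_lborel_iff)
  then show ?thesis
  proof eventually_elim
    case (elim t)
    then show ?case
      by (intro impI Linf_norm_leD order_trans[OF mp[OF elim] assms])
  qed
qed

lemma in_W1inf_lipschitz:
  assumes "0 < l" "in_W1inf 0 l f"
  obtains K where "K-lipschitz_on {0..l} f"
proof -
  obtain g where g: "in_Linf {0<..<l} g" "has_weak_deriv 0 l f g" and f: "continuous_on {0..l} f"
    using assms(2) by (auto simp: in_W1inf_def)
  from g(1) have "Linf_norm {0<..<l} g < \<infinity>"
    by (simp add: in_Linf_def)
  then obtain C where C: "0 \<le> C" "AE x in lborel. x \<in> {0<..<l} \<longrightarrow> \<bar>g x\<bar> \<le> C"
    using Linf_norm_bound[OF assms(1)] by blast
  show ?thesis
    using that[OF has_weak_deriv_imp_lipschitz_on[OF assms(1) f g(2) C]] .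
qed

text \<open>The norm contains the essential supremum of the difference, and for functions continuous
  in x this controls every point value.\<close>

lemma C0_W1inf_continuous:
  assumes l: "0 < l" and u: "C0_W1inf T l u" and x: "x \<in> {0..l}"
  shows "continuous_on {0..T} (\<lambda>t. u t x)"
  unfolding continuous_on_def
proof
  fix t assume t: "t \<in> {0..T}"
  show "((\<lambda>s. u s x) \<longlongrightarrow> u t x) (at t within {0..T})"
  proof (rule tendstoI)
    fix e :: real assume e: "0 < e"
    have "((\<lambda>s. W1inf_norm 0 l (\<lambda>x. u s x - u t x)) \<longlongrightarrow> 0) (at t within {0..T})"
      using u t by (simp add: C0_W1inf_def)
    then have "\<forall>\<^sub>F s in at t within {0..T}. W1inf_norm 0 l (\<lambda>x. u s x - u t x) < ereal (e / 2)"
      using e by (intro order_tendstoD) (auto simp: zero_ereal_def)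
    moreover have "\<forall>\<^sub>F s in at t within {0..T}. s \<in> {0..T}"
      by (simp add: eventually_at_filter)
    ultimately show "\<forall>\<^sub>F s in at t within {0..T}. dist (u s x) (u t x) < e"
    proof eventually_elim
      case (elim s)
      have "Linf_norm {0<..<l} (\<lambda>x. u s x - u t x) \<le> W1inf_norm 0 l (\<lambda>x. u s x - u t x)"
        unfolding W1inf_norm_def using Linf_norm_nonneg[OF l] by (simp add: ereal_le_add_self)
      also have "\<dots> \<le> ereal (e / 2)" using elim by simp
      finally have ae: "AE x in lborel. x \<in> {0<..<l} \<longrightarrow> \<bar>u s x - u t x\<bar> \<le> e / 2"
        by (rule Linf_norm_leD)
      have "continuous_on {0..l} (\<lambda>x. \<bar>u s x - u t x\<bar>)"
        using u t elim by (intro continuous_intros) (auto simp: C0_W1inf_def in_W1inf_def)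
      from AE_imp_le_continuous[OF l this ae x] show ?case
        using e by (simp add: dist_real_def)
    qed
  qed
qed

text \<open>The bound on \<open>g\<close> holds for almost every t and then almost every x; Fubini
  exchanges the order, so that for almost every x the function of time can be tested as in the
  one-dimensional case. Continuity in x then removes the exceptional points. The constant passes
  through without loss, which is how a small C_t becomes a small Lipschitz constant.\<close>

lemma has_weak_time_deriv_imp_lipschitz_on:
  assumes T: "0 < T" and l: "0 < l" and u: "C0_W1inf T l u"
    and g: "has_weak_time_deriv T l u g" "in_Linf_Linf T l g" "Linf_Linf_norm T l g \<le> ereal C"
    and x: "x \<in> {0..l}"
  shows "C-lipschitz_on {0..T} (\<lambda>t. u t x)"
proof -
  have C: "0 \<le> C"
    using order_trans[OF Linf_Linf_norm_nonneg[OF T l] g(3)] by simp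
  have ct: "continuous_on {0..T} (\<lambda>t. u t x)" if "x \<in> {0..l}" for x
    using C0_W1inf_continuous[OF l u that] .
  have cx: "continuous_on {0..l} (u t)" if "t \<in> {0..T}" for t
    using u that by (simp add: C0_W1inf_def in_W1inf_def)
  let ?Q = "{0<..<T} \<times> {0<..<l}"
  \<comment> \<open>Extension of \<open>g\<close> by 0, which puts the exchange of the two
    quantifiers on the full product measure.\<close>
  define k where "k t x = indicator ?Q (t, x) * g t x" for t x
  have "(\<lambda>(t, x). g t x) \<in> borel_measurable (restrict_space lborel ?Q)"
    using g(2) by (simp add: in_Linf_Linf_def)
  then have "(\<lambda>z. indicator ?Q z *\<^sub>R (case z of (t, x) \<Rightarrow> g t x)) \<in> borel_measurable lborel"
    by (subst (asm) borel_measurable_restrict_space_iff) (auto intro!: borel_open open_Times)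
  moreover have "(\<lambda>z. indicator ?Q z *\<^sub>R (case z of (t, x) \<Rightarrow> g t x)) = (\<lambda>z. k (fst z) (snd z))"
    by (auto simp: k_def)
  ultimately have [measurable]: "(\<lambda>z. k (fst z) (snd z)) \<in> borel_measurable (lborel \<Otimes>\<^sub>M lborel)"
    by (simp add: lborel_prod)
  have k0: "\<bar>k t x\<bar> \<le> C" if "t \<in> {0<..<T} \<Longrightarrow> x \<in> {0<..<l} \<Longrightarrow> \<bar>g t x\<bar> \<le> C" for t x
    using that C by (auto simp: k_def indicator_def)
  have k1: "\<bar>g t x\<bar> \<le> C" if "t \<in> {0<..<T}" "x \<in> {0<..<l}" "\<bar>k t x\<bar> \<le> C" for t x
    using that by (auto simp: k_def)
  have "AE t in lborel. AE x in lborel. \<bar>k t x\<bar> \<le> C"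
    using Linf_Linf_norm_leD[OF g(3)]
  proof eventually_elim
    case (elim t)
    show ?case
    proof (cases "t \<in> {0<..<T}")
      case True
      with elim have "AE x in lborel. x \<in> {0<..<l} \<longrightarrow> \<bar>g t x\<bar> \<le> C" by simp
      then show ?thesis
        by eventually_elim (use k0 in blast)
    next
      case False
      then show ?thesis
        using k0 by (intro always_eventually) blast
    qed
  qed
  moreover have "{z \<in> space (lborel \<Otimes>\<^sub>M lborel). \<bar>k (fst z) (snd z)\<bar> \<le> C} \<in> sets (lborel \<Otimes>\<^sub>M lborel)"
    by measurable
  ultimately have "AE x in lborel. AE t in lborel. \<bar>k t x\<bar> \<le> C"
    using lborel_pair.AE_commute[of "\<lambda>t x. \<bar>k t x\<bar> \<le> C"] by blast
  then have gb: "AE x in lborel. x \<in> {0<..<l} \<longrightarrow> (AE t in lborel. t \<in> {0<..<T} \<longrightarrow> \<bar>g t x\<bar> \<le> C)"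
  proof eventually_elim
    case (elim x)
    show ?case
    proof
      assume "x \<in> {0<..<l}"
      then show "AE t in lborel. t \<in> {0<..<T} \<longrightarrow> \<bar>g t x\<bar> \<le> C"
        using elim k1 by (auto elim: eventually_mono)
    qed
  qed
  have *: "\<bar>u s x - u t x\<bar> \<le> C * (t - s)" if st: "0 < s" "s < t" "t < T" for s t
  proof (rule AE_imp_le_continuous[OF l _ _ x])
    show "continuous_on {0..l} (\<lambda>x. \<bar>u s x - u t x\<bar>)"
      using st by (intro continuous_intros cx) auto
    define h where "h n = (t - s) / (2 + real n)" for n :: nat
    have h: "0 < h n" "h n \<le> t - s" for n
      using st by (auto simp: h_def divide_simps mult_le_cancel_left1)
    have "AE x in lborel. x \<in> {0<..<l} \<longrightarrow>
        (LINT r:{0<..<T}|lborel. bump' s t (h n) r * u r x)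
          = - (LINT r:{0<..<T}|lborel. bump s t (h n) r * g r x)" for n
      using g(1) test_fun_bump[OF st(1,3) h] unfolding has_weak_time_deriv_def AE_restrict_lborel_iff
      by blast
    \<comment> \<open>All widths \<open>h n\<close> at once, off a single null set.\<close>
    then have "AE x in lborel. \<forall>n::nat. x \<in> {0<..<l} \<longrightarrow>
        (LINT r:{0<..<T}|lborel. bump' s t (h n) r * u r x)
          = - (LINT r:{0<..<T}|lborel. bump s t (h n) r * g r x)"
      unfolding AE_all_countable by blast
    with gb show "AE x in lborel. x \<in> {0<..<l} \<longrightarrow> \<bar>u s x - u t x\<bar> \<le> C * (t - s)"
    proof eventually_elim
      case (elim x)
      show ?case
      proof
        assume x: "x \<in> {0<..<l}"
        show "\<bar>u s x - u t x\<bar> \<le> C * (t - s)"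
        proof (rule bump_weak_lipschitz[OF ct st])
          fix n
          show "\<bar>LINT r:{0<..<T}|lborel. bump' s t ((t - s) / (2 + real n)) r * u r x\<bar> \<le> C * (t - s)"
            using elim x abs_LINT_bump_le[OF C, of 0 T "\<lambda>r. g r x" "h n" t s] h by (simp add: h_def)
        qed (use x in auto)
      qed
    qed
  qed
  have "C-lipschitz_on {0<..<T} (\<lambda>t. u t x)"
  proof (rule lipschitz_onI[OF _ C])
    fix s t assume "s \<in> {0<..<T}" "t \<in> {0<..<T}"
    then show "dist (u s x) (u t x) \<le> C * dist s t"
      using *[of s t] *[of t s] by (cases s t rule: linorder_cases) (auto simp: dist_real_def)
  qed
  then show ?thesis
    using lipschitz_on_closure[of C "{0<..<T}" "\<lambda>t. u t x"] T ct[OF x] by simp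
qed

text \<open>Regularity provides some weak time derivative, so the one picked by choice is a weak
  time derivative too, and this is all that the estimate requires of it. The second part keeps track
  of the constant for the observed solution.\<close>

lemma regular_time_lipschitz:
  assumes T: "0 < T" and l: "0 < l" and u: "regular T l u"
  shows "\<exists>C. \<forall>x\<in>{0..l}. C-lipschitz_on {0..T} (\<lambda>t. u t x)"
    and "Linf_Linf_norm T l (weak_time_deriv T l u) \<le> ereal C \<Longrightarrow> x \<in> {0..l} \<Longrightarrow>
      C-lipschitz_on {0..T} (\<lambda>t. u t x)"
proof -
  let ?g = "weak_time_deriv T l u"
  have "\<exists>g. in_Linf_Linf T l g \<and> has_weak_time_deriv T l u g"
    using u by (simp add: regular_def W1inf_Linf_def)
  then have g: "in_Linf_Linf T l ?g \<and> has_weak_time_deriv T l u ?g"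
    unfolding weak_time_deriv_def by (rule someI_ex)
  have C0: "C0_W1inf T l u"
    using u by (simp add: regular_def)
  show *: "C-lipschitz_on {0..T} (\<lambda>t. u t x)"
    if "Linf_Linf_norm T l ?g \<le> ereal C" "x \<in> {0..l}" for C x
    using has_weak_time_deriv_imp_lipschitz_on[OF T l C0 _ _ that] g by blast
  have "Linf_Linf_norm T l ?g < \<infinity>"
    using g by (simp add: in_Linf_Linf_def)
  then obtain C where "Linf_Linf_norm T l ?g \<le> ereal C"
    using Linf_Linf_norm_nonneg[OF T l, of ?g] by (cases "Linf_Linf_norm T l ?g") auto
  then show "\<exists>C. \<forall>x\<in>{0..l}. C-lipschitz_on {0..T} (\<lambda>t. u t x)"
    using * by blast
qed

lemma regular_space_lipschitz:
  assumes "0 < l" "regular T l u" "t \<in> {0..T}"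
  shows "\<exists>K. K-lipschitz_on {0..l} (u t)"
proof -
  have "in_W1inf 0 l (u t)"
    using assms by (simp add: regular_def C0_W1inf_def)
  then show ?thesis
    using in_W1inf_lipschitz[OF assms(1)] by blast
qed

text \<open>Continuity is used twice: at almost every t to pass from almost every x to the given
  one, then in t.\<close>

lemma regular_Linf_Linf_norm_leD:
  assumes T: "0 < T" and l: "0 < l" and u: "regular T l u" and c: "Linf_Linf_norm T l u \<le> ereal c"
    and t: "t \<in> {0..T}" and x: "x \<in> {0..l}"
  shows "\<bar>u t x\<bar> \<le> c"
proof -
  have C0: "C0_W1inf T l u"
    using u by (simp add: regular_def)
  have cx: "continuous_on {0..l} (u t)" if "t \<in> {0..T}" for t
    using C0 that by (simp add: C0_W1inf_def in_W1inf_def)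
  have "AE t in lborel. t \<in> {0<..<T} \<longrightarrow> \<bar>u t x\<bar> \<le> c"
    using Linf_Linf_norm_leD[OF c]
  proof eventually_elim
    case (elim t)
    show ?case
    proof
      assume t: "t \<in> {0<..<T}"
      from elim t have ae: "AE x in lborel. x \<in> {0<..<l} \<longrightarrow> \<bar>u t x\<bar> \<le> c" by (rule mp)
      have "t \<in> {0..T}"
        using t by simp
      then have "continuous_on {0..l} (u t)"
        by (rule cx)
      then have "continuous_on {0..l} (\<lambda>x. \<bar>u t x\<bar>)"
        by (intro continuous_intros)
      from AE_imp_le_continuous[OF l this ae x] show "\<bar>u t x\<bar> \<le> c" .
    qed
  qed
  moreover have "continuous_on {0..T} (\<lambda>t. \<bar>u t x\<bar>)"
    by (intro continuous_intros C0_W1inf_continuous[OF l C0 x])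
  ultimately show ?thesis
    by (rule AE_imp_le_continuous[OF T _ _ t, rotated])
qed

lemma AE_lborel_negligible:
  assumes "AE x in lborel. Q x"
  obtains N where "negligible N" "\<And>x. x \<notin> N \<Longrightarrow> Q x"
proof -
  obtain N where "N \<in> null_sets lborel" "{x. \<not> Q x} \<subseteq> N"
    using assms by (auto simp: eventually_ae_filter)
  then show ?thesis
    using that[of N] by (auto simp: negligible_iff_null_sets null_sets_completionI)
qed

lemma integral_mono_negligible:
  fixes f g :: "real \<Rightarrow> real"
  assumes N: "negligible N" and f: "f integrable_on S" and g: "g integrable_on S"
    and le: "\<And>x. x \<in> S - N \<Longrightarrow> f x \<le> g x"
  shows "integral S f \<le> integral S g"
proof -
  define h where "h x = (if x \<in> N then g x else f x)" for x
  have "h integrable_on S"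
    by (rule integrable_spike[OF f N]) (auto simp: h_def)
  then have "integral S h \<le> integral S g"
    using le by (intro integral_le g) (auto simp: h_def)
  moreover have "integral S h = integral S f"
    by (rule integral_spike[OF N]) (auto simp: h_def)
  ultimately show ?thesis by simp
qed

section \<open>Families that are bounded and Lipschitz in a parameter\<close>

text \<open>The parameter in \<open>S\<close> comes first and the index in \<open>X\<close> second,
  so one calculus of sums, products and compositions serves both time (with the points of the pipe
  as indices) and space (with a single time as index). Boundedness is included since products would
  not stay Lipschitz without it.\<close>

definition unif_lip :: "real set \<Rightarrow> 'a set \<Rightarrow> (real \<Rightarrow> 'a \<Rightarrow> real) \<Rightarrow> bool" where
  "unif_lip S X f \<longleftrightarrow> (\<exists>K\<ge>0. \<forall>x\<in>X. \<forall>s\<in>S. \<bar>f s x\<bar> \<le> K \<and> (\<forall>t\<in>S. \<bar>f s x - f t x\<bar> \<le> K * \<bar>s - t\<bar>))"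

lemma unif_lipI:
  assumes "\<And>x s. x \<in> X \<Longrightarrow> s \<in> S \<Longrightarrow> \<bar>f s x\<bar> \<le> B"
    and "\<And>x s t. x \<in> X \<Longrightarrow> s \<in> S \<Longrightarrow> t \<in> S \<Longrightarrow> \<bar>f s x - f t x\<bar> \<le> K * \<bar>s - t\<bar>"
  shows "unif_lip S X f"
  unfolding unif_lip_def
proof (intro exI[of _ "max 0 (max B K)"] conjI ballI)
  fix x s t assume "x \<in> X" "s \<in> S"
  then show "\<bar>f s x\<bar> \<le> max 0 (max B K)"
    using assms(1)[of x s] by auto
  assume "t \<in> S"
  have "\<bar>f s x - f t x\<bar> \<le> K * \<bar>s - t\<bar>"
    by (intro assms) fact+
  also have "\<dots> \<le> max 0 (max B K) * \<bar>s - t\<bar>"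
    by (intro mult_right_mono) auto
  finally show "\<bar>f s x - f t x\<bar> \<le> max 0 (max B K) * \<bar>s - t\<bar>" .
qed auto

lemma unif_lipE:
  assumes "unif_lip S X f"
  obtains K where "0 \<le> K" "\<And>x s. x \<in> X \<Longrightarrow> s \<in> S \<Longrightarrow> \<bar>f s x\<bar> \<le> K"
    "\<And>x s t. x \<in> X \<Longrightarrow> s \<in> S \<Longrightarrow> t \<in> S \<Longrightarrow> \<bar>f s x - f t x\<bar> \<le> K * \<bar>s - t\<bar>"
  using assms unfolding unif_lip_def by meson

lemma unif_lip_const: "unif_lip S X (\<lambda>s x. c)"
  by (rule unif_lipI[where B="\<bar>c\<bar>" and K=0]) auto

lemma unif_lip_add:
  assumes "unif_lip S X f" "unif_lip S X g"
  shows "unif_lip S X (\<lambda>s x. f s x + g s x)"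
proof -
  obtain K where K: "\<And>x s. x \<in> X \<Longrightarrow> s \<in> S \<Longrightarrow> \<bar>f s x\<bar> \<le> K"
      "\<And>x s t. x \<in> X \<Longrightarrow> s \<in> S \<Longrightarrow> t \<in> S \<Longrightarrow> \<bar>f s x - f t x\<bar> \<le> K * \<bar>s - t\<bar>"
    using assms(1) by (rule unif_lipE) blast
  obtain L where L: "\<And>x s. x \<in> X \<Longrightarrow> s \<in> S \<Longrightarrow> \<bar>g s x\<bar> \<le> L"
      "\<And>x s t. x \<in> X \<Longrightarrow> s \<in> S \<Longrightarrow> t \<in> S \<Longrightarrow> \<bar>g s x - g t x\<bar> \<le> L * \<bar>s - t\<bar>"
    using assms(2) by (rule unif_lipE) blast
  show ?thesis
  proof (rule unif_lipI[where B="K + L" and K="K + L"])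
    fix x s t assume x: "x \<in> X" "s \<in> S"
    show "\<bar>f s x + g s x\<bar> \<le> K + L"
      using K(1)[OF x] L(1)[OF x] by linarith
    assume "t \<in> S"
    then show "\<bar>f s x + g s x - (f t x + g t x)\<bar> \<le> (K + L) * \<bar>s - t\<bar>"
      using K(2)[OF x, of t] L(2)[OF x, of t] unfolding distrib_right by linarith
  qed
qed

lemma unif_lip_mult:
  assumes "unif_lip S X f" "unif_lip S X g"
  shows "unif_lip S X (\<lambda>s x. f s x * g s x)"
proof -
  obtain K where K: "0 \<le> K" "\<And>x s. x \<in> X \<Longrightarrow> s \<in> S \<Longrightarrow> \<bar>f s x\<bar> \<le> K"
      "\<And>x s t. x \<in> X \<Longrightarrow> s \<in> S \<Longrightarrow> t \<in> S \<Longrightarrow> \<bar>f s x - f t x\<bar> \<le> K * \<bar>s - t\<bar>"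
    using assms(1) by (rule unif_lipE) blast
  obtain L where L: "0 \<le> L" "\<And>x s. x \<in> X \<Longrightarrow> s \<in> S \<Longrightarrow> \<bar>g s x\<bar> \<le> L"
      "\<And>x s t. x \<in> X \<Longrightarrow> s \<in> S \<Longrightarrow> t \<in> S \<Longrightarrow> \<bar>g s x - g t x\<bar> \<le> L * \<bar>s - t\<bar>"
    using assms(2) by (rule unif_lipE) blast
  show ?thesis
  proof (rule unif_lipI[where B="K * L" and K="2 * K * L"])
    fix x s t assume x: "x \<in> X" "s \<in> S"
    show "\<bar>f s x * g s x\<bar> \<le> K * L"
      unfolding abs_mult using K(1) K(2)[OF x] L(2)[OF x] by (intro mult_mono) auto
    assume t: "t \<in> S"
    have "f s x * g s x - f t x * g t x = f s x * (g s x - g t x) + (f s x - f t x) * g t x"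
      by (simp add: algebra_simps)
    also have "\<bar>\<dots>\<bar> \<le> \<bar>f s x\<bar> * \<bar>g s x - g t x\<bar> + \<bar>f s x - f t x\<bar> * \<bar>g t x\<bar>"
      by (rule order_trans[OF abs_triangle_ineq]) (simp add: abs_mult)
    also have "\<dots> \<le> K * (L * \<bar>s - t\<bar>) + (K * \<bar>s - t\<bar>) * L"
      using K(1) L(1) K(2)[OF x] L(2)[OF x(1) t] K(3)[OF x t] L(3)[OF x t]
      by (intro add_mono mult_mono) auto
    finally show "\<bar>f s x * g s x - f t x * g t x\<bar> \<le> 2 * K * L * \<bar>s - t\<bar>"
      by (simp add: algebra_simps)
  qed
qed

lemma unif_lip_diff:
  assumes "unif_lip S X f" "unif_lip S X g"
  shows "unif_lip S X (\<lambda>s x. f s x - g s x)"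
  using unif_lip_add[OF assms(1) unif_lip_mult[OF unif_lip_const[of S X "-1"] assms(2)]] by simp

lemma unif_lip_power2:
  assumes "unif_lip S X f"
  shows "unif_lip S X (\<lambda>s x. (f s x)\<^sup>2)"
  using unif_lip_mult[OF assms assms] by (simp add: power2_eq_square)

lemma C1_lipschitz_bounded:
  fixes \<phi> :: "real \<Rightarrow> real"
  assumes "\<And>y. y \<in> {a..b} \<Longrightarrow> (\<phi> has_real_derivative \<phi>' y) (at y)" "continuous_on {a..b} \<phi>'"
  obtains K where "\<And>y. y \<in> {a..b} \<Longrightarrow> \<bar>\<phi> y\<bar> \<le> K"
    "\<And>y z. y \<in> {a..b} \<Longrightarrow> z \<in> {a..b} \<Longrightarrow> \<bar>\<phi> y - \<phi> z\<bar> \<le> K * \<bar>y - z\<bar>"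
proof -
  have "continuous_on {a..b} \<phi>"
    using assms(1) by (meson DERIV_isCont continuous_at_imp_continuous_on)
  then have "bounded (\<phi> ` {a..b})" "bounded (\<phi>' ` {a..b})"
    using assms(2) by (auto intro!: compact_imp_bounded compact_continuous_image)
  then obtain B B' where "\<forall>y\<in>\<phi> ` {a..b}. norm y \<le> B" "\<forall>y\<in>\<phi>' ` {a..b}. norm y \<le> B'"
    unfolding bounded_iff by blast
  then have B: "\<And>y. y \<in> {a..b} \<Longrightarrow> \<bar>\<phi> y\<bar> \<le> B" "\<And>y. y \<in> {a..b} \<Longrightarrow> \<bar>\<phi>' y\<bar> \<le> B'"
    by auto
  show ?thesis
  proof (rule that[of "max B B'"])
    fix y z assume yz: "y \<in> {a..b}" "z \<in> {a..b}"
    show "\<bar>\<phi> y\<bar> \<le> max B B'" using B(1)[OF yz(1)] by simp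
    have "norm (\<phi> y - \<phi> z) \<le> max B B' * norm (y - z)"
      using yz assms(1) B(2)
      by (intro field_differentiable_bound[of "{a..b}" \<phi> \<phi>'])
        (auto intro: has_field_derivative_at_within simp: le_max_iff_disj)
    then show "\<bar>\<phi> y - \<phi> z\<bar> \<le> max B B' * \<bar>y - z\<bar>" by simp
  qed
qed

lemma unif_lip_compose:
  assumes \<phi>: "\<And>y. y \<in> {a..b} \<Longrightarrow> (\<phi> has_real_derivative \<phi>' y) (at y)" "continuous_on {a..b} \<phi>'"
    and f: "unif_lip S X f" "\<And>s x. s \<in> S \<Longrightarrow> x \<in> X \<Longrightarrow> f s x \<in> {a..b}"
  shows "unif_lip S X (\<lambda>s x. \<phi> (f s x))"
proof -
  obtain K where K: "\<And>y. y \<in> {a..b} \<Longrightarrow> \<bar>\<phi> y\<bar> \<le> K"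
    "\<And>y z. y \<in> {a..b} \<Longrightarrow> z \<in> {a..b} \<Longrightarrow> \<bar>\<phi> y - \<phi> z\<bar> \<le> K * \<bar>y - z\<bar>"
    using C1_lipschitz_bounded[OF \<phi>] by blast
  obtain L where L: "\<And>x s t. x \<in> X \<Longrightarrow> s \<in> S \<Longrightarrow> t \<in> S \<Longrightarrow> \<bar>f s x - f t x\<bar> \<le> L * \<bar>s - t\<bar>"
    using f(1) by (rule unif_lipE) blast
  show ?thesis
  proof (rule unif_lipI[where B=K and K="K * L"])
    fix x s t assume x: "x \<in> X" "s \<in> S"
    show b: "\<bar>\<phi> (f s x)\<bar> \<le> K" using f(2) x K(1) by blast
    assume t: "t \<in> S"
    have "\<bar>\<phi> (f s x) - \<phi> (f t x)\<bar> \<le> K * \<bar>f s x - f t x\<bar>"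
      using f(2) x t K(2) by blast
    also have "\<dots> \<le> K * (L * \<bar>s - t\<bar>)"
      using b by (intro mult_left_mono L x t) linarith
    finally show "\<bar>\<phi> (f s x) - \<phi> (f t x)\<bar> \<le> K * L * \<bar>s - t\<bar>"
      by (simp add: mult.assoc)
  qed
qed

lemma unif_lip_integral:
  fixes l :: real
  assumes f: "unif_lip S {0..l} f" and c: "\<And>s. s \<in> S \<Longrightarrow> continuous_on {0..l} (f s)"
  shows "unif_lip S {0..l} (\<lambda>s x. integral {0..x} (f s))"
proof -
  obtain K where K: "0 \<le> K" "\<And>x s. x \<in> {0..l} \<Longrightarrow> s \<in> S \<Longrightarrow> \<bar>f s x\<bar> \<le> K"
      "\<And>x s t. x \<in> {0..l} \<Longrightarrow> s \<in> S \<Longrightarrow> t \<in> S \<Longrightarrow> \<bar>f s x - f t x\<bar> \<le> K * \<bar>s - t\<bar>"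
    using f by (rule unif_lipE) blast
  have i: "f s integrable_on {0..x}" if "s \<in> S" "x \<in> {0..l}" for s x
    using that by (intro integrable_continuous_real continuous_on_subset[OF c]) auto
  show ?thesis
  proof (rule unif_lipI[where B="K * l" and K="K * l"])
    fix x s t assume x: "x \<in> {0..l}" "s \<in> S"
    have "\<bar>integral {0..x} (f s)\<bar> \<le> integral {0..x} (\<lambda>_. K)"
      using x K i unfolding real_norm_def[symmetric] by (intro integral_norm_bound_integral) auto
    also have "\<dots> \<le> K * l" using x K(1) by (simp add: mult.commute mult_left_mono)
    finally show "\<bar>integral {0..x} (f s)\<bar> \<le> K * l" .
    assume t: "t \<in> S"
    have "\<bar>integral {0..x} (f s) - integral {0..x} (f t)\<bar> = \<bar>integral {0..x} (\<lambda>y. f s y - f t y)\<bar>"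
      using i x t by (simp add: integral_diff)
    also have "\<dots> \<le> integral {0..x} (\<lambda>_. K * \<bar>s - t\<bar>)"
      using x t K i unfolding real_norm_def[symmetric]
      by (intro integral_norm_bound_integral integrable_diff) auto
    also have "\<dots> \<le> K * l * \<bar>s - t\<bar>"
      using x K(1) by (simp add: mult_ac mult_left_mono mult_right_mono)
    finally show "\<bar>integral {0..x} (f s) - integral {0..x} (f t)\<bar> \<le> K * l * \<bar>s - t\<bar>" .
  qed
qed

text \<open>Cauchy-Schwarz in the form that the variance of \<open>f\<close> over {0..x} is
  nonnegative; \<open>c\<close> is the mean value.\<close>

lemma square_integral_le:
  fixes f :: "real \<Rightarrow> real"
  assumes f: "continuous_on {0..l} f" and x: "x \<in> {0..l}"
  shows "(integral {0..x} f)\<^sup>2 \<le> l * integral {0..l} (\<lambda>y. (f y)\<^sup>2)"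
proof (cases "x = 0")
  case True
  have "0 \<le> integral {0..l} (\<lambda>y. (f y)\<^sup>2)"
    by (intro integral_nonneg integrable_continuous_real continuous_intros f) auto
  with True x show ?thesis by simp
next
  case False
  with x have x0: "0 < x" by simp
  have fc: "continuous_on {0..x} f" using f x by (auto intro: continuous_on_subset)
  define I where "I = integral {0..x} f"
  define c where "c = I / x"
  have i: "f integrable_on {0..x}" "(\<lambda>y. (f y)\<^sup>2) integrable_on {0..x}"
    by (intro integrable_continuous_real continuous_intros fc)+
  have "((\<lambda>y. (f y)\<^sup>2 - 2 * c * f y + c\<^sup>2) has_integral
      integral {0..x} (\<lambda>y. (f y)\<^sup>2) - 2 * c * I + (x - 0) * c\<^sup>2) {0..x}"
    unfolding I_def using x0 i has_integral_const_real[of "c\<^sup>2" 0 x]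
    by (intro has_integral_add has_integral_diff has_integral_mult_right integrable_integral) auto
  moreover have "(f y)\<^sup>2 - 2 * c * f y + c\<^sup>2 = (f y - c)\<^sup>2" for y
    by (simp add: power2_eq_square algebra_simps)
  ultimately have "0 \<le> integral {0..x} (\<lambda>y. (f y)\<^sup>2) - 2 * c * I + (x - 0) * c\<^sup>2"
    by (metis (mono_tags, lifting) has_integral_nonneg zero_le_power2)
  also have "\<dots> = integral {0..x} (\<lambda>y. (f y)\<^sup>2) - I\<^sup>2 / x"
    using x0 by (simp add: c_def power2_eq_square)
  finally have "I\<^sup>2 \<le> x * integral {0..x} (\<lambda>y. (f y)\<^sup>2)"
    using x0 by (simp add: field_simps)
  also have "\<dots> \<le> l * integral {0..l} (\<lambda>y. (f y)\<^sup>2)"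
  proof (intro mult_mono)
    show "integral {0..x} (\<lambda>y. (f y)\<^sup>2) \<le> integral {0..l} (\<lambda>y. (f y)\<^sup>2)"
      using x by (intro integral_subset_le i integrable_continuous_real continuous_intros f) auto
    show "0 \<le> integral {0..x} (\<lambda>y. (f y)\<^sup>2)"
      by (intro integral_nonneg i) auto
  qed (use x in auto)
  finally show ?thesis by (simp add: I_def)
qed

section \<open>Pointwise dissipation estimates\<close>

lemma abs_mult_le_squares: "\<bar>x\<bar> * \<bar>y\<bar> \<le> (x\<^sup>2 + y\<^sup>2) / (2::real)"
  using sum_squares_bound[of "\<bar>x\<bar>" "\<bar>y\<bar>"] by simp

lemma abs_mult_le_sum_squares: "\<bar>x\<bar> * \<bar>y\<bar> \<le> x\<^sup>2 + (y::real)\<^sup>2"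
proof -
  define z where "z = x\<^sup>2 + y\<^sup>2"
  have "0 \<le> z" "\<bar>x\<bar> * \<bar>y\<bar> \<le> z / 2"
    using abs_mult_le_squares[of x y] by (simp_all add: z_def)
  then show ?thesis by (simp flip: z_def)
qed

lemma weighted_young:
  assumes "0 < \<theta>"
  shows "B * \<bar>x\<bar> * \<bar>y\<bar> \<le> B\<^sup>2 / (4 * \<theta>) * x\<^sup>2 + \<theta> * (y::real)\<^sup>2"
proof -
  have "0 \<le> (B * \<bar>x\<bar> - 2 * \<theta> * \<bar>y\<bar>)\<^sup>2 / (4 * \<theta>)"
    using assms by simp
  also have "\<dots> = B\<^sup>2 / (4 * \<theta>) * x\<^sup>2 + \<theta> * y\<^sup>2 - B * \<bar>x\<bar> * \<bar>y\<bar>"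
    using assms by (simp add: power2_eq_square field_simps)
  finally show ?thesis by simp
qed

lemma mult_small_le:
  assumes "\<bar>x\<bar> \<le> d * z" "0 \<le> e" "e \<le> 1" "0 \<le> d * z"
  shows "e * x \<le> d * (z::real)" "- (e * x) \<le> d * z"
proof -
  have "e * \<bar>x\<bar> \<le> 1 * (d * z)"
    using assms by (intro mult_mono) auto
  then have "\<bar>e * x\<bar> \<le> d * z"
    using assms by (simp add: abs_mult)
  then show "e * x \<le> d * z" "- (e * x) \<le> d * z" by auto
qed

text \<open>The state at one point: \<open>R\<close>, \<open>V\<close> are the errors in density and velocity, \<open>r * V + w * R\<close> and
  \<open>A + s * V\<close> those in mass flow and enthalpy, \<open>F\<close> is the error in the friction term and \<open>\<Phi>\<close> an
  antiderivative of \<open>R\<close>.\<close>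

lemma pointwise_small_terms:
  fixes d a b w s R V r F \<Phi> :: real
  assumes d: "0 < d" "d \<le> 1" and r: "a \<le> r" "r \<le> b" "0 < a" and w: "\<bar>w\<bar> \<le> d" and s: "\<bar>s\<bar> \<le> d"
    and F: "\<bar>F\<bar> \<le> 2 * d * \<bar>V\<bar>"
  shows "\<bar>(r * V + w * R) * F\<bar> \<le> d * ((2 * b + 1) * (R\<^sup>2 + V\<^sup>2))"
    and "\<bar>s * V * R\<bar> \<le> d * (R\<^sup>2 + V\<^sup>2)"
    and "\<bar>F * \<Phi>\<bar> \<le> d * (V\<^sup>2 + \<Phi>\<^sup>2)"
    and "\<bar>V * (r * V + w * R) - r * V\<^sup>2\<bar> \<le> d * (R\<^sup>2 + V\<^sup>2)"
proof -
  let ?n = "R\<^sup>2 + V\<^sup>2"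
  have RV: "\<bar>R\<bar> * \<bar>V\<bar> \<le> ?n / 2" by (rule abs_mult_le_squares)
  have RVn: "\<bar>R\<bar> * \<bar>V\<bar> \<le> ?n" by (rule abs_mult_le_sum_squares)
  have "\<bar>r * V + w * R\<bar> \<le> \<bar>r * V\<bar> + \<bar>w * R\<bar>" by (rule abs_triangle_ineq)
  also have "\<dots> \<le> b * \<bar>V\<bar> + 1 * \<bar>R\<bar>"
    unfolding abs_mult using r w d by (intro add_mono mult_right_mono) auto
  finally have M: "\<bar>r * V + w * R\<bar> \<le> b * \<bar>V\<bar> + \<bar>R\<bar>" by simp
  have "\<bar>(r * V + w * R) * F\<bar> \<le> (b * \<bar>V\<bar> + \<bar>R\<bar>) * (2 * d * \<bar>V\<bar>)"
    unfolding abs_mult using M F r d by (intro mult_mono) auto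
  also have "\<dots> = d * (2 * b * \<bar>V\<bar>\<^sup>2 + 2 * (\<bar>R\<bar> * \<bar>V\<bar>))"
    unfolding power2_eq_square by (simp only: algebra_simps)
  also have "\<dots> = d * (2 * b * V\<^sup>2 + 2 * (\<bar>R\<bar> * \<bar>V\<bar>))" by simp
  also have "\<dots> \<le> d * (2 * b * ?n + ?n)"
    using RV d r by (intro mult_left_mono add_mono) auto
  finally show "\<bar>(r * V + w * R) * F\<bar> \<le> d * ((2 * b + 1) * ?n)"
    by (simp add: algebra_simps)
  have "\<bar>s * V * R\<bar> = \<bar>s\<bar> * (\<bar>R\<bar> * \<bar>V\<bar>)"
    by (simp add: abs_mult)
  also have "\<dots> \<le> d * (\<bar>R\<bar> * \<bar>V\<bar>)"
    using s by (intro mult_right_mono) auto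
  also have "\<dots> \<le> d * ?n" using RVn d by (intro mult_left_mono) auto
  finally show "\<bar>s * V * R\<bar> \<le> d * ?n" .
  have "\<bar>F * \<Phi>\<bar> \<le> 2 * d * \<bar>V\<bar> * \<bar>\<Phi>\<bar>"
    unfolding abs_mult using F by (intro mult_right_mono) auto
  also have "\<dots> = d * (2 * (\<bar>V\<bar> * \<bar>\<Phi>\<bar>))" by simp
  also have "\<dots> \<le> d * (V\<^sup>2 + \<Phi>\<^sup>2)"
    using abs_mult_le_squares[of V \<Phi>] d by (intro mult_left_mono) auto
  finally show "\<bar>F * \<Phi>\<bar> \<le> d * (V\<^sup>2 + \<Phi>\<^sup>2)" .
  have "V * (r * V + w * R) - r * V\<^sup>2 = w * (R * V)"
    by (simp add: algebra_simps power2_eq_square)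
  also have "\<bar>\<dots>\<bar> \<le> d * (\<bar>R\<bar> * \<bar>V\<bar>)"
    unfolding abs_mult using w by (intro mult_right_mono) auto
  also have "\<dots> \<le> d * ?n" using RVn d by (intro mult_left_mono) auto
  finally show "\<bar>V * (r * V + w * R) - r * V\<^sup>2\<bar> \<le> d * ?n" .
qed

text \<open>The integrand left in the time derivative of the functional once the x-derivatives of H
  M and H \<Phi> have been integrated away, apart from the remainder with \<rho>_t and v_t. With H =
  \<open>A + s * V\<close> and M = \<open>r * V + w * R\<close> the first line comes from the energy
  and the bracket after \<open>e\<close> from V \<Phi>; \<open>\<Psi>\<close> is the antiderivative
  of \<open>Lr\<close> and enters through the time derivative of \<Phi>. Plain real arguments
  separate the inequalities from the differential equations.\<close>

definition dissipation ::
    "real \<Rightarrow> real \<Rightarrow> real \<Rightarrow> real \<Rightarrow> real \<Rightarrow> real \<Rightarrow> real \<Rightarrow> real \<Rightarrow> real \<Rightarrow> real \<Rightarrow> real \<Rightarrow> real \<Rightarrow> real \<Rightarrow> real" where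
  "dissipation \<gamma> e r w s A F Lr Lv R V \<Phi> \<Psi> =
     (A + s * V) * Lr + (r * V + w * R) * (Lv - \<gamma> * F)
     + e * ((A + s * V) * R + (Lv - \<gamma> * F) * \<Phi> + V * \<Psi> - V * (r * V + w * R))"

text \<open>The observer damps V. The factor \<open>- e\<close> in front of H R yields damping of R
  at the price of multiples of \<open>e * V\<^sup>2\<close>, which \<open>\<alpha>\<close> pays for.
  The number \<open>N\<close> stands for the integral of R^2 over the pipe: the last bracket
  integrates to just this integral, so the loss caused by \<Phi> is paid out of the gain in R. The
  order of the quantifiers is essential: \<open>e\<close>, \<open>c\<^sub>1\<close>,
  \<open>c\<^sub>3\<close>, \<open>C\<^sub>0\<close> do not depend on \<open>d\<close>.\<close>

lemma dissipation_velocity_damping: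
  fixes a b \<kappa> \<gamma> l \<alpha> B C e\<^sub>1 :: real
  assumes a: "0 < a" "a \<le> b" and pos: "0 < \<kappa>" "0 \<le> \<gamma>" "0 < l" "0 < \<alpha>" "0 \<le> B" "0 \<le> C" "0 < e\<^sub>1"
  obtains e c\<^sub>1 c\<^sub>3 C\<^sub>0 where "0 < e" "e \<le> e\<^sub>1" "0 < c\<^sub>1" "0 < c\<^sub>3" "0 \<le> C\<^sub>0"
    "\<And>d r w s A F Lv R V \<Phi> N. \<lbrakk>0 < d; d \<le> 1; a \<le> r; r \<le> b; \<bar>w\<bar> \<le> d; \<bar>s\<bar> \<le> d;
      \<kappa> * R\<^sup>2 \<le> A * R; \<bar>F\<bar> \<le> 2 * d * \<bar>V\<bar>;
      (r * V + w * R) * Lv \<le> - \<alpha> * V\<^sup>2 + d * (C * (R\<^sup>2 + V\<^sup>2)); \<bar>Lv\<bar> \<le> B * \<bar>V\<bar> + d * C * \<bar>R\<bar>;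
      \<Phi>\<^sup>2 \<le> l * N\<rbrakk> \<Longrightarrow>
      dissipation \<gamma> (- e) r w s A F 0 Lv R V \<Phi> 0
        \<le> d * C\<^sub>0 * (R\<^sup>2 + V\<^sup>2 + N) - c\<^sub>1 * V\<^sup>2 - c\<^sub>3 * (2 * R\<^sup>2 - N / l)"
proof -
  \<comment> \<open>Weight in Young's inequality that spends half of the gain in R on \<Phi>:
    \<open>\<theta> * (l * N)\<close> equals \<open>\<kappa> / 2 * (N / l)\<close>.\<close>
  define \<theta> where "\<theta> = \<kappa> / (2 * l\<^sup>2)"
  \<comment> \<open>Cost in V^2 per unit of \<open>e\<close>: \<open>b\<close> comes from V M, the
    rest from Young's inequality.\<close>
  define k where "k = b + B\<^sup>2 / (4 * \<theta>)"
  define e where "e = min e\<^sub>1 (min 1 (\<alpha> / (2 * k)))"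
  \<comment> \<open>Sum of the coefficients with which \<open>d * n\<close> occurs in the collected
    estimate.\<close>
  define D where "D = 2 * C + \<gamma> * (2 * b + 1) + \<gamma> + 2"
  have \<theta>: "0 < \<theta>" using pos by (simp add: \<theta>_def)
  have k: "0 < k" using a \<theta> by (simp add: k_def add_pos_nonneg)
  have e: "0 < e" "e \<le> e\<^sub>1" "e \<le> 1" "e * k \<le> \<alpha> / 2"
  proof -
    have "e \<le> \<alpha> / (2 * k)" by (simp add: e_def)
    then show "e * k \<le> \<alpha> / 2" using k by (simp add: field_simps)
  qed (use pos k in \<open>auto simp: e_def\<close>)
  have D: "0 \<le> D" using pos a by (simp add: D_def)
  show thesis
  proof (rule that[of e "\<alpha> / 2" "e * \<kappa> / 2" "D * (1 + l)"])
    fix d r w s A F Lv R V \<Phi> N :: real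
    assume d: "0 < d" "d \<le> 1" and r: "a \<le> r" "r \<le> b" and w: "\<bar>w\<bar> \<le> d" and s: "\<bar>s\<bar> \<le> d"
      and A: "\<kappa> * R\<^sup>2 \<le> A * R" and F: "\<bar>F\<bar> \<le> 2 * d * \<bar>V\<bar>"
      and L1: "(r * V + w * R) * Lv \<le> - \<alpha> * V\<^sup>2 + d * (C * (R\<^sup>2 + V\<^sup>2))"
      and L2: "\<bar>Lv\<bar> \<le> B * \<bar>V\<bar> + d * C * \<bar>R\<bar>" and \<Phi>: "\<Phi>\<^sup>2 \<le> l * N"
    define M where "M = r * V + w * R"
    define n where "n = R\<^sup>2 + V\<^sup>2"
    note small = pointwise_small_terms[OF d r a(1) w s F, of R, folded M_def n_def]
      pointwise_small_terms(3)[OF d r a(1) w s F, of \<Phi>]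
    have n: "0 \<le> n" "R\<^sup>2 \<le> n" "V\<^sup>2 \<le> n" by (auto simp: n_def)
    have N: "0 \<le> N"
      using \<Phi> pos zero_le_power2[of \<Phi>] by (metis mult_pos_neg not_le order_trans)
    have 1: "- (\<gamma> * (M * F)) \<le> d * (\<gamma> * (2 * b + 1) * n)"
      using mult_left_mono[OF small(1) pos(2)] pos(2) abs_ge_minus_self[of "M * F"]
        mult_left_mono[of "- (M * F)" "\<bar>M * F\<bar>" \<gamma>] by (simp add: algebra_simps)
    have 2: "- (e * (A * R)) \<le> - (e * (\<kappa> * R\<^sup>2))"
      using A e by (simp add: mult_left_mono)
    have 3: "- (e * (s * V * R)) \<le> d * n"
      using small(2) e d n by (intro mult_small_le) auto
    \<comment> \<open>The part of \<open>Lv\<close> in \<open>R\<close> carries a factor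
      \<open>d\<close> and joins the small terms; only the part in \<open>V\<close> has to go
      through Young's inequality with weight \<open>\<theta>\<close>.\<close>
    have 4: "- (e * (Lv * \<Phi>)) \<le> e * (B\<^sup>2 / (4 * \<theta>) * V\<^sup>2 + \<theta> * \<Phi>\<^sup>2) + d * (C * (n + \<Phi>\<^sup>2))"
    proof -
      have "- (Lv * \<Phi>) \<le> \<bar>Lv\<bar> * \<bar>\<Phi>\<bar>" by (simp flip: abs_mult)
      also have "\<dots> \<le> (B * \<bar>V\<bar> + d * C * \<bar>R\<bar>) * \<bar>\<Phi>\<bar>"
        using L2 by (intro mult_right_mono) auto
      also have "\<dots> = B * \<bar>V\<bar> * \<bar>\<Phi>\<bar> + d * C * (\<bar>R\<bar> * \<bar>\<Phi>\<bar>)"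
        by (simp add: algebra_simps)
      finally have "e * - (Lv * \<Phi>) \<le> e * (B * \<bar>V\<bar> * \<bar>\<Phi>\<bar> + d * C * (\<bar>R\<bar> * \<bar>\<Phi>\<bar>))"
        using e by (intro mult_left_mono) auto
      moreover have "e * (B * \<bar>V\<bar> * \<bar>\<Phi>\<bar>) \<le> e * (B\<^sup>2 / (4 * \<theta>) * V\<^sup>2 + \<theta> * \<Phi>\<^sup>2)"
        using e weighted_young[OF \<theta>] by (intro mult_left_mono) auto
      moreover have "e * (d * C * (\<bar>R\<bar> * \<bar>\<Phi>\<bar>)) \<le> 1 * (d * C * (n + \<Phi>\<^sup>2))"
      proof (intro mult_mono)
        have "\<bar>R\<bar> * \<bar>\<Phi>\<bar> \<le> R\<^sup>2 + \<Phi>\<^sup>2" by (rule abs_mult_le_sum_squares)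
        also have "\<dots> \<le> n + \<Phi>\<^sup>2" using n by simp
        finally show "\<bar>R\<bar> * \<bar>\<Phi>\<bar> \<le> n + \<Phi>\<^sup>2" .
      qed (use e d pos n in auto)
      ultimately show ?thesis by (simp add: algebra_simps)
    qed
    have 5: "e * (\<gamma> * (F * \<Phi>)) \<le> d * (\<gamma> * (n + \<Phi>\<^sup>2))"
    proof (rule mult_small_le)
      have "\<bar>F * \<Phi>\<bar> \<le> d * (n + \<Phi>\<^sup>2)"
        using small(5) n d mult_left_mono[of "V\<^sup>2 + \<Phi>\<^sup>2" "n + \<Phi>\<^sup>2" d] by linarith
      then show "\<bar>\<gamma> * (F * \<Phi>)\<bar> \<le> d * (\<gamma> * (n + \<Phi>\<^sup>2))"
        unfolding abs_mult[of \<gamma>] using pos(2) mult_left_mono[of "\<bar>F * \<Phi>\<bar>" "d * (n + \<Phi>\<^sup>2)" \<gamma>]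
        by (simp add: mult_ac)
    qed (use e d pos n in auto)
    have 6: "e * (V * M) \<le> e * (b * V\<^sup>2) + d * n"
    proof -
      have "e * (V * M - r * V\<^sup>2) \<le> d * n"
        using small(4) e d n by (intro mult_small_le) auto
      moreover have "e * (r * V\<^sup>2) \<le> e * (b * V\<^sup>2)"
        using r e by (intro mult_left_mono mult_right_mono) auto
      ultimately show ?thesis by (simp add: algebra_simps)
    qed
    have "dissipation \<gamma> (- e) r w s A F 0 Lv R V \<Phi> 0 = M * Lv - \<gamma> * (M * F) - e * (A * R)
        - e * (s * V * R) - e * (Lv * \<Phi>) + e * (\<gamma> * (F * \<Phi>)) + e * (V * M)"
      unfolding dissipation_def M_def[symmetric] by (simp add: algebra_simps)
    also have "\<dots> \<le> (- \<alpha> * V\<^sup>2 + d * (C * n)) + d * (\<gamma> * (2 * b + 1) * n) - e * (\<kappa> * R\<^sup>2) + d * n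
        + (e * (B\<^sup>2 / (4 * \<theta>) * V\<^sup>2 + \<theta> * \<Phi>\<^sup>2) + d * (C * (n + \<Phi>\<^sup>2))) + d * (\<gamma> * (n + \<Phi>\<^sup>2))
        + (e * (b * V\<^sup>2) + d * n)"
      using 1 2 3 4 5 6 L1 unfolding M_def[symmetric] n_def[symmetric] by linarith
    also have "\<dots> = d * (D * n + (C + \<gamma>) * \<Phi>\<^sup>2) + (e * k - \<alpha>) * V\<^sup>2 - e * (\<kappa> * R\<^sup>2) + e * \<theta> * \<Phi>\<^sup>2"
      by (simp add: D_def k_def algebra_simps)
    also have "\<dots> \<le> d * (D * (1 + l) * (n + N)) + (- \<alpha> / 2) * V\<^sup>2 - e * (\<kappa> * R\<^sup>2) + e * \<theta> * (l * N)"
    proof (intro add_mono diff_mono mult_left_mono[of _ _ d] mult_right_mono[of _ _ "V\<^sup>2"]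
        mult_left_mono[of _ _ "e * \<theta>"])
      have "(C + \<gamma>) * \<Phi>\<^sup>2 \<le> D * (l * N)"
        using \<Phi> pos a by (intro mult_mono) (auto simp: D_def)
      moreover have "0 \<le> D * l * n" "0 \<le> D * N" using D pos n N by auto
      ultimately show "D * n + (C + \<gamma>) * \<Phi>\<^sup>2 \<le> D * (1 + l) * (n + N)"
        by (simp add: algebra_simps)
    qed (use d e \<theta> \<Phi> in auto)
    also have "e * \<theta> * (l * N) = e * \<kappa> / 2 * (N / l)"
      using pos by (simp add: \<theta>_def power2_eq_square field_simps)
    finally show "dissipation \<gamma> (- e) r w s A F 0 Lv R V \<Phi> 0
        \<le> d * (D * (1 + l)) * (R\<^sup>2 + V\<^sup>2 + N) - \<alpha> / 2 * V\<^sup>2 - e * \<kappa> / 2 * (2 * R\<^sup>2 - N / l)"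
      by (simp add: n_def algebra_simps)
  qed (use e D pos in auto)
qed

text \<open>The roles are exchanged: the observer damps R, and - V M with a positive factor
  \<open>e\<close> damps V. The price is a multiple of \<open>e * R\<^sup>2\<close> from H R and the
  term V \<Psi>, which has no factor \<open>d\<close>; both are paid by \<open>\<beta>\<close>, so
  \<open>e\<close> has to be small against it.\<close>

lemma dissipation_density_damping:
  fixes a b K \<gamma> l \<beta> \<Lambda> e\<^sub>1 :: real
  assumes a: "0 < a" "a \<le> b" and pos: "0 < K" "0 \<le> \<gamma>" "0 < l" "0 < \<beta>" "0 < \<Lambda>" "0 < e\<^sub>1"
  obtains e c\<^sub>1 c\<^sub>3 C\<^sub>0 where "0 < e" "e \<le> e\<^sub>1" "0 < c\<^sub>1" "0 < c\<^sub>3" "0 \<le> C\<^sub>0"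
    "\<And>d r w s A F Lr R V \<Phi> \<Psi> N. \<lbrakk>0 < d; d \<le> 1; a \<le> r; r \<le> b; \<bar>w\<bar> \<le> d; \<bar>s\<bar> \<le> d;
      A * R \<le> K * R\<^sup>2; \<bar>F\<bar> \<le> 2 * d * \<bar>V\<bar>; A * Lr \<le> - \<beta> * R\<^sup>2; \<bar>Lr\<bar> \<le> \<Lambda> * \<bar>R\<bar>;
      \<Phi>\<^sup>2 \<le> l * N; \<Psi>\<^sup>2 \<le> l * (\<Lambda>\<^sup>2 * N)\<rbrakk> \<Longrightarrow>
      dissipation \<gamma> e r w s A F Lr 0 R V \<Phi> \<Psi>
        \<le> d * C\<^sub>0 * (R\<^sup>2 + V\<^sup>2 + N) - c\<^sub>1 * V\<^sup>2 - c\<^sub>3 * (2 * R\<^sup>2 - N / l)"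
proof -
  \<comment> \<open>The bound \<open>\<beta> / (2 * K)\<close> keeps half of the damping of R
    against H R. The last bound makes the share of \<open>N\<close> in V \<Psi> at most
    \<open>\<beta> / 4 * (N / l)\<close>, after Young's inequality with weight \<open>a / 2\<close>
    has left half of the damping of V.\<close>
  define e where "e = min e\<^sub>1 (min 1 (min (\<beta> / (2 * K)) (\<beta> * a / (2 * l\<^sup>2 * \<Lambda>\<^sup>2))))"
  define D where "D = \<Lambda> + \<gamma> * (2 * b + 1) + \<gamma> + 2"
  have e: "0 < e" "e \<le> e\<^sub>1" "e \<le> 1" "e * K \<le> \<beta> / 2" "e * (l * \<Lambda>\<^sup>2 / (2 * a)) \<le> \<beta> / 4 / l"
  proof -
    have "e \<le> \<beta> / (2 * K)" by (simp add: e_def)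
    then show "e * K \<le> \<beta> / 2" using pos by (simp add: field_simps)
    have "e \<le> \<beta> * a / (2 * l\<^sup>2 * \<Lambda>\<^sup>2)" by (simp add: e_def)
    then have "e * (l * \<Lambda>\<^sup>2 / (2 * a)) \<le> \<beta> * a / (2 * l\<^sup>2 * \<Lambda>\<^sup>2) * (l * \<Lambda>\<^sup>2 / (2 * a))"
      using pos a by (intro mult_right_mono) auto
    also have "\<dots> = \<beta> / 4 / l" using pos a by (simp add: power2_eq_square field_simps)
    finally show "e * (l * \<Lambda>\<^sup>2 / (2 * a)) \<le> \<beta> / 4 / l" .
  qed (use pos a in \<open>auto simp: e_def\<close>)
  have D: "0 \<le> D" using pos a by (simp add: D_def)
  show thesis
  proof (rule that[of e "e * a / 2" "\<beta> / 4" "D * (1 + l)"])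
    fix d r w s A F Lr R V \<Phi> \<Psi> N :: real
    assume d: "0 < d" "d \<le> 1" and r: "a \<le> r" "r \<le> b" and w: "\<bar>w\<bar> \<le> d" and s: "\<bar>s\<bar> \<le> d"
      and A: "A * R \<le> K * R\<^sup>2" and F: "\<bar>F\<bar> \<le> 2 * d * \<bar>V\<bar>"
      and L1: "A * Lr \<le> - \<beta> * R\<^sup>2" and L2: "\<bar>Lr\<bar> \<le> \<Lambda> * \<bar>R\<bar>" and \<Phi>: "\<Phi>\<^sup>2 \<le> l * N"
      and \<Psi>: "\<Psi>\<^sup>2 \<le> l * (\<Lambda>\<^sup>2 * N)"
    define M where "M = r * V + w * R"
    define n where "n = R\<^sup>2 + V\<^sup>2"
    note small = pointwise_small_terms[OF d r a(1) w s F, of R, folded M_def n_def]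
      pointwise_small_terms(3)[OF d r a(1) w s F, of \<Phi>]
    have n: "0 \<le> n" "R\<^sup>2 \<le> n" "V\<^sup>2 \<le> n" by (auto simp: n_def)
    have N: "0 \<le> N"
      using \<Phi> pos zero_le_power2[of \<Phi>] by (metis mult_pos_neg not_le order_trans)
    have 1: "- (\<gamma> * (M * F)) \<le> d * (\<gamma> * (2 * b + 1) * n)"
      using mult_left_mono[OF small(1) pos(2)] pos(2) abs_ge_minus_self[of "M * F"]
        mult_left_mono[of "- (M * F)" "\<bar>M * F\<bar>" \<gamma>] by (simp add: algebra_simps)
    have 2: "e * (A * R) \<le> \<beta> / 2 * R\<^sup>2"
    proof -
      have "e * (A * R) \<le> e * (K * R\<^sup>2)" using A e by (intro mult_left_mono) auto
      also have "\<dots> = (e * K) * R\<^sup>2" by simp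
      also have "\<dots> \<le> \<beta> / 2 * R\<^sup>2" using e by (intro mult_right_mono) auto
      finally show ?thesis .
    qed
    have 3: "e * (s * V * R) \<le> d * n"
      using small(2) e d n by (intro mult_small_le) auto
    have 4: "s * V * Lr \<le> d * (\<Lambda> * n)"
    proof -
      have "s * V * Lr \<le> \<bar>s\<bar> * (\<bar>Lr\<bar> * \<bar>V\<bar>)"
        by (rule order_trans[OF abs_ge_self]) (simp add: abs_mult mult_ac)
      also have "\<dots> \<le> d * ((\<Lambda> * \<bar>R\<bar>) * \<bar>V\<bar>)"
        using s L2 d by (intro mult_mono mult_right_mono) auto
      also have "\<dots> \<le> d * (\<Lambda> * n)"
        unfolding mult.assoc n_def using abs_mult_le_sum_squares[of R V] d pos
        by (intro mult_left_mono) auto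
      finally show ?thesis .
    qed
    have 5: "- (e * (\<gamma> * (F * \<Phi>))) \<le> d * (\<gamma> * (n + \<Phi>\<^sup>2))"
    proof (rule mult_small_le)
      have "\<bar>F * \<Phi>\<bar> \<le> d * (n + \<Phi>\<^sup>2)"
        using small(5) n d mult_left_mono[of "V\<^sup>2 + \<Phi>\<^sup>2" "n + \<Phi>\<^sup>2" d] by linarith
      then show "\<bar>\<gamma> * (F * \<Phi>)\<bar> \<le> d * (\<gamma> * (n + \<Phi>\<^sup>2))"
        unfolding abs_mult[of \<gamma>] using pos(2) mult_left_mono[of "\<bar>F * \<Phi>\<bar>" "d * (n + \<Phi>\<^sup>2)" \<gamma>]
        by (simp add: mult_ac)
    qed (use e d pos n in auto)
    have 6: "- (e * (V * M)) \<le> - (e * (a * V\<^sup>2)) + d * n"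
    proof -
      have "- (e * (V * M - r * V\<^sup>2)) \<le> d * n"
        using small(4) e d n by (intro mult_small_le) auto
      moreover have "e * (a * V\<^sup>2) \<le> e * (r * V\<^sup>2)"
        using r e by (intro mult_left_mono mult_right_mono) auto
      ultimately show ?thesis by (simp add: algebra_simps)
    qed
    have 7: "e * (V * \<Psi>) \<le> e * a / 2 * V\<^sup>2 + \<beta> / 4 * (N / l)"
    proof -
      have "V * \<Psi> \<le> \<Lambda>\<^sup>2 * (l * N) / (2 * a) + a / 2 * V\<^sup>2"
      proof -
        have "V * \<Psi> \<le> 1 * \<bar>\<Psi>\<bar> * \<bar>V\<bar>"
          by (rule order_trans[OF abs_ge_self]) (simp add: abs_mult mult_ac)
        also have "\<dots> \<le> 1\<^sup>2 / (4 * (a / 2)) * \<Psi>\<^sup>2 + a / 2 * V\<^sup>2"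
          using a by (intro weighted_young) auto
        also have "\<dots> \<le> 1\<^sup>2 / (4 * (a / 2)) * (l * (\<Lambda>\<^sup>2 * N)) + a / 2 * V\<^sup>2"
          using a \<Psi> by (intro add_right_mono mult_left_mono) auto
        finally show ?thesis by (simp add: mult_ac)
      qed
      then have "e * (V * \<Psi>) \<le> e * (\<Lambda>\<^sup>2 * (l * N) / (2 * a) + a / 2 * V\<^sup>2)"
        using e by (intro mult_left_mono) auto
      also have "\<dots> = e * (l * \<Lambda>\<^sup>2 / (2 * a)) * N + e * a / 2 * V\<^sup>2"
        by (simp add: algebra_simps)
      also have "\<dots> \<le> \<beta> / 4 / l * N + e * a / 2 * V\<^sup>2"
        using e N by (intro add_right_mono mult_right_mono) auto
      finally show ?thesis by (simp add: algebra_simps)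
    qed
    have "dissipation \<gamma> e r w s A F Lr 0 R V \<Phi> \<Psi> = A * Lr + s * V * Lr - \<gamma> * (M * F) + e * (A * R)
        + e * (s * V * R) - e * (\<gamma> * (F * \<Phi>)) + e * (V * \<Psi>) - e * (V * M)"
      unfolding dissipation_def M_def[symmetric] by (simp add: algebra_simps)
    also have "\<dots> \<le> - \<beta> * R\<^sup>2 + d * (\<Lambda> * n) + d * (\<gamma> * (2 * b + 1) * n) + \<beta> / 2 * R\<^sup>2
        + d * n + d * (\<gamma> * (n + \<Phi>\<^sup>2)) + (e * a / 2 * V\<^sup>2 + \<beta> / 4 * (N / l))
        + (- (e * (a * V\<^sup>2)) + d * n)"
      using 1 2 3 4 5 6 7 L1 by linarith
    also have "\<dots> = d * (D * n + \<gamma> * \<Phi>\<^sup>2) - e * a / 2 * V\<^sup>2 - \<beta> / 4 * (2 * R\<^sup>2 - N / l)"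
      by (simp add: D_def algebra_simps)
    also have "\<dots> \<le> d * (D * (1 + l) * (n + N)) - e * a / 2 * V\<^sup>2 - \<beta> / 4 * (2 * R\<^sup>2 - N / l)"
    proof (intro diff_right_mono mult_left_mono[of _ _ d])
      have "\<gamma> * \<Phi>\<^sup>2 \<le> D * (l * N)"
        using \<Phi> pos a by (intro mult_mono) (auto simp: D_def)
      moreover have "0 \<le> D * l * n" "0 \<le> D * N" using D pos n N by auto
      ultimately show "D * n + \<gamma> * \<Phi>\<^sup>2 \<le> D * (1 + l) * (n + N)"
        by (simp add: algebra_simps)
    qed (use d in auto)
    finally show "dissipation \<gamma> e r w s A F Lr 0 R V \<Phi> \<Psi>
        \<le> d * (D * (1 + l)) * (R\<^sup>2 + V\<^sup>2 + N) - e * a / 2 * V\<^sup>2 - \<beta> / 4 * (2 * R\<^sup>2 - N / l)"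
      by (simp add: n_def algebra_simps)
  qed (use e D pos a in auto)
qed

section \<open>Evolution of the error\<close>

text \<open>One small number \<open>d\<close> bounds the time derivatives of the observed solution,
  in the guise of Lipschitz constants, and the velocities of both systems. The time constants of the
  observer state are arbitrary, since none of its derivatives enters the estimates. The sources are
  kept general, so that all measurements are treated together.\<close>

locale error_system =
  fixes P P\<^sub>1 P\<^sub>2 P\<^sub>3 :: "real \<Rightarrow> real" and a b \<gamma> l T d K\<^sub>3 :: real
    and \<rho> v \<rho>' v' L\<^sub>\<rho> L\<^sub>v :: "real \<Rightarrow> real \<Rightarrow> real"
  assumes a: "0 < a" "a \<le> b" and \<gamma>: "0 \<le> \<gamma>" and l: "0 < l" and T: "0 < T" and d: "0 < d" "d \<le> 1"
    and P: "\<And>y. 0 < y \<Longrightarrow> (P has_real_derivative P\<^sub>1 y) (at y)"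
      "\<And>y. 0 < y \<Longrightarrow> (P\<^sub>1 has_real_derivative P\<^sub>2 y) (at y)"
      "\<And>y. 0 < y \<Longrightarrow> (P\<^sub>2 has_real_derivative P\<^sub>3 y) (at y)"
    and P3: "\<And>y. y \<in> {a..b} \<Longrightarrow> \<bar>P\<^sub>3 y\<bar> \<le> K\<^sub>3"
    and lip_t: "\<And>x. x \<in> {0..l} \<Longrightarrow> d-lipschitz_on {0..T} (\<lambda>t. \<rho> t x)"
      "\<And>x. x \<in> {0..l} \<Longrightarrow> d-lipschitz_on {0..T} (\<lambda>t. v t x)"
      "\<exists>C. \<forall>x\<in>{0..l}. C-lipschitz_on {0..T} (\<lambda>t. \<rho>' t x)"
      "\<exists>C. \<forall>x\<in>{0..l}. C-lipschitz_on {0..T} (\<lambda>t. v' t x)"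
    and lip_x: "\<And>t. t \<in> {0..T} \<Longrightarrow> \<exists>C. C-lipschitz_on {0..l} (\<rho> t)"
      "\<And>t. t \<in> {0..T} \<Longrightarrow> \<exists>C. C-lipschitz_on {0..l} (v t)"
      "\<And>t. t \<in> {0..T} \<Longrightarrow> \<exists>C. C-lipschitz_on {0..l} (\<rho>' t)"
      "\<And>t. t \<in> {0..T} \<Longrightarrow> \<exists>C. C-lipschitz_on {0..l} (v' t)"
    and bounds: "\<And>t x. t \<in> {0..T} \<Longrightarrow> x \<in> {0..l} \<Longrightarrow> \<rho> t x \<in> {a..b}"
      "\<And>t x. t \<in> {0..T} \<Longrightarrow> x \<in> {0..l} \<Longrightarrow> \<rho>' t x \<in> {a..b}"
      "\<And>t x. t \<in> {0..T} \<Longrightarrow> x \<in> {0..l} \<Longrightarrow> \<bar>v t x\<bar> \<le> d"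
      "\<And>t x. t \<in> {0..T} \<Longrightarrow> x \<in> {0..l} \<Longrightarrow> \<bar>v' t x\<bar> \<le> d"
    and boundary: "\<And>t. t \<in> {0..T} \<Longrightarrow> \<rho> t 0 * v t 0 = \<rho>' t 0 * v' t 0"
      "\<And>t. t \<in> {0..T} \<Longrightarrow> (v t l)\<^sup>2 / 2 + P\<^sub>1 (\<rho> t l) = (v' t l)\<^sup>2 / 2 + P\<^sub>1 (\<rho>' t l)"
    and source: "\<And>t. t \<in> {0..T} \<Longrightarrow> continuous_on {0..l} (L\<^sub>\<rho> t)"
      "\<And>t. t \<in> {0..T} \<Longrightarrow> continuous_on {0..l} (L\<^sub>v t)"
    and solution: "AE (t, x) in lborel. t \<in> {0<..<T} \<and> x \<in> {0<..<l} \<longrightarrow>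
       (\<exists>\<rho>\<^sub>t m\<^sub>x v\<^sub>t h\<^sub>x.
          ((\<lambda>s. \<rho> s x) has_real_derivative \<rho>\<^sub>t) (at t) \<and>
          ((\<lambda>y. \<rho> t y * v t y) has_real_derivative m\<^sub>x) (at x) \<and>
          ((\<lambda>s. v s x) has_real_derivative v\<^sub>t) (at t) \<and>
          ((\<lambda>y. (v t y)\<^sup>2 / 2 + P\<^sub>1 (\<rho> t y)) has_real_derivative h\<^sub>x) (at x) \<and>
          \<rho>\<^sub>t + m\<^sub>x = 0 \<and> v\<^sub>t + h\<^sub>x = - \<gamma> * \<bar>v t x\<bar> * v t x)"
    and observer: "AE (t, x) in lborel. t \<in> {0<..<T} \<and> x \<in> {0<..<l} \<longrightarrow>
       (\<exists>\<rho>\<^sub>t m\<^sub>x v\<^sub>t h\<^sub>x.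
          ((\<lambda>s. \<rho>' s x) has_real_derivative \<rho>\<^sub>t) (at t) \<and>
          ((\<lambda>y. \<rho>' t y * v' t y) has_real_derivative m\<^sub>x) (at x) \<and>
          ((\<lambda>s. v' s x) has_real_derivative v\<^sub>t) (at t) \<and>
          ((\<lambda>y. (v' t y)\<^sup>2 / 2 + P\<^sub>1 (\<rho>' t y)) has_real_derivative h\<^sub>x) (at x) \<and>
          \<rho>\<^sub>t + m\<^sub>x = L\<^sub>\<rho> t x \<and> v\<^sub>t + h\<^sub>x = - \<gamma> * \<bar>v' t x\<bar> * v' t x + L\<^sub>v t x)"
begin

definition "R t x = \<rho>' t x - \<rho> t x"
definition "V t x = v' t x - v t x"
definition "A t x = P\<^sub>1 (\<rho>' t x) - P\<^sub>1 (\<rho> t x)"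
text \<open>The mean velocity, from the factorisation (v'^2 - v^2)/2 = S V; it puts the enthalpy
  error into the form \<open>A + s * V\<close> of \<open>dissipation\<close>.\<close>

definition "S t x = (v t x + v' t x) / 2"
definition "M t x = \<rho>' t x * V t x + v t x * R t x"
definition "H t x = A t x + S t x * V t x"
definition "F t x = \<bar>v' t x\<bar> * v' t x - \<bar>v t x\<bar> * v t x"
definition "\<Phi> t x = integral {0..x} (R t)"
definition "\<Psi> t x = integral {0..x} (L\<^sub>\<rho> t)"

text \<open>The relative energy of \<open>(\<rho>', v')\<close> with respect to \<open>(\<rho>, v)\<close>.\<close>

definition "E t x = \<rho>' t x * (V t x)\<^sup>2 / 2 + v t x * R t x * V t x
   + (P (\<rho>' t x) - P (\<rho> t x) - P\<^sub>1 (\<rho> t x) * R t x)"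

definition "energy e t = integral {0..l} (\<lambda>x. E t x + e * (V t x * \<Phi> t x))"

definition "dis e t x = dissipation \<gamma> e (\<rho>' t x) (v t x) (S t x) (A t x) (F t x) (L\<^sub>\<rho> t x) (L\<^sub>v t x)
    (R t x) (V t x) (\<Phi> t x) (\<Psi> t x)"

lemma M_eq: "M t x = \<rho>' t x * v' t x - \<rho> t x * v t x"
  by (simp add: M_def R_def V_def algebra_simps)

lemma H_eq: "H t x = ((v' t x)\<^sup>2 / 2 + P\<^sub>1 (\<rho>' t x)) - ((v t x)\<^sup>2 / 2 + P\<^sub>1 (\<rho> t x))"
  by (simp add: H_def A_def S_def V_def power2_eq_square field_simps)

lemma pos: "t \<in> {0..T} \<Longrightarrow> x \<in> {0..l} \<Longrightarrow> 0 < \<rho> t x" "t \<in> {0..T} \<Longrightarrow> x \<in> {0..l} \<Longrightarrow> 0 < \<rho>' t x"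
  using bounds(1,2)[of t x] a by auto

lemma P_deriv: "y \<in> {a..b} \<Longrightarrow> (P has_real_derivative P\<^sub>1 y) (at y)"
  "y \<in> {a..b} \<Longrightarrow> (P\<^sub>1 has_real_derivative P\<^sub>2 y) (at y)"
  using P a by auto

lemma P_cont: "continuous_on {a..b} P\<^sub>1" "continuous_on {a..b} P\<^sub>2"
  using DERIV_isCont[OF P(2)] DERIV_isCont[OF P(3)] a by (auto intro!: continuous_at_imp_continuous_on)

lemma unif_lip_time:
  "unif_lip {0..T} {0..l} \<rho>" "unif_lip {0..T} {0..l} v"
  "unif_lip {0..T} {0..l} \<rho>'" "unif_lip {0..T} {0..l} v'"
proof -
  have *: "unif_lip {0..T} {0..l} u"
    if "\<And>t x. t \<in> {0..T} \<Longrightarrow> x \<in> {0..l} \<Longrightarrow> \<bar>u t x\<bar> \<le> B"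
      "\<forall>x\<in>{0..l}. C-lipschitz_on {0..T} (\<lambda>t. u t x)" for u :: "real \<Rightarrow> real \<Rightarrow> real" and B C
  proof (rule unif_lipI[where B=B and K=C])
    fix x s t assume "x \<in> {0..l}" "s \<in> {0..T}" "t \<in> {0..T}"
    then show "\<bar>u s x - u t x\<bar> \<le> C * \<bar>s - t\<bar>"
      using that(2) lipschitz_onD[of C "{0..T}" "\<lambda>t. u t x" s t] by (auto simp: dist_real_def)
  qed (use that in auto)
  have b: "\<bar>\<rho> t x\<bar> \<le> b" "\<bar>\<rho>' t x\<bar> \<le> b" if "t \<in> {0..T}" "x \<in> {0..l}" for t x
    using bounds(1,2)[OF that] a by auto
  obtain C where "\<forall>x\<in>{0..l}. C-lipschitz_on {0..T} (\<lambda>t. \<rho>' t x)" using lip_t(3) by blast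
  then show "unif_lip {0..T} {0..l} \<rho>'" by (intro *[where B=b]) (use b in auto)
  obtain C where "\<forall>x\<in>{0..l}. C-lipschitz_on {0..T} (\<lambda>t. v' t x)" using lip_t(4) by blast
  then show "unif_lip {0..T} {0..l} v'" by (intro *[where B=d]) (use bounds in auto)
  show "unif_lip {0..T} {0..l} \<rho>" by (intro *[where B=b and C=d]) (use b lip_t in auto)
  show "unif_lip {0..T} {0..l} v" by (intro *[where B=d and C=d]) (use bounds lip_t in auto)
qed

lemma unif_lip_space:
  assumes t: "t \<in> {0..T}"
  shows "unif_lip {0..l} {t} (\<lambda>x t. \<rho> t x)" "unif_lip {0..l} {t} (\<lambda>x t. v t x)"
    "unif_lip {0..l} {t} (\<lambda>x t. \<rho>' t x)" "unif_lip {0..l} {t} (\<lambda>x t. v' t x)"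
proof -
  have *: "unif_lip {0..l} {t} (\<lambda>x t. u t x)"
    if B: "\<And>x. x \<in> {0..l} \<Longrightarrow> \<bar>u t x\<bar> \<le> B" and L: "\<exists>C. C-lipschitz_on {0..l} (u t)"
    for u :: "real \<Rightarrow> real \<Rightarrow> real" and B
  proof -
    obtain C where C: "C-lipschitz_on {0..l} (u t)" using L by blast
    show ?thesis
    proof (rule unif_lipI[where B=B and K=C])
      fix s x y assume "s \<in> {t}" "x \<in> {0..l}" "y \<in> {0..l}"
      then show "\<bar>u s x - u s y\<bar> \<le> C * \<bar>x - y\<bar>"
        using lipschitz_onD[OF C, of x y] by (auto simp: dist_real_def)
    qed (use B in auto)
  qed
  have b: "\<bar>\<rho> t x\<bar> \<le> b" "\<bar>\<rho>' t x\<bar> \<le> b" if "x \<in> {0..l}" for x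
    using bounds(1,2)[OF t that] a by auto
  show "unif_lip {0..l} {t} (\<lambda>x t. \<rho> t x)" by (rule *[where B=b]) (use b lip_x t in auto)
  show "unif_lip {0..l} {t} (\<lambda>x t. v t x)" by (rule *[where B=d]) (use bounds lip_x t in auto)
  show "unif_lip {0..l} {t} (\<lambda>x t. \<rho>' t x)" by (rule *[where B=b]) (use b lip_x t in auto)
  show "unif_lip {0..l} {t} (\<lambda>x t. v' t x)" by (rule *[where B=d]) (use bounds lip_x t in auto)
qed

lemma unif_lip_space_MH:
  assumes t: "t \<in> {0..T}"
  shows "unif_lip {0..l} {t} (\<lambda>x t. M t x)" "unif_lip {0..l} {t} (\<lambda>x t. H t x)"
proof -
  have PP: "unif_lip {0..l} {t} (\<lambda>x t. P\<^sub>1 (\<rho> t x))" "unif_lip {0..l} {t} (\<lambda>x t. P\<^sub>1 (\<rho>' t x))"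
    by (rule unif_lip_compose[OF P_deriv(2) P_cont(2) unif_lip_space(1)[OF t]]
        unif_lip_compose[OF P_deriv(2) P_cont(2) unif_lip_space(3)[OF t]], assumption,
        use t bounds in force)+
  show "unif_lip {0..l} {t} (\<lambda>x t. M t x)"
    unfolding M_eq by (intro unif_lip_diff unif_lip_mult unif_lip_space t)
  have c: "unif_lip {0..l} {t} (\<lambda>x t. (u x t)\<^sup>2 / 2)" if "unif_lip {0..l} {t} u" for u
    using unif_lip_mult[OF unif_lip_power2[OF that] unif_lip_const[of _ _ "1/2"]] by simp
  show "unif_lip {0..l} {t} (\<lambda>x t. H t x)"
    unfolding H_eq by (intro unif_lip_diff unif_lip_add c unif_lip_space t PP)
qed

lemma cont:
  assumes t: "t \<in> {0..T}"
  shows "continuous_on {0..l} (\<rho> t)" "continuous_on {0..l} (v t)"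
    "continuous_on {0..l} (\<rho>' t)" "continuous_on {0..l} (v' t)"
    "continuous_on {0..l} (\<lambda>x. P (\<rho> t x))" "continuous_on {0..l} (\<lambda>x. P (\<rho>' t x))"
    "continuous_on {0..l} (\<lambda>x. P\<^sub>1 (\<rho> t x))" "continuous_on {0..l} (\<lambda>x. P\<^sub>1 (\<rho>' t x))"
proof -
  show c: "continuous_on {0..l} (\<rho> t)" "continuous_on {0..l} (v t)"
    "continuous_on {0..l} (\<rho>' t)" "continuous_on {0..l} (v' t)"
    using lip_x[OF t] lipschitz_on_continuous_on by blast+
  have "continuous_on {a..b} P"
    using DERIV_isCont[OF P_deriv(1)] by (auto intro!: continuous_at_imp_continuous_on)
  then show "continuous_on {0..l} (\<lambda>x. P (\<rho> t x))" "continuous_on {0..l} (\<lambda>x. P (\<rho>' t x))"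
    "continuous_on {0..l} (\<lambda>x. P\<^sub>1 (\<rho> t x))" "continuous_on {0..l} (\<lambda>x. P\<^sub>1 (\<rho>' t x))"
    using bounds(1,2)[OF t]
    by (blast intro: continuous_on_compose2[OF _ c(1)] continuous_on_compose2[OF _ c(3)] P_cont)+
qed

lemma cont_error:
  assumes t: "t \<in> {0..T}"
  shows "continuous_on {0..l} (R t)" "continuous_on {0..l} (V t)" "continuous_on {0..l} (E t)"
    "continuous_on {0..l} (\<Phi> t)" "continuous_on {0..l} (\<Psi> t)" "continuous_on {0..l} (dis e t)"
proof -
  show R: "continuous_on {0..l} (R t)" and V: "continuous_on {0..l} (V t)"
    unfolding R_def V_def by (intro continuous_intros cont t)+
  show "continuous_on {0..l} (E t)"
    unfolding E_def by (intro continuous_intros cont t R V) auto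
  show \<Phi>: "continuous_on {0..l} (\<Phi> t)" and \<Psi>: "continuous_on {0..l} (\<Psi> t)"
    unfolding \<Phi>_def \<Psi>_def
    by (intro indefinite_integral_continuous_1 integrable_continuous_real R source t)+
  show "continuous_on {0..l} (dis e t)"
    unfolding dis_def dissipation_def S_def A_def F_def
    by (intro continuous_intros cont t R V \<Phi> \<Psi> source) auto
qed

text \<open>Uniformity in x serves twice: it dominates the difference quotients under the integral
  and makes the functional Lipschitz in time.\<close>

lemma unif_lip_density: "unif_lip {0..T} {0..l} (\<lambda>t x. E t x + e * (V t x * \<Phi> t x))"
proof -
  have R: "unif_lip {0..T} {0..l} R" and V: "unif_lip {0..T} {0..l} V"
    unfolding R_def[abs_def] V_def[abs_def] by (intro unif_lip_diff unif_lip_time)+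
  have PP: "unif_lip {0..T} {0..l} (\<lambda>t x. P (\<rho> t x))" "unif_lip {0..T} {0..l} (\<lambda>t x. P (\<rho>' t x))"
    "unif_lip {0..T} {0..l} (\<lambda>t x. P\<^sub>1 (\<rho> t x))"
    by (rule unif_lip_compose[OF P_deriv(1) P_cont(1) unif_lip_time(1)]
        unif_lip_compose[OF P_deriv(1) P_cont(1) unif_lip_time(3)]
        unif_lip_compose[OF P_deriv(2) P_cont(2) unif_lip_time(1)], assumption, rule bounds, assumption+)+
  have \<Phi>: "unif_lip {0..T} {0..l} \<Phi>"
    unfolding \<Phi>_def[abs_def] using cont_error(1) by (intro unif_lip_integral R)
  have c: "unif_lip {0..T} {0..l} (\<lambda>x t. u x t / 2)" if "unif_lip {0..T} {0..l} u" for u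
    using unif_lip_mult[OF that unif_lip_const[of _ _ "1/2"]] by simp
  show ?thesis
    unfolding E_def
    by (intro unif_lip_add unif_lip_diff c unif_lip_mult unif_lip_power2 unif_lip_const R V \<Phi> PP unif_lip_time)
qed

lemma energy_integrable:
  "t \<in> {0..T} \<Longrightarrow> (\<lambda>x. E t x + e * (V t x * \<Phi> t x)) integrable_on {0..l}"
  by (intro integrable_continuous_real continuous_intros cont_error)

lemma energy_lipschitz:
  "\<exists>K. \<forall>s\<in>{0..T}. \<forall>t\<in>{0..T}. \<bar>energy e s - energy e t\<bar> \<le> K * \<bar>s - t\<bar>"
proof -
  obtain K where K: "\<And>x s t. x \<in> {0..l} \<Longrightarrow> s \<in> {0..T} \<Longrightarrow> t \<in> {0..T} \<Longrightarrow>
      \<bar>(E s x + e * (V s x * \<Phi> s x)) - (E t x + e * (V t x * \<Phi> t x))\<bar> \<le> K * \<bar>s - t\<bar>"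
    using unif_lip_density[of e] by (rule unif_lipE) blast
  show ?thesis
  proof (intro exI ballI)
    fix s t assume st: "s \<in> {0..T}" "t \<in> {0..T}"
    have "norm (energy e s - energy e t) = norm (integral {0..l}
        (\<lambda>x. (E s x + e * (V s x * \<Phi> s x)) - (E t x + e * (V t x * \<Phi> t x))))"
      unfolding energy_def using energy_integrable st by (subst integral_diff) auto
    also have "\<dots> \<le> integral {0..l} (\<lambda>x. K * \<bar>s - t\<bar>)"
      using st K by (intro integral_norm_bound_integral integrable_diff energy_integrable) auto
    also have "\<dots> = l * K * \<bar>s - t\<bar>" using l by simp
    finally show "\<bar>energy e s - energy e t\<bar> \<le> l * K * \<bar>s - t\<bar>" by simp
  qed
qed

text \<open>All that the energy computation takes from the differential equations at one point.
  Subtracting the two systems leaves equations for the errors; of the separate time derivatives only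
  those of the observed solution are kept, with their bound.\<close>

definition "good_point t x \<longleftrightarrow> (
    \<exists>\<rho>\<^sub>t v\<^sub>t m\<^sub>x h\<^sub>x. ((\<lambda>s. \<rho> s x) has_real_derivative \<rho>\<^sub>t) (at t) \<and> ((\<lambda>s. v s x) has_real_derivative v\<^sub>t) (at t) \<and>
      \<bar>\<rho>\<^sub>t\<bar> \<le> d \<and> \<bar>v\<^sub>t\<bar> \<le> d \<and>
      (M t has_real_derivative m\<^sub>x) (at x) \<and> (H t has_real_derivative h\<^sub>x) (at x) \<and>
      ((\<lambda>s. R s x) has_real_derivative L\<^sub>\<rho> t x - m\<^sub>x) (at t) \<and>
      ((\<lambda>s. V s x) has_real_derivative L\<^sub>v t x - \<gamma> * F t x - h\<^sub>x) (at t))"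

text \<open>The equations hold almost everywhere in the plane, whereas the functional is
  differentiated at a fixed time; Fubini gives slices of full measure for almost every t.\<close>

lemma good_points:
  obtains N where "negligible N"
    "\<And>t. t \<in> {0<..<T} - N \<Longrightarrow> \<exists>N'. negligible N' \<and> (\<forall>x\<in>{0<..<l} - N'. good_point t x)"
proof -
  have *: "AE t in lborel. AE x in lborel. Q t x" if "AE (t, x) in lborel. Q t x" for Q :: "real \<Rightarrow> real \<Rightarrow> bool"
  proof -
    have "AE z in lborel \<Otimes>\<^sub>M lborel. Q (fst z) (snd z)"
      using that unfolding lborel_prod split_def .
    from lborel_pair.AE_pair[OF this] show ?thesis by simp
  qed
  obtain N1 where N1: "negligible N1" "\<And>t. t \<notin> N1 \<Longrightarrow> AE x in lborel. t \<in> {0<..<T} \<and> x \<in> {0<..<l} \<longrightarrow>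
       (\<exists>\<rho>\<^sub>t m\<^sub>x v\<^sub>t h\<^sub>x.
          ((\<lambda>s. \<rho> s x) has_real_derivative \<rho>\<^sub>t) (at t) \<and>
          ((\<lambda>y. \<rho> t y * v t y) has_real_derivative m\<^sub>x) (at x) \<and>
          ((\<lambda>s. v s x) has_real_derivative v\<^sub>t) (at t) \<and>
          ((\<lambda>y. (v t y)\<^sup>2 / 2 + P\<^sub>1 (\<rho> t y)) has_real_derivative h\<^sub>x) (at x) \<and>
          \<rho>\<^sub>t + m\<^sub>x = 0 \<and> v\<^sub>t + h\<^sub>x = - \<gamma> * \<bar>v t x\<bar> * v t x)"
    using AE_lborel_negligible[OF *[OF solution]] by blast
  obtain N2 where N2: "negligible N2" "\<And>t. t \<notin> N2 \<Longrightarrow> AE x in lborel. t \<in> {0<..<T} \<and> x \<in> {0<..<l} \<longrightarrow>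
       (\<exists>\<rho>\<^sub>t m\<^sub>x v\<^sub>t h\<^sub>x.
          ((\<lambda>s. \<rho>' s x) has_real_derivative \<rho>\<^sub>t) (at t) \<and>
          ((\<lambda>y. \<rho>' t y * v' t y) has_real_derivative m\<^sub>x) (at x) \<and>
          ((\<lambda>s. v' s x) has_real_derivative v\<^sub>t) (at t) \<and>
          ((\<lambda>y. (v' t y)\<^sup>2 / 2 + P\<^sub>1 (\<rho>' t y)) has_real_derivative h\<^sub>x) (at x) \<and>
          \<rho>\<^sub>t + m\<^sub>x = L\<^sub>\<rho> t x \<and> v\<^sub>t + h\<^sub>x = - \<gamma> * \<bar>v' t x\<bar> * v' t x + L\<^sub>v t x)"
    using AE_lborel_negligible[OF *[OF observer]] by blast
  show thesis
  proof (rule that[of "N1 \<union> N2"])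
    show "negligible (N1 \<union> N2)" using N1 N2 by simp
    fix t assume t: "t \<in> {0<..<T} - (N1 \<union> N2)"
    from t have t1: "t \<notin> N1" "t \<notin> N2" by auto
    obtain N3 where N3: "negligible N3" "\<And>x. x \<notin> N3 \<Longrightarrow> t \<in> {0<..<T} \<and> x \<in> {0<..<l} \<longrightarrow>
       (\<exists>\<rho>\<^sub>t m\<^sub>x v\<^sub>t h\<^sub>x.
          ((\<lambda>s. \<rho> s x) has_real_derivative \<rho>\<^sub>t) (at t) \<and>
          ((\<lambda>y. \<rho> t y * v t y) has_real_derivative m\<^sub>x) (at x) \<and>
          ((\<lambda>s. v s x) has_real_derivative v\<^sub>t) (at t) \<and>
          ((\<lambda>y. (v t y)\<^sup>2 / 2 + P\<^sub>1 (\<rho> t y)) has_real_derivative h\<^sub>x) (at x) \<and>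
          \<rho>\<^sub>t + m\<^sub>x = 0 \<and> v\<^sub>t + h\<^sub>x = - \<gamma> * \<bar>v t x\<bar> * v t x)"
      using AE_lborel_negligible[OF N1(2)[OF t1(1)]] by blast
    obtain N4 where N4: "negligible N4" "\<And>x. x \<notin> N4 \<Longrightarrow> t \<in> {0<..<T} \<and> x \<in> {0<..<l} \<longrightarrow>
       (\<exists>\<rho>\<^sub>t m\<^sub>x v\<^sub>t h\<^sub>x.
          ((\<lambda>s. \<rho>' s x) has_real_derivative \<rho>\<^sub>t) (at t) \<and>
          ((\<lambda>y. \<rho>' t y * v' t y) has_real_derivative m\<^sub>x) (at x) \<and>
          ((\<lambda>s. v' s x) has_real_derivative v\<^sub>t) (at t) \<and>
          ((\<lambda>y. (v' t y)\<^sup>2 / 2 + P\<^sub>1 (\<rho>' t y)) has_real_derivative h\<^sub>x) (at x) \<and>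
          \<rho>\<^sub>t + m\<^sub>x = L\<^sub>\<rho> t x \<and> v\<^sub>t + h\<^sub>x = - \<gamma> * \<bar>v' t x\<bar> * v' t x + L\<^sub>v t x)"
      using AE_lborel_negligible[OF N2(2)[OF t1(2)]] by blast
    show "\<exists>N'. negligible N' \<and> (\<forall>x\<in>{0<..<l} - N'. good_point t x)"
    proof (intro exI[of _ "N3 \<union> N4"] conjI ballI)
      show "negligible (N3 \<union> N4)" using N3 N4 by simp
      fix x assume x: "x \<in> {0<..<l} - (N3 \<union> N4)"
      then have xl: "x \<in> {0..l}" by auto
      have tx: "t \<in> {0<..<T} \<and> x \<in> {0<..<l}" using t x by auto
      obtain rt mx vt hx where s: "((\<lambda>s. \<rho> s x) has_real_derivative rt) (at t)"
          "((\<lambda>y. \<rho> t y * v t y) has_real_derivative mx) (at x)"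
          "((\<lambda>s. v s x) has_real_derivative vt) (at t)"
          "((\<lambda>y. (v t y)\<^sup>2 / 2 + P\<^sub>1 (\<rho> t y)) has_real_derivative hx) (at x)"
          "rt + mx = 0" "vt + hx = - \<gamma> * \<bar>v t x\<bar> * v t x"
        using N3(2)[of x] x tx by blast
      obtain rt' mx' vt' hx' where s': "((\<lambda>s. \<rho>' s x) has_real_derivative rt') (at t)"
          "((\<lambda>y. \<rho>' t y * v' t y) has_real_derivative mx') (at x)"
          "((\<lambda>s. v' s x) has_real_derivative vt') (at t)"
          "((\<lambda>y. (v' t y)\<^sup>2 / 2 + P\<^sub>1 (\<rho>' t y)) has_real_derivative hx') (at x)"
          "rt' + mx' = L\<^sub>\<rho> t x" "vt' + hx' = - \<gamma> * \<bar>v' t x\<bar> * v' t x + L\<^sub>v t x"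
        using N4(2)[of x] x tx by blast
      \<comment> \<open>This is where the Lipschitz constants in time become bounds for \<rho>_t and
        v_t.\<close>
      have bd: "\<bar>D\<bar> \<le> d" if D: "((\<lambda>s. u s x) has_real_derivative D) (at t)"
        and lip: "d-lipschitz_on {0..T} (\<lambda>t. u t x)" for u :: "real \<Rightarrow> real \<Rightarrow> real" and D
        by (rule lipschitz_derivative_bound[OF D, of 0 T])
          (use tx lipschitz_onD[OF lip, of _ t] in \<open>auto simp: dist_real_def\<close>)
      show "good_point t x"
        unfolding good_point_def
      proof (intro exI conjI)
        show "\<bar>rt\<bar> \<le> d" "\<bar>vt\<bar> \<le> d"
          by (rule bd[where u=\<rho>, OF s(1) lip_t(1)[OF xl]]) (rule bd[where u=v, OF s(3) lip_t(2)[OF xl]])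
        show "(M t has_real_derivative mx' - mx) (at x)"
          unfolding M_eq[abs_def] by (intro DERIV_diff s s')
        show "(H t has_real_derivative hx' - hx) (at x)"
          unfolding H_eq[abs_def] by (intro DERIV_diff s s')
        have "L\<^sub>\<rho> t x - (mx' - mx) = rt' - rt" using s(5) s'(5) by simp
        then show "((\<lambda>s. R s x) has_real_derivative L\<^sub>\<rho> t x - (mx' - mx)) (at t)"
          unfolding R_def using DERIV_diff[OF s'(1) s(1)] by simp
        have "L\<^sub>v t x - \<gamma> * F t x - (hx' - hx) = vt' - vt"
          using s(6) s'(6) by (simp add: F_def algebra_simps)
        then show "((\<lambda>s. V s x) has_real_derivative L\<^sub>v t x - \<gamma> * F t x - (hx' - hx)) (at t)"
          unfolding V_def using DERIV_diff[OF s'(3) s(3)] by simp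
      qed (fact s)+
    qed
  qed
qed

text \<open>With \<rho>' = \<rho> + R and v' = v + V the change in time splits into that of the
  errors, paired with H and M, and that of the observed solution, paired with the Taylor remainders
  of enthalpy and mass flow: \<open>(V t x)\<^sup>2 / 2 + (A t x - P\<^sub>2 (\<rho> t x) * R t
  x)\<close> and \<open>R t x * V t x\<close>.\<close>

lemma energy_density_derivative:
  assumes t: "t \<in> {0..T}" and x: "x \<in> {0..l}"
    and D: "((\<lambda>s. \<rho> s x) has_real_derivative \<rho>\<^sub>t) (at t)" "((\<lambda>s. v s x) has_real_derivative v\<^sub>t) (at t)"
      "((\<lambda>s. R s x) has_real_derivative R\<^sub>t) (at t)" "((\<lambda>s. V s x) has_real_derivative V\<^sub>t) (at t)"
  shows "((\<lambda>s. E s x) has_real_derivative H t x * R\<^sub>t + M t x * V\<^sub>t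
    + (\<rho>\<^sub>t * ((V t x)\<^sup>2 / 2 + (A t x - P\<^sub>2 (\<rho> t x) * R t x)) + v\<^sub>t * (R t x * V t x))) (at t)"
proof -
  have 1: "((\<lambda>s. \<rho>' s x) has_real_derivative \<rho>\<^sub>t + R\<^sub>t) (at t)"
    using DERIV_add[OF D(1) D(3)] by (simp add: R_def)
  note p = pos[OF t x]
  have 2: "((\<lambda>s. P (\<rho>' s x)) has_real_derivative P\<^sub>1 (\<rho>' t x) * (\<rho>\<^sub>t + R\<^sub>t)) (at t)"
    "((\<lambda>s. P (\<rho> s x)) has_real_derivative P\<^sub>1 (\<rho> t x) * \<rho>\<^sub>t) (at t)"
    "((\<lambda>s. P\<^sub>1 (\<rho> s x)) has_real_derivative P\<^sub>2 (\<rho> t x) * \<rho>\<^sub>t) (at t)"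
    using DERIV_chain2[OF P(1) 1] DERIV_chain2[OF P(1) D(1)] DERIV_chain2[OF P(2) D(1)] p by auto
  have v': "v' t x = v t x + V t x" by (simp add: V_def)
  have V2: "((\<lambda>s. (V s x)\<^sup>2) has_real_derivative V\<^sub>t * V t x + V\<^sub>t * V t x) (at t)"
    unfolding power2_eq_square by (rule DERIV_mult[OF D(4) D(4)])
  have "((\<lambda>s. E s x) has_real_derivative
      ((\<rho>\<^sub>t + R\<^sub>t) * (V t x)\<^sup>2 + (V\<^sub>t * V t x + V\<^sub>t * V t x) * \<rho>' t x) / 2
      + ((v\<^sub>t * R t x + R\<^sub>t * v t x) * V t x + V\<^sub>t * (v t x * R t x))
      + (P\<^sub>1 (\<rho>' t x) * (\<rho>\<^sub>t + R\<^sub>t) - P\<^sub>1 (\<rho> t x) * \<rho>\<^sub>t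
        - (P\<^sub>2 (\<rho> t x) * \<rho>\<^sub>t * R t x + R\<^sub>t * P\<^sub>1 (\<rho> t x)))) (at t)"
    unfolding E_def by (intro DERIV_add DERIV_diff DERIV_mult DERIV_cdivide 1 2 D V2)
  then show ?thesis
    by (rule DERIV_cong)
      (simp add: H_def M_def A_def S_def v' power2_eq_square field_simps)
qed

text \<open>The only term that is not visibly quadratic is the Taylor remainder of
  \<open>P\<^sub>1\<close>. It is bounded by two mean value inequalities on the segment between the
  densities, for \<open>P\<^sub>2\<close> and then for
  \<open>P\<^sub>1 y - P\<^sub>2 (\<rho> t x) * y\<close>.\<close>

lemma remainder_bound:
  assumes t: "t \<in> {0..T}" and x: "x \<in> {0..l}" and "\<bar>\<rho>\<^sub>t\<bar> \<le> d" "\<bar>v\<^sub>t\<bar> \<le> d"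
  shows "\<rho>\<^sub>t * ((V t x)\<^sup>2 / 2 + (A t x - P\<^sub>2 (\<rho> t x) * R t x)) + v\<^sub>t * (R t x * V t x)
    \<le> d * (1 + K\<^sub>3) * ((R t x)\<^sup>2 + (V t x)\<^sup>2)"
proof -
  have K3: "0 \<le> K\<^sub>3"
    using P3[of a] a by (auto intro: order_trans[OF abs_ge_zero])
  have seg: "y \<in> {a..b}" if "y \<in> closed_segment (\<rho> t x) (\<rho>' t x)" for y
    using that bounds(1,2)[OF t x] by (auto simp: closed_segment_eq_real_ivl split: if_splits)
  have A: "\<bar>A t x - P\<^sub>2 (\<rho> t x) * R t x\<bar> \<le> K\<^sub>3 * (R t x)\<^sup>2"
  proof -
    let ?I = "closed_segment (\<rho> t x) (\<rho>' t x)"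
    have P2: "\<bar>P\<^sub>2 y - P\<^sub>2 (\<rho> t x)\<bar> \<le> K\<^sub>3 * \<bar>R t x\<bar>" if y: "y \<in> ?I" for y
    proof -
      have "norm (P\<^sub>2 y - P\<^sub>2 (\<rho> t x)) \<le> K\<^sub>3 * norm (y - \<rho> t x)"
        by (rule field_differentiable_bound[of ?I P\<^sub>2 P\<^sub>3])
          (use y seg a P3 in \<open>auto intro!: has_field_derivative_at_within P(3) dest!: seg\<close>)
      also have "\<dots> \<le> K\<^sub>3 * \<bar>R t x\<bar>"
        using y K3 by (intro mult_left_mono) (auto simp: R_def closed_segment_eq_real_ivl split: if_splits)
      finally show ?thesis by simp
    qed
    have "norm ((P\<^sub>1 (\<rho>' t x) - P\<^sub>2 (\<rho> t x) * \<rho>' t x) - (P\<^sub>1 (\<rho> t x) - P\<^sub>2 (\<rho> t x) * \<rho> t x))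
        \<le> K\<^sub>3 * \<bar>R t x\<bar> * norm (\<rho>' t x - \<rho> t x)"
    proof (rule field_differentiable_bound[of ?I "\<lambda>y. P\<^sub>1 y - P\<^sub>2 (\<rho> t x) * y" "\<lambda>y. P\<^sub>2 y - P\<^sub>2 (\<rho> t x)"])
      fix y assume y: "y \<in> ?I"
      then have "0 < y" using seg[OF y] a by auto
      then show "((\<lambda>y. P\<^sub>1 y - P\<^sub>2 (\<rho> t x) * y) has_real_derivative P\<^sub>2 y - P\<^sub>2 (\<rho> t x)) (at y within ?I)"
        by (auto intro!: derivative_eq_intros has_field_derivative_at_within[OF P(2)])
    qed (use P2 in auto)
    then show ?thesis
      by (simp add: A_def R_def power2_eq_square algebra_simps)
  qed
  have s: "0 \<le> (R t x)\<^sup>2" "0 \<le> (V t x)\<^sup>2" by simp_all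
  have "\<rho>\<^sub>t * ((V t x)\<^sup>2 / 2 + (A t x - P\<^sub>2 (\<rho> t x) * R t x)) \<le> d * ((V t x)\<^sup>2 / 2 + K\<^sub>3 * (R t x)\<^sup>2)"
  proof (rule order_trans[OF abs_ge_self], unfold abs_mult, rule mult_mono)
    show "\<bar>(V t x)\<^sup>2 / 2 + (A t x - P\<^sub>2 (\<rho> t x) * R t x)\<bar> \<le> (V t x)\<^sup>2 / 2 + K\<^sub>3 * (R t x)\<^sup>2"
      by (rule order_trans[OF abs_triangle_ineq]) (use A in simp)
  qed (use assms d in auto)
  moreover have "v\<^sub>t * (R t x * V t x) \<le> d * (((R t x)\<^sup>2 + (V t x)\<^sup>2) / 2)"
    by (rule order_trans[OF abs_ge_self], unfold abs_mult, rule mult_mono)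
      (use assms d abs_mult_le_squares[of "R t x" "V t x"] in auto)
  ultimately have "\<rho>\<^sub>t * ((V t x)\<^sup>2 / 2 + (A t x - P\<^sub>2 (\<rho> t x) * R t x)) + v\<^sub>t * (R t x * V t x)
    \<le> d * ((V t x)\<^sup>2 + (R t x)\<^sup>2 / 2 + K\<^sub>3 * (R t x)\<^sup>2)"
    by (simp add: algebra_simps)
  also have "\<dots> \<le> d * ((1 + K\<^sub>3) * ((R t x)\<^sup>2 + (V t x)\<^sup>2))"
    using d K3 s by (intro mult_left_mono) (auto simp: algebra_simps)
  finally show ?thesis by (simp add: mult.assoc)
qed

text \<open>For fixed t the fluxes are gathered in \<open>Z\<close>, a Lipschitz function of x that
  vanishes at both ends, so its derivative integrates to zero. The remainder is replaced by its
  continuous bound pointwise, before integrating, hence an inequality.\<close>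

lemma energy_derivative:
  obtains N where "negligible N" "\<And>t. t \<in> {0<..<T} - N \<Longrightarrow> \<exists>D. (energy e has_real_derivative D) (at t) \<and>
    D \<le> integral {0..l} (\<lambda>x. dis e t x + d * (1 + K\<^sub>3) * ((R t x)\<^sup>2 + (V t x)\<^sup>2))"
proof -
  obtain N where N: "negligible N" and good: "\<And>t. t \<in> {0<..<T} - N \<Longrightarrow>
      \<exists>N'. negligible N' \<and> (\<forall>x\<in>{0<..<l} - N'. good_point t x)"
    using good_points by blast
  show thesis
  proof (rule that[OF N])
    fix t assume tN: "t \<in> {0<..<T} - N"
    then have t: "t \<in> {0..T}" by auto
    obtain N' where N': "negligible N'" and goodx: "\<And>x. x \<in> {0<..<l} - N' \<Longrightarrow> good_point t x"
      using good[OF tN] by blast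
    define \<epsilon> where "\<epsilon> = min t (T - t)"
    have \<epsilon>: "0 < \<epsilon>" using tN by (auto simp: \<epsilon>_def)
    have near: "s \<in> {0..T}" if "\<bar>s - t\<bar> < \<epsilon>" for s
      using that by (auto simp: \<epsilon>_def)
    have M0: "M t 0 = 0" and Hl: "H t l = 0" and \<Phi>0: "\<Phi> t 0 = 0"
      using boundary[OF t] by (auto simp: M_eq H_eq \<Phi>_def)
    define m where "m y = deriv (M t) y" for y
    have m: "(M t has_real_derivative m y) (at y)" "((\<lambda>s. R s y) has_real_derivative L\<^sub>\<rho> t y - m y) (at t)"
      if "y \<in> {0<..<l} - N'" for y
      using goodx[OF that] by (auto simp: m_def good_point_def dest: DERIV_imp_deriv)
    \<comment> \<open>Integration of R_t = L_\<rho> - M_x over {0..x}; the boundary condition M(t,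
      0) = 0 removes the constant.\<close>
    have \<Phi>t: "((\<lambda>s. \<Phi> s x) has_real_derivative \<Psi> t x - M t x) (at t)" if x: "x \<in> {0..l}" for x
    proof -
      have R: "unif_lip {0..T} {0..l} R"
        unfolding R_def[abs_def] by (intro unif_lip_diff unif_lip_time)
      obtain K where K: "\<And>x s t. x \<in> {0..l} \<Longrightarrow> s \<in> {0..T} \<Longrightarrow> t \<in> {0..T} \<Longrightarrow> \<bar>R s x - R t x\<bar> \<le> K * \<bar>s - t\<bar>"
        using R by (rule unif_lipE) blast
      have N0: "negligible (N' \<union> {0, x})" using N' by simp
      have "((\<lambda>s. integral {0..x} (R s)) has_real_derivative integral {0..x} (\<lambda>y. L\<^sub>\<rho> t y - m y)) (at t)"
      proof (rule has_real_derivative_integral(2)[OF \<epsilon> _ _ _ N0, where K=K])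
        show "R s integrable_on {0..x}" if "\<bar>s - t\<bar> < \<epsilon>" for s
          using near[OF that] x
          by (intro integrable_continuous_real continuous_on_subset[OF cont_error(1)]) auto
        show "\<bar>R s y - R t y\<bar> \<le> K * \<bar>s - t\<bar>" if "\<bar>s - t\<bar> < \<epsilon>" "y \<in> {0..x}" for s y
          using near[OF that(1)] x that t by (intro K) auto
        show "((\<lambda>s. R s y) has_real_derivative L\<^sub>\<rho> t y - m y) (at t)" if "y \<in> {0..x} - (N' \<union> {0, x})" for y
          using that x by (intro m(2)) auto
      qed (rule integrable_const_ivl)
      moreover have "(m has_integral M t x - M t 0) {0..x}"
      proof -
        obtain K where K: "\<And>s x y. s \<in> {t} \<Longrightarrow> x \<in> {0..l} \<Longrightarrow> y \<in> {0..l} \<Longrightarrow> \<bar>M s x - M s y\<bar> \<le> K * \<bar>x - y\<bar>"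
          using unif_lip_space_MH(1)[OF t] by (rule unif_lipE) blast
        show ?thesis
          by (rule lipschitz_FTC[OF _ _ N', where K=K]) (use x K m(1) in auto)
      qed
      moreover have "(L\<^sub>\<rho> t has_integral \<Psi> t x) {0..x}"
        unfolding \<Psi>_def using x
        by (intro integrable_integral integrable_continuous_real continuous_on_subset[OF source(1)[OF t]]) auto
      ultimately show ?thesis
        unfolding \<Phi>_def using has_integral_diff[of "L\<^sub>\<rho> t" "\<Psi> t x" "{0..x}" m "M t x - M t 0"] M0
        by (simp add: integral_unique)
    qed
    define f where "f s x = E s x + e * (V s x * \<Phi> s x)" for s x
    \<comment> \<open>\<open>M t x * H t x\<close> is the flux of the energy and
      \<open>H t x * \<Phi> t x\<close> that of V \<Phi>. At 0 the factors M and \<Phi> vanish, at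
      \<open>l\<close> the factor H.\<close>
    define Z where "Z x = M t x * H t x + e * (H t x * \<Phi> t x)" for x
    have key: "(\<lambda>s. f s x) field_differentiable (at t) \<and> (Z has_real_derivative deriv Z x) (at x) \<and>
        deriv (\<lambda>s. f s x) t + deriv Z x \<le> dis e t x + d * (1 + K\<^sub>3) * ((R t x)\<^sup>2 + (V t x)\<^sup>2)"
      if x: "x \<in> {0<..<l} - N'" for x
    proof -
      from x have xl: "x \<in> {0..l}" by auto
      obtain rt vt mx hx where g: "((\<lambda>s. \<rho> s x) has_real_derivative rt) (at t)" "((\<lambda>s. v s x) has_real_derivative vt) (at t)"
        and b: "\<bar>rt\<bar> \<le> d" "\<bar>vt\<bar> \<le> d"
        and MH: "(M t has_real_derivative mx) (at x)" "(H t has_real_derivative hx) (at x)"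
        and RV: "((\<lambda>s. R s x) has_real_derivative L\<^sub>\<rho> t x - mx) (at t)"
          "((\<lambda>s. V s x) has_real_derivative L\<^sub>v t x - \<gamma> * F t x - hx) (at t)"
        using goodx[OF x] unfolding good_point_def by blast
      define q where "q = rt * ((V t x)\<^sup>2 / 2 + (A t x - P\<^sub>2 (\<rho> t x) * R t x)) + vt * (R t x * V t x)"
      have q: "q \<le> d * (1 + K\<^sub>3) * ((R t x)\<^sup>2 + (V t x)\<^sup>2)"
        unfolding q_def by (rule remainder_bound[OF t xl b])
      have f: "((\<lambda>s. f s x) has_real_derivative
          (H t x * (L\<^sub>\<rho> t x - mx) + M t x * (L\<^sub>v t x - \<gamma> * F t x - hx) + q)
          + e * ((L\<^sub>v t x - \<gamma> * F t x - hx) * \<Phi> t x + (\<Psi> t x - M t x) * V t x)) (at t)"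
        unfolding f_def q_def
        by (intro DERIV_add DERIV_cmult DERIV_mult energy_density_derivative t xl g RV \<Phi>t)
      have "(\<Phi> t has_real_derivative R t x) (at x within {0..l})"
        unfolding \<Phi>_def by (rule integral_has_real_derivative[OF cont_error(1)[OF t] xl])
      then have \<Phi>x: "(\<Phi> t has_real_derivative R t x) (at x)"
        using x by (simp add: at_within_Icc_at)
      have Z: "(Z has_real_derivative (mx * H t x + hx * M t x) + e * (hx * \<Phi> t x + R t x * H t x)) (at x)"
        unfolding Z_def by (intro DERIV_add DERIV_cmult DERIV_mult MH \<Phi>x)
      \<comment> \<open>All terms with \<open>mx\<close> and \<open>hx\<close> cancel against the
        derivative of the flux. What the flux leaves behind is H times the x-derivative R of \<Phi>,
        the term H R in \<open>dissipation\<close>.\<close>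
      have "deriv (\<lambda>s. f s x) t + deriv Z x = dis e t x + q"
        unfolding DERIV_imp_deriv[OF f] DERIV_imp_deriv[OF Z]
        by (simp add: dis_def dissipation_def algebra_simps flip: M_def H_def)
      then show ?thesis
        using q f Z DERIV_imp_deriv[OF Z] field_differentiable_def by fastforce
    qed
    have N0: "negligible (N' \<union> {0, l})" using N' by simp
    obtain K where K: "\<And>x s t. x \<in> {0..l} \<Longrightarrow> s \<in> {0..T} \<Longrightarrow> t \<in> {0..T} \<Longrightarrow> \<bar>f s x - f t x\<bar> \<le> K * \<bar>s - t\<bar>"
      using unif_lip_density[of e] unfolding f_def by (rule unif_lipE) blast
    have fi: "f s integrable_on {0..l}" if "\<bar>s - t\<bar> < \<epsilon>" for s
      unfolding f_def by (rule energy_integrable[OF near[OF that]])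
    have fl: "\<bar>f s x - f t x\<bar> \<le> K * \<bar>s - t\<bar>" if "\<bar>s - t\<bar> < \<epsilon>" "x \<in> {0..l}" for s x
      using K[OF that(2) near[OF that(1)] t] .
    have fd: "((\<lambda>s. f s x) has_real_derivative deriv (\<lambda>s. f s x) t) (at t)" if "x \<in> {0..l} - (N' \<union> {0, l})" for x
      using key[of x] that by (auto simp: DERIV_deriv_iff_field_differentiable)
    note D = has_real_derivative_integral[OF \<epsilon> fi integrable_const_ivl fl N0 fd, simplified]
    have Zi: "(deriv Z has_integral Z l - Z 0) {0..l}"
    proof -
      have \<Phi>x: "unif_lip {0..l} {t} (\<lambda>x t. \<Phi> t x)"
      proof -
        obtain B where B: "0 \<le> B" "\<And>x. x \<in> {0..l} \<Longrightarrow> \<bar>R t x\<bar> \<le> B"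
          using unif_lip_diff[OF unif_lip_space(3)[OF t] unif_lip_space(1)[OF t], folded R_def]
          by (rule unif_lipE) blast
        have lip: "\<bar>\<Phi> t x - \<Phi> t y\<bar> \<le> B * \<bar>x - y\<bar>" if "x \<in> {0..l}" "y \<in> {0..l}" for x y
        proof -
          have "norm (\<Phi> t x - \<Phi> t y) \<le> B * norm (x - y)"
            by (rule field_differentiable_bound[of "{0..l}" "\<Phi> t" "R t"])
              (use that B integral_has_real_derivative[OF cont_error(1)[OF t]] in \<open>auto simp: \<Phi>_def[abs_def]\<close>)
          then show ?thesis by simp
        qed
        show ?thesis
        proof (rule unif_lipI[where K=B and B="B * l"])
          fix s x assume "s \<in> {t}" "x \<in> {0..l}"
          then show "\<bar>\<Phi> s x\<bar> \<le> B * l"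
            using lip[of x 0] \<Phi>0 l B(1) mult_left_mono[of x l B] by simp
        qed (use lip in auto)
      qed
      have "unif_lip {0..l} {t} (\<lambda>x t. M t x * H t x + e * (H t x * \<Phi> t x))"
        by (intro unif_lip_add unif_lip_mult unif_lip_const \<Phi>x unif_lip_space_MH t)
      then obtain K where K: "\<And>s x y. s \<in> {t} \<Longrightarrow> x \<in> {0..l} \<Longrightarrow> y \<in> {0..l} \<Longrightarrow>
          \<bar>(M s x * H s x + e * (H s x * \<Phi> s x)) - (M s y * H s y + e * (H s y * \<Phi> s y))\<bar> \<le> K * \<bar>x - y\<bar>"
        by (rule unif_lipE) blast
      have Zl: "\<bar>Z x - Z y\<bar> \<le> K * \<bar>x - y\<bar>" if "x \<in> {0..l}" "y \<in> {0..l}" for x y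
        using K[of t x y] that by (simp add: Z_def)
      show ?thesis
        by (rule lipschitz_FTC[OF _ Zl N']) (use l key in auto)
    qed
    moreover have "Z l - Z 0 = 0" by (simp add: Z_def M0 Hl \<Phi>0)
    ultimately have Z0: "(deriv Z has_integral 0) {0..l}" by simp
    let ?B = "\<lambda>x. dis e t x + d * (1 + K\<^sub>3) * ((R t x)\<^sup>2 + (V t x)\<^sup>2)"
    have B: "?B integrable_on {0..l}"
      by (intro integrable_continuous_real continuous_intros cont_error t)
    have "integral {0..l} (\<lambda>x. deriv (\<lambda>s. f s x) t) \<le> integral {0..l} (\<lambda>x. ?B x - deriv Z x)"
    proof (rule integral_mono_negligible[OF N0 D(1)])
      show "(\<lambda>x. ?B x - deriv Z x) integrable_on {0..l}"
        using B Z0 by (intro integrable_diff) auto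
      show "deriv (\<lambda>s. f s x) t \<le> ?B x - deriv Z x" if "x \<in> {0..l} - (N' \<union> {0, l})" for x
        using key[of x] that by auto
    qed
    also have "\<dots> = integral {0..l} ?B - integral {0..l} (deriv Z)"
      using B Z0 by (intro integral_diff) auto
    also have "integral {0..l} (deriv Z) = 0"
      using Z0 by (rule integral_unique)
    finally have "integral {0..l} (\<lambda>x. deriv (\<lambda>s. f s x) t) \<le> integral {0..l} ?B" by simp
    moreover have "(energy e has_real_derivative integral {0..l} (\<lambda>x. deriv (\<lambda>s. f s x) t)) (at t)"
      using D(2) by (simp add: energy_def[abs_def] f_def[abs_def])
    ultimately show "\<exists>D. (energy e has_real_derivative D) (at t) \<and> D \<le> integral {0..l} ?B"
      by blast
  qed
qed

end

section \<open>Mean value estimates\<close>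

lemma abs_square_diff_le:
  fixes w w' :: real
  assumes "\<bar>w\<bar> \<le> d" "\<bar>w'\<bar> \<le> d"
  shows "\<bar>\<bar>w'\<bar> * w' - \<bar>w\<bar> * w\<bar> \<le> 2 * d * \<bar>w' - w\<bar>"
proof -
  have "\<bar>w'\<bar> * w' - \<bar>w\<bar> * w = \<bar>w'\<bar> * (w' - w) + (\<bar>w'\<bar> - \<bar>w\<bar>) * w"
    by (simp add: algebra_simps)
  also have "\<bar>\<dots>\<bar> \<le> \<bar>w'\<bar> * \<bar>w' - w\<bar> + \<bar>\<bar>w'\<bar> - \<bar>w\<bar>\<bar> * \<bar>w\<bar>"
    by (rule order_trans[OF abs_triangle_ineq]) (simp add: abs_mult)
  also have "\<dots> \<le> d * \<bar>w' - w\<bar> + \<bar>w' - w\<bar> * d"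
    using assms by (intro add_mono mult_mono) auto
  finally show ?thesis by simp
qed

lemma MVT_Icc:
  fixes f f' :: "real \<Rightarrow> real"
  assumes f: "\<And>y. y \<in> {a..b} \<Longrightarrow> (f has_real_derivative f' y) (at y)" and r: "r \<in> {a..b}" "r' \<in> {a..b}"
  obtains \<xi> where "\<xi> \<in> {a..b}" "f r' - f r = f' \<xi> * (r' - r)"
proof (cases r r' rule: linorder_cases)
  case less
  obtain z where "r < z" "z < r'" "f r' - f r = (r' - r) * f' z"
    using MVT2[OF less, of f f'] f r by auto
  then show ?thesis using that[of z] r by (simp add: mult.commute)
next
  case equal
  then show ?thesis using that[of r] r by simp
next
  case greater
  obtain z where "r' < z" "z < r" "f r - f r' = (r - r') * f' z"
    using MVT2[OF greater, of f f'] f r by auto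
  then show ?thesis using that[of z] r by (simp add: algebra_simps)
qed

lemma Taylor2_Icc:
  fixes f f' f'' :: "real \<Rightarrow> real"
  assumes f: "\<And>y. y \<in> {a..b} \<Longrightarrow> (f has_real_derivative f' y) (at y)"
    "\<And>y. y \<in> {a..b} \<Longrightarrow> (f' has_real_derivative f'' y) (at y)" and r: "r \<in> {a..b}" "r' \<in> {a..b}"
  obtains \<xi> where "\<xi> \<in> {a..b}" "f r' - f r - f' r * (r' - r) = f'' \<xi> / 2 * (r' - r)\<^sup>2"
proof (cases "r' = r")
  case False
  define g where "g m = (if m = 0 then f else if m = 1 then f' else f'')" for m :: nat
  have "\<exists>t. (if r' < r then r' < t \<and> t < r else r < t \<and> t < r') \<and>
      f r' = (\<Sum>m<2. g m r / fact m * (r' - r) ^ m) + g 2 t / fact 2 * (r' - r) ^ 2"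
  proof (rule Taylor[of 2 g f a b r r'])
    show "\<forall>m t. m < 2 \<and> a \<le> t \<and> t \<le> b \<longrightarrow> (g m has_real_derivative g (Suc m) t) (at t)"
      using f by (auto simp: g_def)
  qed (use r False in \<open>auto simp: g_def\<close>)
  then obtain t where "if r' < r then r' < t \<and> t < r else r < t \<and> t < r'"
    "f r' = f r + f' r * (r' - r) + f'' t / 2 * (r' - r)\<^sup>2"
    by (auto simp: g_def eval_nat_numeral)
  then show ?thesis
    using that[of t] r by (auto split: if_splits)
qed (use that[of r] r in simp)

section \<open>Equivalence of the functional with the squared L2 norm, and its decay\<close>

context error_system begin

definition "N t = integral {0..l} (\<lambda>x. (R t x)\<^sup>2)"
definition "n t = integral {0..l} (\<lambda>x. (R t x)\<^sup>2 + (V t x)\<^sup>2)"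

lemma square_integrable:
  "t \<in> {0..T} \<Longrightarrow> (\<lambda>x. (R t x)\<^sup>2) integrable_on {0..l}"
  "t \<in> {0..T} \<Longrightarrow> (\<lambda>x. (V t x)\<^sup>2) integrable_on {0..l}"
  by (intro integrable_continuous_real continuous_intros cont_error, assumption)+

lemma n_eq: "t \<in> {0..T} \<Longrightarrow> n t = N t + integral {0..l} (\<lambda>x. (V t x)\<^sup>2)"
  unfolding n_def N_def by (intro integral_add square_integrable)

lemma N_nonneg: "t \<in> {0..T} \<Longrightarrow> 0 \<le> N t"
  and V2_nonneg: "t \<in> {0..T} \<Longrightarrow> 0 \<le> integral {0..l} (\<lambda>x. (V t x)\<^sup>2)"
  unfolding N_def by (intro integral_nonneg square_integrable; simp)+

lemma \<Phi>_bound: "t \<in> {0..T} \<Longrightarrow> x \<in> {0..l} \<Longrightarrow> (\<Phi> t x)\<^sup>2 \<le> l * N t"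
  unfolding \<Phi>_def N_def by (intro square_integral_le cont_error)

lemma \<Psi>_bound:
  assumes t: "t \<in> {0..T}" and x: "x \<in> {0..l}"
    and L: "\<And>x. x \<in> {0..l} \<Longrightarrow> \<bar>L\<^sub>\<rho> t x\<bar> \<le> \<Lambda> * \<bar>R t x\<bar>"
  shows "(\<Psi> t x)\<^sup>2 \<le> l * (\<Lambda>\<^sup>2 * N t)"
proof -
  have "(\<Psi> t x)\<^sup>2 \<le> l * integral {0..l} (\<lambda>y. (L\<^sub>\<rho> t y)\<^sup>2)"
    unfolding \<Psi>_def by (intro square_integral_le source t x)
  also have "\<dots> \<le> l * integral {0..l} (\<lambda>y. \<Lambda>\<^sup>2 * (R t y)\<^sup>2)"
  proof (intro mult_left_mono integral_le integrable_continuous_real continuous_intros source cont_error t)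
    fix y assume "y \<in> {0..l}"
    then have "\<bar>L\<^sub>\<rho> t y\<bar>\<^sup>2 \<le> (\<Lambda> * \<bar>R t y\<bar>)\<^sup>2" by (intro power_mono L) auto
    then show "(L\<^sub>\<rho> t y)\<^sup>2 \<le> \<Lambda>\<^sup>2 * (R t y)\<^sup>2" by (simp add: power_mult_distrib)
  qed (use l in auto)
  finally show ?thesis by (simp add: N_def)
qed

text \<open>\<open>m\<close> is a common lower bound for the density and for P'', so the two squares
  in the relative energy contribute at least \<open>m / 2 * n t\<close>. The mixed term v R V costs
  at most \<open>d / 2\<close>, the term with \<Phi> at most
  \<open>\<bar>e\<bar> * (1 + l\<^sup>2) / 2\<close>, each no more than \<open>m / 8\<close>; this
  leaves \<open>m / 4\<close>. The upper bound is generous.\<close>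

lemma energy_bounds:
  assumes P2: "\<And>y. y \<in> {a..b} \<Longrightarrow> \<kappa> \<le> P\<^sub>2 y" "\<And>y. y \<in> {a..b} \<Longrightarrow> P\<^sub>2 y \<le> K" and \<kappa>: "0 < \<kappa>"
    and m: "m \<le> a" "m \<le> \<kappa>" "d \<le> m / 4" "\<bar>e\<bar> * (1 + l\<^sup>2) \<le> m / 4" and t: "t \<in> {0..T}"
  shows "m / 4 * n t \<le> energy e t" "energy e t \<le> (b + K + m) * n t"
proof -
  have m0: "0 \<le> m" using m d by simp
  have K: "0 \<le> K" using P2[of a] \<kappa> a by auto
  have E: "\<bar>e * (V t x * \<Phi> t x)\<bar> \<le> \<bar>e\<bar> / 2 * ((V t x)\<^sup>2 + l * N t)"
      "(m / 2 - d / 2) * ((R t x)\<^sup>2 + (V t x)\<^sup>2) \<le> E t x"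
      "E t x \<le> (b + K + d) / 2 * ((R t x)\<^sup>2 + (V t x)\<^sup>2)"
    if x: "x \<in> {0..l}" for x
  proof -
    have "\<bar>V t x\<bar> * \<bar>\<Phi> t x\<bar> \<le> ((V t x)\<^sup>2 + (\<Phi> t x)\<^sup>2) / 2" by (rule abs_mult_le_squares)
    also have "\<dots> \<le> ((V t x)\<^sup>2 + l * N t) / 2" using \<Phi>_bound[OF t x] by simp
    finally have "\<bar>e\<bar> * (\<bar>V t x\<bar> * \<bar>\<Phi> t x\<bar>) \<le> \<bar>e\<bar> * (((V t x)\<^sup>2 + l * N t) / 2)"
      by (intro mult_left_mono) auto
    then show "\<bar>e * (V t x * \<Phi> t x)\<bar> \<le> \<bar>e\<bar> / 2 * ((V t x)\<^sup>2 + l * N t)" by (simp add: abs_mult)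
    define W where "W = v t x * R t x * V t x"
    define D where "D = P (\<rho>' t x) - P (\<rho> t x) - P\<^sub>1 (\<rho> t x) * R t x"
    define X where "X = (R t x)\<^sup>2"
    define Y where "Y = (V t x)\<^sup>2"
    have XY: "0 \<le> X" "0 \<le> Y" by (auto simp: X_def Y_def)
    have W: "\<bar>W\<bar> \<le> d * ((X + Y) / 2)"
    proof -
      have "\<bar>W\<bar> = \<bar>v t x\<bar> * (\<bar>R t x\<bar> * \<bar>V t x\<bar>)" by (simp add: W_def abs_mult)
      also have "\<dots> \<le> d * ((X + Y) / 2)"
        unfolding X_def Y_def using bounds(3)[OF t x] d by (intro mult_mono abs_mult_le_squares) auto
      finally show ?thesis .
    qed
    obtain \<xi> where \<xi>: "\<xi> \<in> {a..b}"
      "P (\<rho>' t x) - P (\<rho> t x) - P\<^sub>1 (\<rho> t x) * (\<rho>' t x - \<rho> t x) = P\<^sub>2 \<xi> / 2 * (\<rho>' t x - \<rho> t x)\<^sup>2"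
      using Taylor2_Icc[OF P_deriv bounds(1,2)[OF t x]] by blast
    then have D: "D = P\<^sub>2 \<xi> / 2 * X" by (simp add: D_def X_def R_def)
    have "\<kappa> / 2 * X \<le> D" "D \<le> K / 2 * X"
      unfolding D using P2[OF \<xi>(1)] XY by (intro mult_right_mono; simp)+
    moreover have "m / 2 * X \<le> \<kappa> / 2 * X" using m XY by (intro mult_right_mono) auto
    moreover have "m / 2 * Y \<le> \<rho>' t x * Y / 2" "\<rho>' t x * Y / 2 \<le> b / 2 * Y"
      using m XY bounds(2)[OF t x] mult_right_mono[of m "\<rho>' t x" Y] mult_right_mono[of "\<rho>' t x" b Y] by auto
    moreover have "0 \<le> b / 2 * X" "0 \<le> K / 2 * Y" using XY a K by auto
    moreover have "E t x = \<rho>' t x * Y / 2 + W + D" by (simp add: E_def W_def D_def Y_def)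
    moreover have "(m / 2 - d / 2) * (X + Y) = m / 2 * X + m / 2 * Y - d * ((X + Y) / 2)"
      "(b + K + d) / 2 * (X + Y) = b / 2 * X + b / 2 * Y + (K / 2 * X + K / 2 * Y) + d * ((X + Y) / 2)"
      by (simp_all add: algebra_simps add_divide_distrib)
    ultimately have "(m / 2 - d / 2) * (X + Y) \<le> E t x" "E t x \<le> (b + K + d) / 2 * (X + Y)"
      using W unfolding abs_le_iff by linarith+
    then show "(m / 2 - d / 2) * ((R t x)\<^sup>2 + (V t x)\<^sup>2) \<le> E t x"
      "E t x \<le> (b + K + d) / 2 * ((R t x)\<^sup>2 + (V t x)\<^sup>2)"
      by (simp_all add: X_def Y_def)
  qed
  define I where "I = integral {0..l} (\<lambda>x. (V t x)\<^sup>2)"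
  have I: "0 \<le> I" "n t = N t + I" "0 \<le> N t"
    using V2_nonneg[OF t] N_nonneg[OF t] n_eq[OF t] by (simp_all add: I_def)
  have Vi: "((\<lambda>x. (V t x)\<^sup>2) has_integral I) {0..l}"
    unfolding I_def by (intro integrable_integral square_integrable t)
  have ni: "((\<lambda>x. (R t x)\<^sup>2 + (V t x)\<^sup>2) has_integral n t) {0..l}"
    unfolding n_def by (intro integrable_integral integrable_add square_integrable t)
  have c: "((\<lambda>x. l * N t) has_integral l * (l * N t)) {0..l}"
    using has_integral_const_real[of "l * N t" 0 l] l by simp
  have ci: "((\<lambda>x. C * ((R t x)\<^sup>2 + (V t x)\<^sup>2) + D * ((V t x)\<^sup>2 + l * N t)) has_integral
      C * n t + D * (I + l * (l * N t))) {0..l}" for C D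
    by (intro has_integral_add has_integral_mult_right ni Vi c)
  have en: "((\<lambda>x. E t x + e * (V t x * \<Phi> t x)) has_integral energy e t) {0..l}"
    unfolding energy_def by (intro integrable_integral energy_integrable t)
  have small: "\<bar>e\<bar> / 2 * (I + l * (l * N t)) \<le> m / 8 * n t"
  proof -
    have "I + l * (l * N t) \<le> (1 + l\<^sup>2) * n t"
      using I by (simp add: algebra_simps power2_eq_square)
    then have "\<bar>e\<bar> / 2 * (I + l * (l * N t)) \<le> \<bar>e\<bar> / 2 * ((1 + l\<^sup>2) * n t)"
      by (intro mult_left_mono) auto
    also have "\<dots> = (\<bar>e\<bar> * (1 + l\<^sup>2)) * (n t / 2)" by simp
    also have "\<dots> \<le> m / 4 * (n t / 2)" using m(4) I by (intro mult_right_mono) auto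
    finally show ?thesis by simp
  qed
  have "(m / 2 - d / 2) * n t + (- \<bar>e\<bar> / 2) * (I + l * (l * N t)) \<le> energy e t"
    by (rule has_integral_le[OF ci en]) (use E in \<open>force simp: abs_le_iff\<close>)
  moreover have "d / 2 * n t \<le> m / 8 * n t" using m I by (intro mult_right_mono) auto
  ultimately show "m / 4 * n t \<le> energy e t"
    using small by (simp add: algebra_simps)
  have "energy e t \<le> (b + K + d) / 2 * n t + \<bar>e\<bar> / 2 * (I + l * (l * N t))"
    by (rule has_integral_le[OF en ci]) (use E in \<open>force simp: abs_le_iff\<close>)
  moreover have "(b + K + d) / 2 * n t = (b + K) / 2 * n t + d / 2 * n t"
    "(b + K + m) * n t = (b + K) / 2 * n t + (b + K) / 2 * n t + 8 * (m / 8 * n t)"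
    by (simp_all add: algebra_simps add_divide_distrib)
  moreover have "0 \<le> (b + K) / 2 * n t" "0 \<le> m / 8 * n t"
    using I K a m0 by auto
  ultimately show "energy e t \<le> (b + K + m) * n t"
    using small \<open>d / 2 * n t \<le> m / 8 * n t\<close> by linarith
qed

text \<open>Integrated over the pipe, the damping is at least \<open>c * n t\<close>, and half of it
  absorbs the terms with a factor \<open>d\<close>. With \<open>k = b + K + m\<close> the bound of
  the functional by \<open>k * n t\<close> turns the rest into the rate \<open>c / (2 * k)\<close>;
  the factor \<open>4 * k / m\<close> is the ratio of the two bounds in
  \<open>energy_bounds\<close>. The assumption \<open>dis\<close> speaks of arbitrary numbers and is
  applied to the values of \<open>\<Phi>\<close>, \<open>\<Psi>\<close> and
  \<open>N\<close>.\<close>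

lemma decay:
  assumes P2: "\<And>y. y \<in> {a..b} \<Longrightarrow> \<kappa> \<le> P\<^sub>2 y" "\<And>y. y \<in> {a..b} \<Longrightarrow> P\<^sub>2 y \<le> K" and \<kappa>: "0 < \<kappa>"
    and m: "0 < m" "m \<le> a" "m \<le> \<kappa>" "d \<le> m / 4" "\<bar>e\<bar> * (1 + l\<^sup>2) \<le> m / 4"
    and c: "0 < c" "c \<le> c\<^sub>1" "c \<le> c\<^sub>3" "d * (1 + K\<^sub>3 + C\<^sub>0 * (1 + l)) \<le> c / 2" "0 \<le> C\<^sub>0"
    and L: "\<And>t x. t \<in> {0..T} \<Longrightarrow> x \<in> {0..l} \<Longrightarrow> \<bar>L\<^sub>\<rho> t x\<bar> \<le> \<Lambda> * \<bar>R t x\<bar>"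
    and dis: "\<And>t x \<phi> \<psi> z. \<lbrakk>t \<in> {0..T}; x \<in> {0..l}; \<phi>\<^sup>2 \<le> l * z; \<psi>\<^sup>2 \<le> l * (\<Lambda>\<^sup>2 * z)\<rbrakk> \<Longrightarrow>
      dissipation \<gamma> e (\<rho>' t x) (v t x) (S t x) (A t x) (F t x) (L\<^sub>\<rho> t x) (L\<^sub>v t x) (R t x) (V t x) \<phi> \<psi>
      \<le> d * C\<^sub>0 * ((R t x)\<^sup>2 + (V t x)\<^sup>2 + z) - c\<^sub>1 * (V t x)\<^sup>2 - c\<^sub>3 * (2 * (R t x)\<^sup>2 - z / l)"
    and t: "t \<in> {0..T}"
  shows "n t \<le> 4 * (b + K + m) / m * n 0 * exp (- (c / (2 * (b + K + m))) * t)"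
proof -
  define k where "k = b + K + m"
  have K: "0 < K" using P2[of a] \<kappa> a by auto
  then have k: "0 < k" using a m by (simp add: k_def)
  note eb = energy_bounds[OF P2 \<kappa> m(2-5), folded k_def]
  have I: "integral {0..l} (\<lambda>x. dis e t x + d * (1 + K\<^sub>3) * ((R t x)\<^sup>2 + (V t x)\<^sup>2)) \<le> - (c / 2) * n t"
    if t: "t \<in> {0..T}" for t
  proof -
    define I where "I = integral {0..l} (\<lambda>x. (V t x)\<^sup>2)"
    have I: "0 \<le> I" "n t = N t + I" "0 \<le> N t"
      using V2_nonneg[OF t] N_nonneg[OF t] n_eq[OF t] by (simp_all add: I_def)
    have Vi: "((\<lambda>x. (V t x)\<^sup>2) has_integral I) {0..l}"
      unfolding I_def by (intro integrable_integral square_integrable t)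
    have Ri: "((\<lambda>x. (R t x)\<^sup>2) has_integral N t) {0..l}"
      unfolding N_def by (intro integrable_integral square_integrable t)
    have ci: "((\<lambda>x. y) has_integral l * y) {0..l}" for y
      using has_integral_const_real[of y 0 l] l by simp
    have B: "((\<lambda>x. (d * C\<^sub>0 * ((R t x)\<^sup>2 + (V t x)\<^sup>2 + N t) - c\<^sub>1 * (V t x)\<^sup>2 - c\<^sub>3 * (2 * (R t x)\<^sup>2 - N t / l))
        + d * (1 + K\<^sub>3) * ((R t x)\<^sup>2 + (V t x)\<^sup>2)) has_integral
        (d * C\<^sub>0 * (N t + I + l * N t) - c\<^sub>1 * I - c\<^sub>3 * (2 * N t - l * (N t / l)))
        + d * (1 + K\<^sub>3) * (N t + I)) {0..l}"
      by (intro has_integral_add has_integral_diff has_integral_mult_right Ri Vi ci)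
    have "integral {0..l} (\<lambda>x. dis e t x + d * (1 + K\<^sub>3) * ((R t x)\<^sup>2 + (V t x)\<^sup>2))
      \<le> (d * C\<^sub>0 * (N t + I + l * N t) - c\<^sub>1 * I - c\<^sub>3 * (2 * N t - l * (N t / l))) + d * (1 + K\<^sub>3) * (N t + I)"
    proof (rule has_integral_le[OF integrable_integral B])
      show "(\<lambda>x. dis e t x + d * (1 + K\<^sub>3) * ((R t x)\<^sup>2 + (V t x)\<^sup>2)) integrable_on {0..l}"
        by (intro integrable_continuous_real continuous_intros cont_error t)
      fix x assume x: "x \<in> {0..l}"
      show "dis e t x + d * (1 + K\<^sub>3) * ((R t x)\<^sup>2 + (V t x)\<^sup>2)
        \<le> (d * C\<^sub>0 * ((R t x)\<^sup>2 + (V t x)\<^sup>2 + N t) - c\<^sub>1 * (V t x)\<^sup>2 - c\<^sub>3 * (2 * (R t x)\<^sup>2 - N t / l))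
        + d * (1 + K\<^sub>3) * ((R t x)\<^sup>2 + (V t x)\<^sup>2)"
        using dis[OF t x \<Phi>_bound[OF t x] \<Psi>_bound[OF t x L[OF t]]] unfolding dis_def by simp
    qed
    \<comment> \<open>Over a pipe of length \<open>l\<close> the bracket
      \<open>2 * N t - l * (N t / l)\<close> is just \<open>N t\<close>.\<close>
    also have "\<dots> = d * C\<^sub>0 * (n t + l * N t) - c\<^sub>1 * I - c\<^sub>3 * N t + d * (1 + K\<^sub>3) * n t"
      using l I by (simp add: algebra_simps)
    also have "\<dots> \<le> d * C\<^sub>0 * (n t + l * n t) - c * I - c * N t + d * (1 + K\<^sub>3) * n t"
      using c d l I by (intro add_mono diff_mono mult_left_mono mult_right_mono) auto
    also have "\<dots> = (d * (1 + K\<^sub>3 + C\<^sub>0 * (1 + l))) * n t - c * n t"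
      using I by (simp add: algebra_simps)
    also have "\<dots> \<le> c / 2 * n t - c * n t"
      using c I by (intro diff_right_mono mult_right_mono) auto
    finally show ?thesis by simp
  qed
  obtain Z where Z: "negligible Z" "\<And>t. t \<in> {0<..<T} - Z \<Longrightarrow> \<exists>D. (energy e has_real_derivative D) (at t) \<and>
    D \<le> integral {0..l} (\<lambda>x. dis e t x + d * (1 + K\<^sub>3) * ((R t x)\<^sup>2 + (V t x)\<^sup>2))"
    using energy_derivative[of e] by blast
  obtain L where "\<forall>s\<in>{0..T}. \<forall>t\<in>{0..T}. \<bar>energy e s - energy e t\<bar> \<le> L * \<bar>s - t\<bar>"
    using energy_lipschitz by blast
  then have "energy e t \<le> energy e 0 * exp (- (c / (2 * k)) * t)"
  proof (intro lipschitz_exp_decay[where K=L, OF _ Z(1) _ t])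
    fix s assume sZ: "s \<in> {0<..<T} - Z"
    then have s: "s \<in> {0..T}" by auto
    obtain D where D: "(energy e has_real_derivative D) (at s)"
      "D \<le> integral {0..l} (\<lambda>x. dis e s x + d * (1 + K\<^sub>3) * ((R s x)\<^sup>2 + (V s x)\<^sup>2))"
      using Z(2)[OF sZ] by blast
    have "c / (2 * k) * energy e s \<le> c / (2 * k) * (k * n s)"
      using eb(2)[OF _ _ s] c k by (intro mult_left_mono) auto
    also have "\<dots> = c / 2 * n s" using k by simp
    finally have "D \<le> - (c / (2 * k)) * energy e s" using D(2) I[OF s] by simp
    with D(1) show "\<exists>D. (energy e has_real_derivative D) (at s) \<and> D \<le> - (c / (2 * k)) * energy e s"
      by blast
  qed auto
  also have "\<dots> \<le> (k * n 0) * exp (- (c / (2 * k)) * t)"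
    using T by (intro mult_right_mono eb(2)) auto
  finally have "m / 4 * n t \<le> (k * n 0) * exp (- (c / (2 * k)) * t)"
    using eb(1)[OF _ _ t] by simp
  then show ?thesis
    unfolding k_def[symmetric] using m by (simp add: field_simps)
qed

end

section \<open>Observer terms and the decay estimate\<close>

lemma positive_bounds_Icc:
  fixes f :: "real \<Rightarrow> real"
  assumes "a \<le> b" "continuous_on {a..b} f" "\<And>y. y \<in> {a..b} \<Longrightarrow> 0 < f y"
  obtains lo hi where "0 < lo" "\<And>y. y \<in> {a..b} \<Longrightarrow> lo \<le> f y" "\<And>y. y \<in> {a..b} \<Longrightarrow> f y \<le> hi"
proof -
  have ne: "compact {a..b}" "{a..b} \<noteq> {}" using assms(1) by auto
  obtain y where y: "y \<in> {a..b}" "\<forall>z\<in>{a..b}. f y \<le> f z"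
    using continuous_attains_inf[OF ne assms(2)] by blast
  obtain z where z: "z \<in> {a..b}" "\<forall>y\<in>{a..b}. f y \<le> f z"
    using continuous_attains_sup[OF ne assms(2)] by blast
  show ?thesis using that[of "f y" "f z"] y z assms(3) by blast
qed

lemma P_tilde_deriv:
  assumes cont: "continuous_on {0<..} (deriv p)" and pos: "\<forall>r>0. 0 < deriv p r" and r: "0 < r\<^sub>r\<^sub>e\<^sub>f" "0 < r"
  shows "(P_tilde p r\<^sub>r\<^sub>e\<^sub>f has_real_derivative sqrt (deriv p r) / (sqrt (deriv p r\<^sub>r\<^sub>e\<^sub>f) * r)) (at r)"
proof -
  \<comment> \<open>A compact interval inside the positive axis that has \<open>r\<close> in its
    interior, so that the derivative within the interval is a full derivative.\<close>
  define lo hi where "lo = min r\<^sub>r\<^sub>e\<^sub>f r / 2" and "hi = max r\<^sub>r\<^sub>e\<^sub>f r + 1"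
  have b: "0 < lo" "lo \<le> r\<^sub>r\<^sub>e\<^sub>f" "r\<^sub>r\<^sub>e\<^sub>f \<le> hi" "lo < r" "r < hi"
    using r by (auto simp: lo_def hi_def)
  have "continuous_on {lo..hi} (deriv p)"
    using b by (intro continuous_on_subset[OF cont]) auto
  then have c: "continuous_on {lo..hi} (\<lambda>s. sqrt (deriv p s) / (sqrt (deriv p r\<^sub>r\<^sub>e\<^sub>f) * s))"
  proof (intro continuous_intros)
    show "\<forall>s\<in>{lo..hi}. sqrt (deriv p r\<^sub>r\<^sub>e\<^sub>f) * s \<noteq> 0"
    proof
      fix s assume "s \<in> {lo..hi}"
      then have "0 < s" using b by simp
      moreover have "0 < deriv p r\<^sub>r\<^sub>e\<^sub>f" using pos r by blast
      ultimately show "sqrt (deriv p r\<^sub>r\<^sub>e\<^sub>f) * s \<noteq> 0" by simp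
    qed
  qed
  have "((\<lambda>u. LBINT s=ereal r\<^sub>r\<^sub>e\<^sub>f..ereal u. sqrt (deriv p s) / (sqrt (deriv p r\<^sub>r\<^sub>e\<^sub>f) * s)) has_vector_derivative
      sqrt (deriv p r) / (sqrt (deriv p r\<^sub>r\<^sub>e\<^sub>f) * r)) (at r within {lo..hi})"
    using b by (intro interval_integral_FTC2 c) auto
  then show ?thesis
    using b by (simp add: P_tilde_def[abs_def] has_real_derivative_iff_has_vector_derivative at_within_Icc_at)
qed

text \<open>By the mean value theorem for \<open>P_tilde\<close> the term equals
  \<open>- k * (r' - r)\<close>, where \<open>k\<close> is the prefactor \<open>g\<close> times a
  value of the derivative \<open>h\<close> and so lies between positive constants. The term thus
  acts like linear damping of the density error.\<close>

lemma density_observer_term: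
  assumes cont: "continuous_on {0<..} (deriv p)" and pos: "\<forall>r>0. 0 < deriv p r" and r: "0 < r\<^sub>r\<^sub>e\<^sub>f" "0 < \<mu>"
    and a: "0 < a" "a \<le> b"
  obtains \<beta> \<Lambda> where "0 < \<beta>" "0 < \<Lambda>"
    "\<And>r r'. r \<in> {a..b} \<Longrightarrow> r' \<in> {a..b} \<Longrightarrow> \<bar>obs_term_\<rho> Density p r\<^sub>r\<^sub>e\<^sub>f \<mu> r r'\<bar> \<le> \<Lambda> * \<bar>r' - r\<bar>"
    "\<And>r r'. r \<in> {a..b} \<Longrightarrow> r' \<in> {a..b} \<Longrightarrow>
      (r' - r) * obs_term_\<rho> Density p r\<^sub>r\<^sub>e\<^sub>f \<mu> r r' \<le> - \<beta> * (r' - r)\<^sup>2"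
proof -
  let ?c = "sqrt (deriv p r\<^sub>r\<^sub>e\<^sub>f)"
  define g where "g y = \<mu> * (?c / sqrt (deriv p y)) * y" for y
  define h where "h y = sqrt (deriv p y) / (?c * y)" for y
  have pc: "continuous_on {a..b} (deriv p)"
    using a by (intro continuous_on_subset[OF cont]) auto
  have p0: "0 < deriv p y" if "y \<in> {a..b}" for y
    using that a pos by auto
  have c0: "0 < ?c" using pos r by simp
  have ne: "\<forall>y\<in>{a..b}. sqrt (deriv p y) \<noteq> 0" "\<forall>y\<in>{a..b}. ?c * y \<noteq> 0"
    using p0 c0 a by force+
  have gc: "continuous_on {a..b} g" and hc: "continuous_on {a..b} h"
    unfolding g_def h_def by (intro continuous_intros pc ne)+
  have g0: "0 < g y" "0 < h y" if "y \<in> {a..b}" for y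
    unfolding g_def h_def using p0[OF that] c0 that a r by (auto intro!: divide_pos_pos mult_pos_pos)
  obtain g1 g2 where g: "0 < g1" "\<And>y. y \<in> {a..b} \<Longrightarrow> g1 \<le> g y" "\<And>y. y \<in> {a..b} \<Longrightarrow> g y \<le> g2"
    using positive_bounds_Icc[OF a(2) gc g0(1)] by blast
  obtain h1 h2 where h: "0 < h1" "\<And>y. y \<in> {a..b} \<Longrightarrow> h1 \<le> h y" "\<And>y. y \<in> {a..b} \<Longrightarrow> h y \<le> h2"
    using positive_bounds_Icc[OF a(2) hc g0(2)] by blast
  note gh = g(1) h(1) g(2,3) h(2,3)
  have hi: "0 < g2" "0 < h2"
    using gh(1,2) gh(3-6)[of a] a by auto
  have main: "\<exists>k. obs_term_\<rho> Density p r\<^sub>r\<^sub>e\<^sub>f \<mu> r r' = - k * (r' - r) \<and> g1 * h1 \<le> k \<and> k \<le> g2 * h2"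
    if rr: "r \<in> {a..b}" "r' \<in> {a..b}" for r r'
  proof -
    have "(P_tilde p r\<^sub>r\<^sub>e\<^sub>f has_real_derivative h y) (at y)" if "y \<in> {a..b}" for y
      unfolding h_def using that a by (intro P_tilde_deriv cont pos r) auto
    from MVT_Icc[OF this rr] obtain \<xi> where \<xi>: "\<xi> \<in> {a..b}"
      "P_tilde p r\<^sub>r\<^sub>e\<^sub>f r' - P_tilde p r\<^sub>r\<^sub>e\<^sub>f r = h \<xi> * (r' - r)" by blast
    have "obs_term_\<rho> Density p r\<^sub>r\<^sub>e\<^sub>f \<mu> r r' = g r' * (P_tilde p r\<^sub>r\<^sub>e\<^sub>f r - P_tilde p r\<^sub>r\<^sub>e\<^sub>f r')"
      by (simp add: g_def)
    also have "\<dots> = - (g r' * (P_tilde p r\<^sub>r\<^sub>e\<^sub>f r' - P_tilde p r\<^sub>r\<^sub>e\<^sub>f r))"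
      by (simp add: algebra_simps)
    also have "\<dots> = - (g r' * h \<xi>) * (r' - r)" unfolding \<xi> by simp
    finally show ?thesis
      using gh(3,4)[OF rr(2)] gh(5,6)[OF \<xi>(1)] gh(1,2) hi g0(1)[OF rr(2)] g0(2)[OF \<xi>(1)]
      by (intro exI[of _ "g r' * h \<xi>"] conjI mult_mono) simp_all
  qed
  show ?thesis
  proof (rule that[of "g1 * h1" "g2 * h2"])
    fix r r' assume rr: "r \<in> {a..b}" "r' \<in> {a..b}"
    obtain k where k: "obs_term_\<rho> Density p r\<^sub>r\<^sub>e\<^sub>f \<mu> r r' = - k * (r' - r)" "g1 * h1 \<le> k" "k \<le> g2 * h2"
      using main[OF rr] by blast
    have k0: "0 \<le> k" using k(2) gh(1,2) by (meson mult_pos_pos less_imp_le order_trans)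
    show "\<bar>obs_term_\<rho> Density p r\<^sub>r\<^sub>e\<^sub>f \<mu> r r'\<bar> \<le> g2 * h2 * \<bar>r' - r\<bar>"
      unfolding k(1) abs_mult using k k0 by (intro mult_right_mono) auto
    have "(g1 * h1) * (r' - r)\<^sup>2 \<le> k * (r' - r)\<^sup>2"
      by (intro mult_right_mono k) auto
    then show "(r' - r) * obs_term_\<rho> Density p r\<^sub>r\<^sub>e\<^sub>f \<mu> r r' \<le> - (g1 * h1) * (r' - r)\<^sup>2"
      unfolding k(1) by (simp add: power2_eq_square mult_ac)
  qed (use gh hi in auto)
qed

text \<open>One statement for the three measurements: the sign of \<open>e\<close> hides behind the
  absolute value, and \<open>\<Lambda>\<close> is 0 for velocity and mass flow measurements, where
  the density equation has no source.\<close>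

lemma observer_dissipation:
  fixes P\<^sub>1 P\<^sub>2 :: "real \<Rightarrow> real"
  assumes cont: "continuous_on {0<..} (deriv p)" and pos: "\<forall>r>0. 0 < deriv p r" and r: "0 < r\<^sub>r\<^sub>e\<^sub>f" "0 < \<mu>"
    and a: "0 < a" "a \<le> b" and \<gamma>: "0 \<le> \<gamma>" and l: "0 < l" and e\<^sub>1: "0 < e\<^sub>1"
    and P: "\<And>y. y \<in> {a..b} \<Longrightarrow> (P\<^sub>1 has_real_derivative P\<^sub>2 y) (at y)"
      "\<And>y. y \<in> {a..b} \<Longrightarrow> \<kappa> \<le> P\<^sub>2 y" "\<And>y. y \<in> {a..b} \<Longrightarrow> P\<^sub>2 y \<le> K" and \<kappa>: "0 < \<kappa>"
  obtains e c\<^sub>1 c\<^sub>3 C\<^sub>0 \<Lambda> where "\<bar>e\<bar> \<le> e\<^sub>1" "0 < c\<^sub>1" "0 < c\<^sub>3" "0 \<le> C\<^sub>0"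
    "\<And>r r'. r \<in> {a..b} \<Longrightarrow> r' \<in> {a..b} \<Longrightarrow> \<bar>obs_term_\<rho> meas p r\<^sub>r\<^sub>e\<^sub>f \<mu> r r'\<bar> \<le> \<Lambda> * \<bar>r' - r\<bar>"
    "\<And>d r r' w w' \<phi> \<psi> z. \<lbrakk>0 < d; d \<le> 1; r \<in> {a..b}; r' \<in> {a..b}; \<bar>w\<bar> \<le> d; \<bar>w'\<bar> \<le> d;
      \<phi>\<^sup>2 \<le> l * z; \<psi>\<^sup>2 \<le> l * (\<Lambda>\<^sup>2 * z)\<rbrakk> \<Longrightarrow>
      dissipation \<gamma> e r' w ((w + w') / 2) (P\<^sub>1 r' - P\<^sub>1 r) (\<bar>w'\<bar> * w' - \<bar>w\<bar> * w)
        (obs_term_\<rho> meas p r\<^sub>r\<^sub>e\<^sub>f \<mu> r r') (obs_term_v meas \<mu> r w r' w') (r' - r) (w' - w) \<phi> \<psi>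
      \<le> d * C\<^sub>0 * ((r' - r)\<^sup>2 + (w' - w)\<^sup>2 + z) - c\<^sub>1 * (w' - w)\<^sup>2 - c\<^sub>3 * (2 * (r' - r)\<^sup>2 - z / l)"
proof -
  have K: "0 < K" using P(2,3)[of a] \<kappa> a by auto
  have A: "\<exists>k. P\<^sub>1 r' - P\<^sub>1 r = k * (r' - r) \<and> \<kappa> \<le> k \<and> k \<le> K" if "r \<in> {a..b}" "r' \<in> {a..b}" for r r'
    using MVT_Icc[OF P(1) that] P(2,3) by metis
  have A1: "\<kappa> * (r' - r)\<^sup>2 \<le> (P\<^sub>1 r' - P\<^sub>1 r) * (r' - r)" "(P\<^sub>1 r' - P\<^sub>1 r) * (r' - r) \<le> K * (r' - r)\<^sup>2"
    if "r \<in> {a..b}" "r' \<in> {a..b}" for r r'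
    using A[OF that] by (auto simp: power2_eq_square mult.assoc intro!: mult_right_mono)
  have s: "\<bar>(w + w') / 2\<bar> \<le> d" if "\<bar>w\<bar> \<le> d" "\<bar>w'\<bar> \<le> d" for w w' d :: real
    using that by auto
  show thesis
  proof (cases "meas = Density")
    case False
    then have L0: "obs_term_\<rho> meas p r\<^sub>r\<^sub>e\<^sub>f \<mu> r r' = 0" for r r'
      by (cases meas) auto
    \<comment> \<open>The first entry is the damping for velocity measurements, the second that for
      mass flow measurements, where half of the square is lost to the mixed term. The constant
      \<open>B\<close> likewise covers both cases.\<close>
    define \<alpha> where "\<alpha> = min (\<mu> * a) (\<mu> * a\<^sup>2 / 2)"
    define B where "B = \<mu> * (1 + b)"
    have \<alpha>: "0 < \<alpha>" and B: "0 \<le> B" and \<mu>: "0 \<le> \<mu>"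
      using a r by (simp_all add: \<alpha>_def B_def)
    have Lv: "(r' * (w' - w) + w * (r' - r)) * obs_term_v meas \<mu> r w r' w'
          \<le> - \<alpha> * (w' - w)\<^sup>2 + d * (\<mu> * ((r' - r)\<^sup>2 + (w' - w)\<^sup>2)) \<and>
        \<bar>obs_term_v meas \<mu> r w r' w'\<bar> \<le> B * \<bar>w' - w\<bar> + d * \<mu> * \<bar>r' - r\<bar>"
      if d: "0 < d" "d \<le> 1" and rr: "r \<in> {a..b}" "r' \<in> {a..b}" and w: "\<bar>w\<bar> \<le> d" for d r r' w w'
    proof -
      define R V where "R = r' - r" and "V = w' - w"
      have wRV: "\<bar>w * R * V\<bar> \<le> d * (R\<^sup>2 + V\<^sup>2)"
      proof -
        have "\<bar>w * R * V\<bar> = \<bar>w\<bar> * (\<bar>R\<bar> * \<bar>V\<bar>)" by (simp add: abs_mult)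
        also have "\<dots> \<le> d * (R\<^sup>2 + V\<^sup>2)"
          using w d by (intro mult_mono abs_mult_le_sum_squares) auto
        finally show ?thesis .
      qed
      have wR: "\<bar>w * R\<bar> \<le> d * \<bar>R\<bar>" unfolding abs_mult using w by (intro mult_right_mono) auto
      show ?thesis
      proof (cases meas)
        case Velocity
        have "\<alpha> \<le> \<mu> * a" by (simp add: \<alpha>_def)
        also have "\<dots> \<le> \<mu> * r'" using rr r by (intro mult_left_mono) auto
        finally have "\<alpha> * V\<^sup>2 \<le> \<mu> * (r' * V\<^sup>2)"
          unfolding mult.assoc[symmetric] by (intro mult_right_mono) auto
        moreover have "- (\<mu> * (w * R * V)) \<le> \<mu> * (d * (R\<^sup>2 + V\<^sup>2))"
          using wRV r mult_left_mono[of "- (w * R * V)" "d * (R\<^sup>2 + V\<^sup>2)" \<mu>] by (simp add: abs_le_iff)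
        ultimately have 1: "(r' * V + w * R) * (- \<mu> * V) \<le> - \<alpha> * V\<^sup>2 + d * (\<mu> * (R\<^sup>2 + V\<^sup>2))"
          by (simp add: algebra_simps power2_eq_square)
        have "\<mu> * \<bar>V\<bar> \<le> B * \<bar>V\<bar>"
          unfolding B_def using r a by (intro mult_right_mono) auto
        moreover have "0 \<le> d * \<mu> * \<bar>R\<bar>" using d r by simp
        ultimately have "\<bar>- \<mu> * V\<bar> \<le> B * \<bar>V\<bar> + d * \<mu> * \<bar>R\<bar>"
          using r by (simp add: abs_mult)
        moreover have "obs_term_v meas \<mu> r w r' w' = - \<mu> * V"
          by (simp add: Velocity V_def algebra_simps)
        ultimately show ?thesis using 1 by (simp only: R_def[symmetric] V_def[symmetric])
      next
        case Mass_Flow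
        define m where "m = r' * V + w * R"
        have o: "obs_term_v meas \<mu> r w r' w' = - \<mu> * m"
          by (simp add: Mass_Flow m_def R_def V_def mass_flow_def algebra_simps)
        \<comment> \<open>Half of this square is
          \<open>m\<^sup>2 - (r' * V)\<^sup>2 / 2 + (w * R)\<^sup>2\<close>.\<close>
        have "0 \<le> (r' * V + 2 * (w * R))\<^sup>2" by simp
        then have "(r' * V)\<^sup>2 / 2 - (w * R)\<^sup>2 \<le> m\<^sup>2"
          by (simp add: m_def power2_eq_square field_simps)
        moreover have "a\<^sup>2 * V\<^sup>2 \<le> (r' * V)\<^sup>2"
          unfolding power_mult_distrib using rr a by (intro mult_right_mono power_mono) auto
        moreover have "(w * R)\<^sup>2 \<le> d * (R\<^sup>2 + V\<^sup>2)"
        proof -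
          have "(w * R)\<^sup>2 = \<bar>w\<bar> * (\<bar>w\<bar> * R\<^sup>2)" by (simp add: power2_eq_square)
          also have "\<dots> \<le> d * (1 * (R\<^sup>2 + V\<^sup>2))" using w d by (intro mult_mono) auto
          finally show ?thesis by simp
        qed
        ultimately have "a\<^sup>2 / 2 * V\<^sup>2 - d * (R\<^sup>2 + V\<^sup>2) \<le> m\<^sup>2" by simp
        then have "\<mu> * (a\<^sup>2 / 2 * V\<^sup>2 - d * (R\<^sup>2 + V\<^sup>2)) \<le> \<mu> * m\<^sup>2" using r by (intro mult_left_mono) auto
        moreover have "\<alpha> * V\<^sup>2 \<le> \<mu> * a\<^sup>2 / 2 * V\<^sup>2" by (intro mult_right_mono) (auto simp: \<alpha>_def)
        moreover have "\<mu> * (a\<^sup>2 / 2 * V\<^sup>2 - d * (R\<^sup>2 + V\<^sup>2)) = \<mu> * a\<^sup>2 / 2 * V\<^sup>2 - d * (\<mu> * (R\<^sup>2 + V\<^sup>2))"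
          by (simp add: algebra_simps)
        moreover have "m * (- \<mu> * m) = - (\<mu> * m\<^sup>2)" by (simp add: power2_eq_square)
        ultimately have 1: "m * (- \<mu> * m) \<le> - \<alpha> * V\<^sup>2 + d * (\<mu> * (R\<^sup>2 + V\<^sup>2))" by linarith
        have "\<bar>m\<bar> \<le> (1 + b) * \<bar>V\<bar> + d * \<bar>R\<bar>"
        proof -
          have "\<bar>r' * V\<bar> \<le> (1 + b) * \<bar>V\<bar>" unfolding abs_mult using rr a by (intro mult_right_mono) auto
          then show ?thesis unfolding m_def using wR by linarith
        qed
        then have "\<mu> * \<bar>m\<bar> \<le> \<mu> * ((1 + b) * \<bar>V\<bar> + d * \<bar>R\<bar>)" using r by (intro mult_left_mono) auto
        then have "\<bar>- \<mu> * m\<bar> \<le> B * \<bar>V\<bar> + d * \<mu> * \<bar>R\<bar>"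
          using r by (simp add: B_def abs_mult algebra_simps)
        with 1 show ?thesis unfolding o by (simp only: R_def[symmetric] V_def[symmetric] m_def[symmetric])
      qed (use False in simp)
    qed
    obtain e c\<^sub>1 c\<^sub>3 C\<^sub>0 where e: "0 < e" "e \<le> e\<^sub>1" "0 < c\<^sub>1" "0 < c\<^sub>3" "0 \<le> C\<^sub>0"
      and dis: "\<And>d r w s A F Lv R V \<Phi> N. \<lbrakk>0 < d; d \<le> 1; a \<le> r; r \<le> b; \<bar>w\<bar> \<le> d; \<bar>s\<bar> \<le> d;
      \<kappa> * R\<^sup>2 \<le> A * R; \<bar>F\<bar> \<le> 2 * d * \<bar>V\<bar>;
      (r * V + w * R) * Lv \<le> - \<alpha> * V\<^sup>2 + d * (\<mu> * (R\<^sup>2 + V\<^sup>2)); \<bar>Lv\<bar> \<le> B * \<bar>V\<bar> + d * \<mu> * \<bar>R\<bar>;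
      \<Phi>\<^sup>2 \<le> l * N\<rbrakk> \<Longrightarrow>
      dissipation \<gamma> (- e) r w s A F 0 Lv R V \<Phi> 0
        \<le> d * C\<^sub>0 * (R\<^sup>2 + V\<^sup>2 + N) - c\<^sub>1 * V\<^sup>2 - c\<^sub>3 * (2 * R\<^sup>2 - N / l)"
      using dissipation_velocity_damping[OF a \<kappa> \<gamma> l \<alpha> B \<mu> e\<^sub>1] by blast
    show thesis
    \<comment> \<open>With 0 in place of \<open>\<Lambda>\<close> the assumption on
      \<open>\<psi>\<close> forces \<open>\<psi> = 0\<close>, which matches the last argument of
      \<open>dissipation\<close> in \<open>dis\<close>.\<close>
    proof (rule that[of "- e" c\<^sub>1 c\<^sub>3 C\<^sub>0 0])
      fix d r r' w w' \<phi> \<psi> z :: real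
      assume d: "0 < d" "d \<le> 1" and rr: "r \<in> {a..b}" "r' \<in> {a..b}" and w: "\<bar>w\<bar> \<le> d" "\<bar>w'\<bar> \<le> d"
        and \<phi>: "\<phi>\<^sup>2 \<le> l * z" and \<psi>: "\<psi>\<^sup>2 \<le> l * (0\<^sup>2 * z)"
      from \<psi> have \<psi>0: "\<psi> = 0" by simp
      show "dissipation \<gamma> (- e) r' w ((w + w') / 2) (P\<^sub>1 r' - P\<^sub>1 r) (\<bar>w'\<bar> * w' - \<bar>w\<bar> * w)
          (obs_term_\<rho> meas p r\<^sub>r\<^sub>e\<^sub>f \<mu> r r') (obs_term_v meas \<mu> r w r' w') (r' - r) (w' - w) \<phi> \<psi>
        \<le> d * C\<^sub>0 * ((r' - r)\<^sup>2 + (w' - w)\<^sup>2 + z) - c\<^sub>1 * (w' - w)\<^sup>2 - c\<^sub>3 * (2 * (r' - r)\<^sup>2 - z / l)"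
        unfolding L0 \<psi>0
        using d rr w \<phi> A1[OF rr] abs_square_diff_le[OF w] Lv[OF d rr w(1), of w'] s[OF w]
        by (intro dis) auto
    qed (use e L0 in auto)
  next
    case True
    obtain \<beta> \<Lambda> where \<beta>: "0 < \<beta>" "0 < \<Lambda>"
      and L1: "\<And>r r'. r \<in> {a..b} \<Longrightarrow> r' \<in> {a..b} \<Longrightarrow> \<bar>obs_term_\<rho> Density p r\<^sub>r\<^sub>e\<^sub>f \<mu> r r'\<bar> \<le> \<Lambda> * \<bar>r' - r\<bar>"
      and L2: "\<And>r r'. r \<in> {a..b} \<Longrightarrow> r' \<in> {a..b} \<Longrightarrow>
      (r' - r) * obs_term_\<rho> Density p r\<^sub>r\<^sub>e\<^sub>f \<mu> r r' \<le> - \<beta> * (r' - r)\<^sup>2"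
      using density_observer_term[OF cont pos r a] by blast
    have AL: "(P\<^sub>1 r' - P\<^sub>1 r) * obs_term_\<rho> Density p r\<^sub>r\<^sub>e\<^sub>f \<mu> r r' \<le> - (\<kappa> * \<beta>) * (r' - r)\<^sup>2"
      if rr: "r \<in> {a..b}" "r' \<in> {a..b}" for r r'
    proof -
      obtain k where k: "P\<^sub>1 r' - P\<^sub>1 r = k * (r' - r)" "\<kappa> \<le> k" using A[OF rr] by blast
      have "(P\<^sub>1 r' - P\<^sub>1 r) * obs_term_\<rho> Density p r\<^sub>r\<^sub>e\<^sub>f \<mu> r r'
          = k * ((r' - r) * obs_term_\<rho> Density p r\<^sub>r\<^sub>e\<^sub>f \<mu> r r')" unfolding k(1) by simp
      also have "\<dots> \<le> k * (- \<beta> * (r' - r)\<^sup>2)" using L2[OF rr] k \<kappa> by (intro mult_left_mono) auto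
      also have "\<dots> \<le> - (\<kappa> * \<beta>) * (r' - r)\<^sup>2"
        using mult_right_mono[of \<kappa> k "\<beta> * (r' - r)\<^sup>2"] k \<beta> by (simp add: mult_ac)
      finally show ?thesis .
    qed
    have \<kappa>\<beta>: "0 < \<kappa> * \<beta>" using \<kappa> \<beta> by simp
    obtain e c\<^sub>1 c\<^sub>3 C\<^sub>0 where e: "0 < e" "e \<le> e\<^sub>1" "0 < c\<^sub>1" "0 < c\<^sub>3" "0 \<le> C\<^sub>0"
      and dis: "\<And>d r w s A F Lr R V \<Phi> \<Psi> N. \<lbrakk>0 < d; d \<le> 1; a \<le> r; r \<le> b; \<bar>w\<bar> \<le> d; \<bar>s\<bar> \<le> d;
      A * R \<le> K * R\<^sup>2; \<bar>F\<bar> \<le> 2 * d * \<bar>V\<bar>; A * Lr \<le> - (\<kappa> * \<beta>) * R\<^sup>2; \<bar>Lr\<bar> \<le> \<Lambda> * \<bar>R\<bar>;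
      \<Phi>\<^sup>2 \<le> l * N; \<Psi>\<^sup>2 \<le> l * (\<Lambda>\<^sup>2 * N)\<rbrakk> \<Longrightarrow>
      dissipation \<gamma> e r w s A F Lr 0 R V \<Phi> \<Psi>
        \<le> d * C\<^sub>0 * (R\<^sup>2 + V\<^sup>2 + N) - c\<^sub>1 * V\<^sup>2 - c\<^sub>3 * (2 * R\<^sup>2 - N / l)"
      using dissipation_density_damping[OF a K \<gamma> l \<kappa>\<beta> \<beta>(2) e\<^sub>1] by blast
    show thesis
    proof (rule that[of e c\<^sub>1 c\<^sub>3 C\<^sub>0 \<Lambda>])
      fix d r r' w w' \<phi> \<psi> z :: real
      assume d: "0 < d" "d \<le> 1" and rr: "r \<in> {a..b}" "r' \<in> {a..b}" and w: "\<bar>w\<bar> \<le> d" "\<bar>w'\<bar> \<le> d"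
        and \<phi>: "\<phi>\<^sup>2 \<le> l * z" "\<psi>\<^sup>2 \<le> l * (\<Lambda>\<^sup>2 * z)"
      show "dissipation \<gamma> e r' w ((w + w') / 2) (P\<^sub>1 r' - P\<^sub>1 r) (\<bar>w'\<bar> * w' - \<bar>w\<bar> * w)
          (obs_term_\<rho> meas p r\<^sub>r\<^sub>e\<^sub>f \<mu> r r') (obs_term_v meas \<mu> r w r' w') (r' - r) (w' - w) \<phi> \<psi>
        \<le> d * C\<^sub>0 * ((r' - r)\<^sup>2 + (w' - w)\<^sup>2 + z) - c\<^sub>1 * (w' - w)\<^sup>2 - c\<^sub>3 * (2 * (r' - r)\<^sup>2 - z / l)"
        unfolding True obs_term_v.simps
        using rr by (intro dis d w \<phi> A1[OF rr] abs_square_diff_le[OF w] AL[OF rr] L1[OF rr] s[OF w]) auto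
    qed (use e L1 True in auto)
  qed
qed

lemma continuous_on_observer_terms:
  fixes r r' w w' :: "real \<Rightarrow> real"
  assumes cont: "continuous_on {0<..} (deriv p)" and pos: "\<forall>r>0. 0 < deriv p r" and ref: "0 < r\<^sub>r\<^sub>e\<^sub>f" and a: "0 < a"
    and r: "continuous_on X r" "continuous_on X r'" "\<And>x. x \<in> X \<Longrightarrow> r x \<in> {a..b}" "\<And>x. x \<in> X \<Longrightarrow> r' x \<in> {a..b}"
    and w: "continuous_on X w" "continuous_on X w'"
  shows "continuous_on X (\<lambda>x. obs_term_\<rho> meas p r\<^sub>r\<^sub>e\<^sub>f \<mu> (r x) (r' x))"
    and "continuous_on X (\<lambda>x. obs_term_v meas \<mu> (r x) (w x) (r' x) (w' x))"
proof -
  have sub: "r ` X \<subseteq> {0<..}" "r' ` X \<subseteq> {0<..}" using r(3,4) a by fastforce+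
  have "continuous_on {0<..} (P_tilde p r\<^sub>r\<^sub>e\<^sub>f)"
    using P_tilde_deriv[OF cont pos ref] by (auto intro!: continuous_at_imp_continuous_on DERIV_isCont)
  note c = continuous_on_compose2[OF this r(1) sub(1)] continuous_on_compose2[OF this r(2) sub(2)]
    continuous_on_compose2[OF cont r(2) sub(2)]
  have ne: "\<forall>x\<in>X. sqrt (deriv p (r' x)) \<noteq> 0"
  proof
    fix x assume "x \<in> X"
    then have "0 < r' x" using sub(2) by blast
    with pos have "0 < deriv p (r' x)" by blast
    then show "sqrt (deriv p (r' x)) \<noteq> 0" by simp
  qed
  show "continuous_on X (\<lambda>x. obs_term_\<rho> meas p r\<^sub>r\<^sub>e\<^sub>f \<mu> (r x) (r' x))"
  proof (cases meas)
    case Density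
    show ?thesis
      unfolding Density obs_term_\<rho>.simps by (intro continuous_intros c r(2) ne)
  qed simp_all
  show "continuous_on X (\<lambda>x. obs_term_v meas \<mu> (r x) (w x) (r' x) (w' x))"
  proof (cases meas)
    case Velocity
    show ?thesis
      unfolding Velocity obs_term_v.simps by (intro continuous_intros w)
  next
    case Mass_Flow
    show ?thesis
      unfolding Mass_Flow obs_term_v.simps mass_flow_def by (intro continuous_intros w r(1,2))
  qed simp
qed

section \<open>Smooth constitutive functions and the choice of the constants\<close>

lemma smooth_pos_DERIV:
  assumes "smooth_pos f" "0 < r"
  shows "((deriv ^^ n) f has_real_derivative (deriv ^^ Suc n) f r) (at r)"
  using assms by (simp add: smooth_pos_def DERIV_deriv_iff_real_differentiable)

lemma smooth_pos_continuous_on: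
  assumes "smooth_pos f" "A \<subseteq> {0<..}"
  shows "continuous_on A ((deriv ^^ n) f)"
  using assms smooth_pos_DERIV by (blast intro!: continuous_at_imp_continuous_on DERIV_isCont)

lemma L2_norm_eq:
  assumes "continuous_on {0..l} f" "continuous_on {0..l} g"
  shows "L2_norm l (\<lambda>x. (f x, g x)) = sqrt (integral {0..l} (\<lambda>x. (f x)\<^sup>2 + (g x)\<^sup>2))"
proof -
  have "continuous_on {0..l} (\<lambda>x. (norm (f x, g x))\<^sup>2)"
    by (intro continuous_intros assms)
  from LINT_continuous_eq_integral[OF this] show ?thesis
    by (simp add: L2_norm_def norm_Pair)
qed

theorem theorem4p2:
  fixes p P :: "real \<Rightarrow> real"
    and \<gamma> l \<mu> r\<^sub>r\<^sub>e\<^sub>f \<rho>\<^sub>m\<^sub>i\<^sub>n \<rho>\<^sub>m\<^sub>a\<^sub>x v\<^sub>m\<^sub>a\<^sub>x :: real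
    and meas :: measurement
  assumes "smooth_pos p" and "strict_mono_on {0<..} p" and "\<forall>r>0. deriv p r > 0"
    and "smooth_pos P" and "strictly_convex_on {0<..} P"
    and "\<forall>r>0. deriv p r = r * deriv (deriv P) r"
    and "\<gamma> \<ge> 0" and "l > 0" and "\<mu> > 0" and "r\<^sub>r\<^sub>e\<^sub>f > 0"
    and "\<rho>\<^sub>m\<^sub>i\<^sub>n > 0" and "\<rho>\<^sub>m\<^sub>a\<^sub>x > 0" and "v\<^sub>m\<^sub>a\<^sub>x > 0"
    and A2: "\<forall>r\<in>{\<rho>\<^sub>m\<^sub>i\<^sub>n..\<rho>\<^sub>m\<^sub>a\<^sub>x}. r * deriv (deriv P) r \<ge> 4 * \<bar>v\<^sub>m\<^sub>a\<^sub>x\<bar>\<^sup>2"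
  shows "\<exists>\<delta>>0. \<forall>C\<^sub>t v\<^sub>b\<^sub>a\<^sub>r. 0 < C\<^sub>t \<and> C\<^sub>t \<le> \<delta> \<and> 0 < v\<^sub>b\<^sub>a\<^sub>r \<and> v\<^sub>b\<^sub>a\<^sub>r \<le> \<delta> \<longrightarrow>
    (\<exists>C\<^sub>1>0. \<exists>C\<^sub>2>0. \<forall>T>0. \<forall>\<rho> v \<rho>' v' :: real \<Rightarrow> real \<Rightarrow> real.
      \<forall>\<rho>\<^sub>0 v\<^sub>0 \<rho>\<^sub>0' v\<^sub>0' m\<^sub>b h\<^sub>b :: real \<Rightarrow> real.
      \<comment> \<open>the two systems\<close>
      solves_original P \<gamma> l T \<rho> v \<and>
      solves_observer meas p P r\<^sub>r\<^sub>e\<^sub>f \<mu> \<gamma> l T \<rho> v \<rho>' v' \<and>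
      \<comment> \<open>initial and boundary conditions\<close>
      (\<forall>x\<in>{0<..<l}. \<rho> 0 x = \<rho>\<^sub>0 x \<and> v 0 x = v\<^sub>0 x \<and> \<rho>' 0 x = \<rho>\<^sub>0' x \<and> v' 0 x = v\<^sub>0' x) \<and>
      (\<forall>t\<in>{0..T}.
         mass_flow (\<rho> t 0) (v t 0) = m\<^sub>b t \<and> mass_flow (\<rho>' t 0) (v' t 0) = m\<^sub>b t \<and>
         enthalpy P (\<rho> t l) (v t l) = h\<^sub>b t \<and> enthalpy P (\<rho>' t l) (v' t l) = h\<^sub>b t) \<and>
      \<comment> \<open>(A1)\<close>
      regular T l \<rho> \<and> regular T l v \<and>
      (\<forall>t\<in>{0..T}. \<forall>x\<in>{0..l}.
         \<rho>\<^sub>m\<^sub>i\<^sub>n \<le> \<rho> t x \<and> \<rho> t x \<le> \<rho>\<^sub>m\<^sub>a\<^sub>x \<and> - v\<^sub>m\<^sub>a\<^sub>x \<le> v t x \<and> v t x \<le> v\<^sub>m\<^sub>a\<^sub>x) \<and>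
      \<comment> \<open>(A3)\<close>
      regular T l \<rho>' \<and> regular T l v' \<and>
      (\<forall>t\<in>{0..T}. \<forall>x\<in>{0..l}.
         \<rho>\<^sub>m\<^sub>i\<^sub>n \<le> \<rho>' t x \<and> \<rho>' t x \<le> \<rho>\<^sub>m\<^sub>a\<^sub>x \<and> - v\<^sub>m\<^sub>a\<^sub>x \<le> v' t x \<and> v' t x \<le> v\<^sub>m\<^sub>a\<^sub>x) \<and>
      \<comment> \<open>(A4)\<close>
      Linf_Linf_norm T l (weak_time_deriv T l \<rho>) + Linf_Linf_norm T l (weak_time_deriv T l v)
        \<le> ereal C\<^sub>t \<and>
      Linf_Linf_norm T l v \<le> ereal v\<^sub>b\<^sub>a\<^sub>r \<and> Linf_Linf_norm T l v' \<le> ereal v\<^sub>b\<^sub>a\<^sub>r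
      \<longrightarrow>
      (\<forall>t\<in>{0..T}.
         L2_norm l (\<lambda>x. (\<rho> t x - \<rho>' t x, v t x - v' t x))
           \<le> C\<^sub>1 * L2_norm l (\<lambda>x. (\<rho>\<^sub>0 x - \<rho>\<^sub>0' x, v\<^sub>0 x - v\<^sub>0' x)) * exp (- C\<^sub>2 * t)))"
proof -
  define a where "a = \<rho>\<^sub>m\<^sub>i\<^sub>n"
  \<comment> \<open>The maximum keeps {a..b} nonempty even if
    \<open>\<rho>\<^sub>m\<^sub>a\<^sub>x\<close> lies below
    \<open>\<rho>\<^sub>m\<^sub>i\<^sub>n\<close>.\<close>
  define b where "b = max \<rho>\<^sub>m\<^sub>i\<^sub>n \<rho>\<^sub>m\<^sub>a\<^sub>x"
  define P\<^sub>1 where "P\<^sub>1 = deriv P"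
  define P\<^sub>2 where "P\<^sub>2 = deriv P\<^sub>1"
  define P\<^sub>3 where "P\<^sub>3 = deriv P\<^sub>2"
  have a: "0 < a" "a \<le> b" using \<open>\<rho>\<^sub>m\<^sub>i\<^sub>n > 0\<close> by (auto simp: a_def b_def)
  have ab: "{a..b} \<subseteq> {0<..}" using a by auto
  have P: "(P has_real_derivative P\<^sub>1 y) (at y)" "(P\<^sub>1 has_real_derivative P\<^sub>2 y) (at y)"
    "(P\<^sub>2 has_real_derivative P\<^sub>3 y) (at y)" if "0 < y" for y
    using smooth_pos_DERIV[OF \<open>smooth_pos P\<close> that, of 0] smooth_pos_DERIV[OF \<open>smooth_pos P\<close> that, of 1]
      smooth_pos_DERIV[OF \<open>smooth_pos P\<close> that, of 2]
    by (simp_all add: P\<^sub>1_def P\<^sub>2_def P\<^sub>3_def eval_nat_numeral)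
  have Pc: "continuous_on {a..b} P\<^sub>2" "continuous_on {a..b} P\<^sub>3"
    using smooth_pos_continuous_on[OF \<open>smooth_pos P\<close> ab, of 2] smooth_pos_continuous_on[OF \<open>smooth_pos P\<close> ab, of 3]
    by (simp_all add: P\<^sub>1_def P\<^sub>2_def P\<^sub>3_def eval_nat_numeral)
  have p: "continuous_on {0<..} (deriv p)"
    using smooth_pos_continuous_on[OF \<open>smooth_pos p\<close>, of "{0<..}" 1] by simp
  \<comment> \<open>Positivity comes from p' > 0 through p'(\<rho>) = \<rho> P''(\<rho>); strict
    convexity alone would allow zeros of P''.\<close>
  have P2pos: "0 < P\<^sub>2 y" if "y \<in> {a..b}" for y
  proof -
    have "0 < y" using that a by auto
    then have "0 < y * P\<^sub>2 y"
      using \<open>\<forall>r>0. deriv p r > 0\<close> \<open>\<forall>r>0. deriv p r = r * deriv (deriv P) r\<close> by (simp add: P\<^sub>1_def P\<^sub>2_def)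
    with \<open>0 < y\<close> show ?thesis by (simp add: zero_less_mult_iff)
  qed
  obtain \<kappa> K where \<kappa>: "0 < \<kappa>" and P2: "\<And>y. y \<in> {a..b} \<Longrightarrow> \<kappa> \<le> P\<^sub>2 y" "\<And>y. y \<in> {a..b} \<Longrightarrow> P\<^sub>2 y \<le> K"
    using positive_bounds_Icc[OF a(2) Pc(1) P2pos] by blast
  have "bounded (P\<^sub>3 ` {a..b})"
    using Pc(2) by (intro compact_imp_bounded compact_continuous_image) auto
  then obtain K\<^sub>3 where "\<forall>y\<in>P\<^sub>3 ` {a..b}. norm y \<le> K\<^sub>3"
    unfolding bounded_iff by blast
  then have P3: "\<bar>P\<^sub>3 y\<bar> \<le> K\<^sub>3" if "y \<in> {a..b}" for y
    using that by auto
  have "a \<in> {a..b}" using a by simp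
  then have "\<kappa> \<le> P\<^sub>2 a" "P\<^sub>2 a \<le> K" "\<bar>P\<^sub>3 a\<bar> \<le> K\<^sub>3" by (rule P2 P3)+
  then have K: "0 < K" "0 \<le> K\<^sub>3" using \<kappa> by linarith+
  have P12: "(P\<^sub>1 has_real_derivative P\<^sub>2 y) (at y)" if "y \<in> {a..b}" for y
    using that a by (intro P) auto
  define m where "m = min a \<kappa>"
  have m: "0 < m" "m \<le> a" "m \<le> \<kappa>" using a \<kappa> by (auto simp: m_def)
  have l2: "0 < 1 + l\<^sup>2" using \<open>l > 0\<close> by (simp add: add_pos_nonneg)
  \<comment> \<open>The limit for the absolute value of \<open>e\<close> under which the functional
    stays comparable to the squared norm; it has to be known before \<open>e\<close> is
    chosen.\<close>
  then have e1: "0 < m / (4 * (1 + l\<^sup>2))" using m by simp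
  obtain e c\<^sub>1 c\<^sub>3 C\<^sub>0 \<Lambda> where e: "\<bar>e\<bar> \<le> m / (4 * (1 + l\<^sup>2))" "0 < c\<^sub>1" "0 < c\<^sub>3" "0 \<le> C\<^sub>0"
    and L: "\<And>r r'. r \<in> {a..b} \<Longrightarrow> r' \<in> {a..b} \<Longrightarrow> \<bar>obs_term_\<rho> meas p r\<^sub>r\<^sub>e\<^sub>f \<mu> r r'\<bar> \<le> \<Lambda> * \<bar>r' - r\<bar>"
    and dis: "\<And>d r r' w w' \<phi> \<psi> z. \<lbrakk>0 < d; d \<le> 1; r \<in> {a..b}; r' \<in> {a..b}; \<bar>w\<bar> \<le> d; \<bar>w'\<bar> \<le> d;
      \<phi>\<^sup>2 \<le> l * z; \<psi>\<^sup>2 \<le> l * (\<Lambda>\<^sup>2 * z)\<rbrakk> \<Longrightarrow>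
      dissipation \<gamma> e r' w ((w + w') / 2) (P\<^sub>1 r' - P\<^sub>1 r) (\<bar>w'\<bar> * w' - \<bar>w\<bar> * w)
        (obs_term_\<rho> meas p r\<^sub>r\<^sub>e\<^sub>f \<mu> r r') (obs_term_v meas \<mu> r w r' w') (r' - r) (w' - w) \<phi> \<psi>
      \<le> d * C\<^sub>0 * ((r' - r)\<^sup>2 + (w' - w)\<^sup>2 + z) - c\<^sub>1 * (w' - w)\<^sup>2 - c\<^sub>3 * (2 * (r' - r)\<^sup>2 - z / l)"
    using observer_dissipation[where meas=meas, OF p \<open>\<forall>r>0. deriv p r > 0\<close> \<open>r\<^sub>r\<^sub>e\<^sub>f > 0\<close> \<open>\<mu> > 0\<close> a
        \<open>\<gamma> \<ge> 0\<close> \<open>l > 0\<close> e1 P12 P2 \<kappa>] by blast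
  have em: "\<bar>e\<bar> * (1 + l\<^sup>2) \<le> m / 4" using e(1) l2 by (simp add: field_simps)
  define c where "c = min c\<^sub>1 c\<^sub>3"
  have c: "0 < c" "c \<le> c\<^sub>1" "c \<le> c\<^sub>3" using e by (auto simp: c_def)
  define D where "D = 1 + K\<^sub>3 + C\<^sub>0 * (1 + l)"
  have D: "0 < D" using K e \<open>l > 0\<close> by (simp add: D_def add_pos_nonneg)
  \<comment> \<open>The threshold for C_t and the velocity bound. It comes after \<open>e\<close>,
    since \<open>D\<close> contains \<open>C\<^sub>0\<close>. The three entries serve the pointwise
    estimates, the comparison of functional and norm, and the absorption by half of the
    damping.\<close>
  define d where "d = min 1 (min (m / 4) (c / (2 * D)))"
  have dm: "0 < d" "d \<le> 1" "d \<le> m / 4" using m c D by (auto simp: d_def)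
  have "d \<le> c / (2 * D)" by (simp add: d_def)
  then have dD: "d * D \<le> c / 2" using D by (simp add: field_simps)
  define k where "k = b + K + m"
  have k: "0 < k" using a K m by (simp add: k_def)
  \<comment> \<open>The constants for the squared norm, adapted to the norm: the factor goes under a
    root and the rate \<open>c / (2 * k)\<close> is halved. Neither involves C_t or the velocity
    bound, as the estimate is run with \<open>d\<close> in their place.\<close>
  define C1 where "C1 = sqrt (4 * k / m)"
  define C2 where "C2 = c / (4 * k)"
  have C: "0 < C1" "0 < C2" using k m c by (simp_all add: C1_def C2_def)
  have main: "L2_norm l (\<lambda>x. (\<rho> t x - \<rho>' t x, v t x - v' t x))
           \<le> C1 * L2_norm l (\<lambda>x. (\<rho>\<^sub>0 x - \<rho>\<^sub>0' x, v\<^sub>0 x - v\<^sub>0' x)) * exp (- C2 * t)"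
    if T: "0 < T" and sol: "solves_original P \<gamma> l T \<rho> v"
      and obs: "solves_observer meas p P r\<^sub>r\<^sub>e\<^sub>f \<mu> \<gamma> l T \<rho> v \<rho>' v'"
      and init: "\<forall>x\<in>{0<..<l}. \<rho> 0 x = \<rho>\<^sub>0 x \<and> v 0 x = v\<^sub>0 x \<and> \<rho>' 0 x = \<rho>\<^sub>0' x \<and> v' 0 x = v\<^sub>0' x"
      and bc: "\<forall>t\<in>{0..T}. mass_flow (\<rho> t 0) (v t 0) = m\<^sub>b t \<and> mass_flow (\<rho>' t 0) (v' t 0) = m\<^sub>b t \<and>
         enthalpy P (\<rho> t l) (v t l) = h\<^sub>b t \<and> enthalpy P (\<rho>' t l) (v' t l) = h\<^sub>b t"
      and reg: "regular T l \<rho>" "regular T l v" "regular T l \<rho>'" "regular T l v'"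
      and rb: "\<forall>t\<in>{0..T}. \<forall>x\<in>{0..l}. \<rho>\<^sub>m\<^sub>i\<^sub>n \<le> \<rho> t x \<and> \<rho> t x \<le> \<rho>\<^sub>m\<^sub>a\<^sub>x"
        "\<forall>t\<in>{0..T}. \<forall>x\<in>{0..l}. \<rho>\<^sub>m\<^sub>i\<^sub>n \<le> \<rho>' t x \<and> \<rho>' t x \<le> \<rho>\<^sub>m\<^sub>a\<^sub>x"
      and Ct: "Linf_Linf_norm T l (weak_time_deriv T l \<rho>) + Linf_Linf_norm T l (weak_time_deriv T l v) \<le> ereal d"
      and vb: "Linf_Linf_norm T l v \<le> ereal d" "Linf_Linf_norm T l v' \<le> ereal d"
      and t: "t \<in> {0..T}"
    for T t \<rho> v \<rho>' v' \<rho>\<^sub>0 v\<^sub>0 \<rho>\<^sub>0' v\<^sub>0' m\<^sub>b h\<^sub>b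
  proof -
    note l = \<open>l > 0\<close>
    \<comment> \<open>Both norms are nonnegative, so the bound of their sum bounds each.\<close>
    have Ct': "Linf_Linf_norm T l (weak_time_deriv T l \<rho>) \<le> ereal d" "Linf_Linf_norm T l (weak_time_deriv T l v) \<le> ereal d"
      by (rule order_trans[OF _ Ct], simp add: ereal_le_add_self ereal_le_add_self2 Linf_Linf_norm_nonneg[OF T l])+
    have rb': "\<rho> t x \<in> {a..b}" "\<rho>' t x \<in> {a..b}" if "t \<in> {0..T}" "x \<in> {0..l}" for t x
      using rb that by (auto simp: a_def b_def le_max_iff_disj)
    have cx: "continuous_on {0..l} (\<rho> t)" "continuous_on {0..l} (v t)" "continuous_on {0..l} (\<rho>' t)"
      "continuous_on {0..l} (v' t)" if "t \<in> {0..T}" for t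
      using reg that by (auto simp: regular_def C0_W1inf_def in_W1inf_def)
    interpret error_system P P\<^sub>1 P\<^sub>2 P\<^sub>3 a b \<gamma> l T d K\<^sub>3 \<rho> v \<rho>' v'
      "\<lambda>t x. obs_term_\<rho> meas p r\<^sub>r\<^sub>e\<^sub>f \<mu> (\<rho> t x) (\<rho>' t x)"
      "\<lambda>t x. obs_term_v meas \<mu> (\<rho> t x) (v t x) (\<rho>' t x) (v' t x)"
    proof
      show "d-lipschitz_on {0..T} (\<lambda>t. \<rho> t x)" "d-lipschitz_on {0..T} (\<lambda>t. v t x)" if "x \<in> {0..l}" for x
        using regular_time_lipschitz(2)[OF T l reg(1) Ct'(1) that] regular_time_lipschitz(2)[OF T l reg(2) Ct'(2) that]
        by auto
      show "\<exists>C. \<forall>x\<in>{0..l}. C-lipschitz_on {0..T} (\<lambda>t. \<rho>' t x)" "\<exists>C. \<forall>x\<in>{0..l}. C-lipschitz_on {0..T} (\<lambda>t. v' t x)"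
        using regular_time_lipschitz(1)[OF T l] reg by auto
      show "\<exists>C. C-lipschitz_on {0..l} (\<rho> t)" "\<exists>C. C-lipschitz_on {0..l} (v t)"
        "\<exists>C. C-lipschitz_on {0..l} (\<rho>' t)" "\<exists>C. C-lipschitz_on {0..l} (v' t)" if "t \<in> {0..T}" for t
        by (rule regular_space_lipschitz[OF l _ that], rule reg)+
      show "\<bar>v t x\<bar> \<le> d" "\<bar>v' t x\<bar> \<le> d" if "t \<in> {0..T}" "x \<in> {0..l}" for t x
        using regular_Linf_Linf_norm_leD[OF T l reg(2) vb(1) that] regular_Linf_Linf_norm_leD[OF T l reg(4) vb(2) that]
        by auto
      show "\<rho> t 0 * v t 0 = \<rho>' t 0 * v' t 0"
        "(v t l)\<^sup>2 / 2 + P\<^sub>1 (\<rho> t l) = (v' t l)\<^sup>2 / 2 + P\<^sub>1 (\<rho>' t l)" if "t \<in> {0..T}" for t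
        using bc that by (auto simp: mass_flow_def enthalpy_def P\<^sub>1_def)
      show "continuous_on {0..l} (\<lambda>x. obs_term_\<rho> meas p r\<^sub>r\<^sub>e\<^sub>f \<mu> (\<rho> t x) (\<rho>' t x))"
        "continuous_on {0..l} (\<lambda>x. obs_term_v meas \<mu> (\<rho> t x) (v t x) (\<rho>' t x) (v' t x))" if "t \<in> {0..T}" for t
        by (rule continuous_on_observer_terms[OF p \<open>\<forall>r>0. deriv p r > 0\<close> \<open>r\<^sub>r\<^sub>e\<^sub>f > 0\<close> a(1)
              cx(1)[OF that] cx(3)[OF that] rb'(1)[OF that] rb'(2)[OF that] cx(2)[OF that] cx(4)[OF that]]; assumption)+
      show "AE (t, x) in lborel. t \<in> {0<..<T} \<and> x \<in> {0<..<l} \<longrightarrow>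
       (\<exists>\<rho>\<^sub>t m\<^sub>x v\<^sub>t h\<^sub>x.
          ((\<lambda>s. \<rho> s x) has_real_derivative \<rho>\<^sub>t) (at t) \<and>
          ((\<lambda>y. \<rho> t y * v t y) has_real_derivative m\<^sub>x) (at x) \<and>
          ((\<lambda>s. v s x) has_real_derivative v\<^sub>t) (at t) \<and>
          ((\<lambda>y. (v t y)\<^sup>2 / 2 + P\<^sub>1 (\<rho> t y)) has_real_derivative h\<^sub>x) (at x) \<and>
          \<rho>\<^sub>t + m\<^sub>x = 0 \<and> v\<^sub>t + h\<^sub>x = - \<gamma> * \<bar>v t x\<bar> * v t x)"
        using sol unfolding solves_original_def solves_system_def mass_flow_def enthalpy_def P\<^sub>1_def add_0_right .
      show "AE (t, x) in lborel. t \<in> {0<..<T} \<and> x \<in> {0<..<l} \<longrightarrow>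
       (\<exists>\<rho>\<^sub>t m\<^sub>x v\<^sub>t h\<^sub>x.
          ((\<lambda>s. \<rho>' s x) has_real_derivative \<rho>\<^sub>t) (at t) \<and>
          ((\<lambda>y. \<rho>' t y * v' t y) has_real_derivative m\<^sub>x) (at x) \<and>
          ((\<lambda>s. v' s x) has_real_derivative v\<^sub>t) (at t) \<and>
          ((\<lambda>y. (v' t y)\<^sup>2 / 2 + P\<^sub>1 (\<rho>' t y)) has_real_derivative h\<^sub>x) (at x) \<and>
          \<rho>\<^sub>t + m\<^sub>x = obs_term_\<rho> meas p r\<^sub>r\<^sub>e\<^sub>f \<mu> (\<rho> t x) (\<rho>' t x) \<and>
          v\<^sub>t + h\<^sub>x = - \<gamma> * \<bar>v' t x\<bar> * v' t x + obs_term_v meas \<mu> (\<rho> t x) (v t x) (\<rho>' t x) (v' t x))"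
        using obs unfolding solves_observer_def solves_system_def mass_flow_def enthalpy_def P\<^sub>1_def .
      show "0 < a" "a \<le> b" "0 \<le> \<gamma>" "0 < l" "0 < T" "0 < d" "d \<le> 1" by fact+
    qed (fact P P3 rb')+
    have n: "n t \<le> 4 * k / m * n 0 * exp (- (c / (2 * k)) * t)"
      unfolding k_def
    proof (rule decay[OF P2 \<kappa> m dm(3) em c dD[unfolded D_def] e(4) _ _ t])
      show "\<bar>obs_term_\<rho> meas p r\<^sub>r\<^sub>e\<^sub>f \<mu> (\<rho> t x) (\<rho>' t x)\<bar> \<le> \<Lambda> * \<bar>R t x\<bar>"
        if "t \<in> {0..T}" "x \<in> {0..l}" for t x
        unfolding R_def by (intro L rb' that)
      show "dissipation \<gamma> e (\<rho>' t x) (v t x) (S t x) (A t x) (F t x)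
          (obs_term_\<rho> meas p r\<^sub>r\<^sub>e\<^sub>f \<mu> (\<rho> t x) (\<rho>' t x)) (obs_term_v meas \<mu> (\<rho> t x) (v t x) (\<rho>' t x) (v' t x))
          (R t x) (V t x) \<phi> \<psi>
        \<le> d * C\<^sub>0 * ((R t x)\<^sup>2 + (V t x)\<^sup>2 + z) - c\<^sub>1 * (V t x)\<^sup>2 - c\<^sub>3 * (2 * (R t x)\<^sup>2 - z / l)"
        if "t \<in> {0..T}" "x \<in> {0..l}" "\<phi>\<^sup>2 \<le> l * z" "\<psi>\<^sup>2 \<le> l * (\<Lambda>\<^sup>2 * z)" for t x \<phi> \<psi> z
        unfolding R_def V_def S_def A_def F_def by (intro dis dm rb' bounds that)
    qed
    have L2: "L2_norm l (\<lambda>x. (\<rho> s x - \<rho>' s x, v s x - v' s x)) = sqrt (n s)" if "s \<in> {0..T}" for s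
    proof -
      have "L2_norm l (\<lambda>x. (\<rho> s x - \<rho>' s x, v s x - v' s x))
          = sqrt (integral {0..l} (\<lambda>x. (\<rho> s x - \<rho>' s x)\<^sup>2 + (v s x - v' s x)\<^sup>2))"
        by (intro L2_norm_eq continuous_intros cx that)
      also have "\<dots> = sqrt (n s)"
        unfolding n_def R_def V_def power2_commute[of "\<rho> s _"] power2_commute[of "v s _"] ..
      finally show ?thesis .
    qed
    \<comment> \<open>The initial data are prescribed on the open interval, which is all that the L2
      norm sees.\<close>
    have "L2_norm l (\<lambda>x. (\<rho>\<^sub>0 x - \<rho>\<^sub>0' x, v\<^sub>0 x - v\<^sub>0' x)) = L2_norm l (\<lambda>x. (\<rho> 0 x - \<rho>' 0 x, v 0 x - v' 0 x))"
      unfolding L2_norm_def using init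
      by (intro arg_cong[where f=sqrt] set_lebesgue_integral_cong) auto
    also have "\<dots> = sqrt (n 0)" using T by (intro L2) auto
    finally have L20: "L2_norm l (\<lambda>x. (\<rho>\<^sub>0 x - \<rho>\<^sub>0' x, v\<^sub>0 x - v\<^sub>0' x)) = sqrt (n 0)" .
    have ex: "sqrt (exp (- (c / (2 * k)) * t)) = exp (- C2 * t)"
    proof (rule real_sqrt_unique)
      have "(exp (- C2 * t))\<^sup>2 = exp (2 * (- C2 * t))"
        by (rule exp_double[symmetric])
      also have "2 * (- C2 * t) = - (c / (2 * k)) * t" by (simp add: C2_def)
      finally show "(exp (- C2 * t))\<^sup>2 = exp (- (c / (2 * k)) * t)" .
    qed simp
    show ?thesis
      using real_sqrt_le_mono[OF n] unfolding L2[OF t] L20 C1_def real_sqrt_mult ex .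
  qed
  show ?thesis
  proof (rule exI[of _ d], intro conjI dm(1) allI impI, rule exI[of _ C1], rule conjI[OF C(1)],
      rule exI[of _ C2], rule conjI[OF C(2)], intro allI impI, elim conjE)
    fix C\<^sub>t v\<^sub>b\<^sub>a\<^sub>r T :: real and \<rho> v \<rho>' v' :: "real \<Rightarrow> real \<Rightarrow> real"
      and \<rho>\<^sub>0 v\<^sub>0 \<rho>\<^sub>0' v\<^sub>0' m\<^sub>b h\<^sub>b :: "real \<Rightarrow> real"
    assume le: "C\<^sub>t \<le> d" "v\<^sub>b\<^sub>a\<^sub>r \<le> d" and T: "0 < T" and s: "solves_original P \<gamma> l T \<rho> v"
      "solves_observer meas p P r\<^sub>r\<^sub>e\<^sub>f \<mu> \<gamma> l T \<rho> v \<rho>' v'"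
      "\<forall>x\<in>{0<..<l}. \<rho> 0 x = \<rho>\<^sub>0 x \<and> v 0 x = v\<^sub>0 x \<and> \<rho>' 0 x = \<rho>\<^sub>0' x \<and> v' 0 x = v\<^sub>0' x"
      "\<forall>t\<in>{0..T}. mass_flow (\<rho> t 0) (v t 0) = m\<^sub>b t \<and> mass_flow (\<rho>' t 0) (v' t 0) = m\<^sub>b t \<and>
         enthalpy P (\<rho> t l) (v t l) = h\<^sub>b t \<and> enthalpy P (\<rho>' t l) (v' t l) = h\<^sub>b t"
      and reg: "regular T l \<rho>" "regular T l v" "regular T l \<rho>'" "regular T l v'"
      and rb: "\<forall>t\<in>{0..T}. \<forall>x\<in>{0..l}. \<rho>\<^sub>m\<^sub>i\<^sub>n \<le> \<rho> t x \<and> \<rho> t x \<le> \<rho>\<^sub>m\<^sub>a\<^sub>x \<and> - v\<^sub>m\<^sub>a\<^sub>x \<le> v t x \<and> v t x \<le> v\<^sub>m\<^sub>a\<^sub>x"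
        "\<forall>t\<in>{0..T}. \<forall>x\<in>{0..l}. \<rho>\<^sub>m\<^sub>i\<^sub>n \<le> \<rho>' t x \<and> \<rho>' t x \<le> \<rho>\<^sub>m\<^sub>a\<^sub>x \<and> - v\<^sub>m\<^sub>a\<^sub>x \<le> v' t x \<and> v' t x \<le> v\<^sub>m\<^sub>a\<^sub>x"
      and n: "Linf_Linf_norm T l (weak_time_deriv T l \<rho>) + Linf_Linf_norm T l (weak_time_deriv T l v) \<le> ereal C\<^sub>t"
        "Linf_Linf_norm T l v \<le> ereal v\<^sub>b\<^sub>a\<^sub>r" "Linf_Linf_norm T l v' \<le> ereal v\<^sub>b\<^sub>a\<^sub>r"
    have n': "Linf_Linf_norm T l (weak_time_deriv T l \<rho>) + Linf_Linf_norm T l (weak_time_deriv T l v) \<le> ereal d"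
      "Linf_Linf_norm T l v \<le> ereal d" "Linf_Linf_norm T l v' \<le> ereal d"
      using order_trans[OF n(1)] order_trans[OF n(2)] order_trans[OF n(3)] le by simp_all
    have rb': "\<forall>t\<in>{0..T}. \<forall>x\<in>{0..l}. \<rho>\<^sub>m\<^sub>i\<^sub>n \<le> \<rho> t x \<and> \<rho> t x \<le> \<rho>\<^sub>m\<^sub>a\<^sub>x"
        "\<forall>t\<in>{0..T}. \<forall>x\<in>{0..l}. \<rho>\<^sub>m\<^sub>i\<^sub>n \<le> \<rho>' t x \<and> \<rho>' t x \<le> \<rho>\<^sub>m\<^sub>a\<^sub>x"
      using rb by blast+
    show "\<forall>t\<in>{0..T}. L2_norm l (\<lambda>x. (\<rho> t x - \<rho>' t x, v t x - v' t x))
           \<le> C1 * L2_norm l (\<lambda>x. (\<rho>\<^sub>0 x - \<rho>\<^sub>0' x, v\<^sub>0 x - v\<^sub>0' x)) * exp (- C2 * t)"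
    proof
      fix t assume "t \<in> {0..T}"
      then show "L2_norm l (\<lambda>x. (\<rho> t x - \<rho>' t x, v t x - v' t x))
           \<le> C1 * L2_norm l (\<lambda>x. (\<rho>\<^sub>0 x - \<rho>\<^sub>0' x, v\<^sub>0 x - v\<^sub>0' x)) * exp (- C2 * t)"
        by (rule main[OF T s reg rb' n'])
    qed
  qed
qed

end
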